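(* Let $d\ge 2$ and let $\Omega$ be a bounded domain in $\mathbb R^d$ such that $\lim_{h\to0^+}\frac{|\omega_h|}{h}=|\partial\Omega|$, with Dirichlet Laplacian eigenvalues $\lambda_1\le\lambda_2\le\dots$. Then for all positive integers $k\geq |\Omega|\,r_{\Omega}^{-d}\left(\frac{d+2}{2C_d}\right)^{d/2}$, $$\frac1{k}\sum_{j=1}^k\lambda_{j}\leq \frac{d}{d+2}\,C_d\left(\frac{k}{|\Omega|}\right)^{\frac{2}{d}}+2\left(\frac{2 C_d}{d+2}\right)^{\frac{1}{2}}\frac{|\partial\Omega|}{|\Omega|}\left(\frac{k}{|\Omega|}\right)^{\frac{1}{d}}+R(k),$$ where $R(k)=o(k^{1/d})$ as $k\to+\infty$, and $R(k)$ is an explicit function of $k$, $d$, $|\Omega|$, $|\partial\Omega|$ and $|\omega_{h(k)}|$ only, with $h(k)=(d+2)^{1/2}(2C_d)^{-1/2}|\Omega|^{1/d}k^{-1/d}$.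
   Context: The eigenvalues are those of the (nonnegative) Dirichlet Laplacian $-\Delta_\Omega^D$ in $L^2(\Omega)$, repeated according to multiplicity. For $h>0$, $\omega_h:=\{x\in\Omega:\operatorname{dist}(x,\partial\Omega)\le h\}$. The inradius is $r_{\Omega}:=\max_{x\in\Omega}\min_{y\in\partial\Omega}|x-y|$. $|\Omega|$, $|\omega_h|$ are Lebesgue measures and $|\partial\Omega|$ is the $(d-1)$-dimensional Hausdorff measure of the boundary (finite by the assumption); $\omega_d=\pi^{d/2}/\Gamma(1+d/2)$ is the volume of the unit ball in $\mathbb R^d$ (not to be confused with the set $\omega_h$); $C_d=4\pi^2\omega_d^{-2/d}$. *)

theory Defs
  imports "HOL-Analysis.Analysis" "HOL-Library.Landau_Symbols"
begin

section \<open>The Dirichlet Laplacian\<close>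

text \<open>Functions of class $C^n$ on the whole space: the partial derivatives of a function with
  gradient \<open>G\<close> are the functions \<open>\<lambda>x. G x \<bullet> b\<close> for \<open>b \<in> Basis\<close>.\<close>

primrec C_k :: "nat \<Rightarrow> ('a::euclidean_space \<Rightarrow> real) \<Rightarrow> bool" where
  "C_k 0 f \<longleftrightarrow> continuous_on UNIV f"
| "C_k (Suc n) f \<longleftrightarrow>
     (\<exists>G. (\<forall>x. GDERIV f x :> G x) \<and> (\<forall>b\<in>Basis. C_k n (\<lambda>x. G x \<bullet> b)))"

definition test_function :: "'a::euclidean_space set \<Rightarrow> ('a \<Rightarrow> real) \<Rightarrow> bool" where
  "test_function \<Omega> \<phi> \<longleftrightarrow>
     (\<forall>n. C_k n \<phi>) \<and> compact (closure {x. \<phi> x \<noteq> 0}) \<and> closure {x. \<phi> x \<noteq> 0} \<subseteq> \<Omega>"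

text \<open>Elements of $L^2$ and of the spaces below are represented by functions on the whole space;
  only their values on \<open>\<Omega>\<close>, up to null sets, matter.\<close>

definition in_L2 :: "'a::euclidean_space set \<Rightarrow> ('a \<Rightarrow> 'b::euclidean_space) \<Rightarrow> bool" where
  "in_L2 \<Omega> f \<longleftrightarrow>
     f \<in> borel_measurable (lebesgue_on \<Omega>) \<and> integrable (lebesgue_on \<Omega>) (\<lambda>x. (norm (f x))\<^sup>2)"

text \<open>\<open>in_H10 \<Omega> u g\<close>: \<open>u\<close> is in $H^1_0(\Omega)$, the closure of $C_c^\infty(\Omega)$ in the
  $H^1$-norm, and \<open>g\<close> is its weak gradient. The gradient is determined by \<open>u\<close> up to a null set.\<close>

definition in_H10 :: "'a::euclidean_space set \<Rightarrow> ('a \<Rightarrow> real) \<Rightarrow> ('a \<Rightarrow> 'a) \<Rightarrow> bool" where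
  "in_H10 \<Omega> u g \<longleftrightarrow> in_L2 \<Omega> u \<and> in_L2 \<Omega> g \<and>
     (\<exists>\<phi> G. (\<forall>n. test_function \<Omega> (\<phi> n) \<and> (\<forall>x. GDERIV (\<phi> n) x :> G n x)) \<and>
        (\<lambda>n. LINT x|lebesgue_on \<Omega>. (\<phi> n x - u x)\<^sup>2) \<longlonglongrightarrow> 0 \<and>
        (\<lambda>n. LINT x|lebesgue_on \<Omega>. (norm (G n x - g x))\<^sup>2) \<longlonglongrightarrow> 0)"

text \<open>The graph of the nonnegative Dirichlet Laplacian $-\Delta^D_\Omega$, the operator in
  $L^2(\Omega)$ associated with the form $\int_\Omega \nabla u\cdot\nabla v$ on $H^1_0(\Omega)$:
  \<open>u\<close> is in the domain and is mapped to \<open>f\<close>. The space $L^2(\Omega)$ is taken over the reals; the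
  complex one has the same eigenvalues with the same multiplicities.\<close>

definition dirichlet_laplacian :: "'a::euclidean_space set \<Rightarrow> ('a \<Rightarrow> real) \<Rightarrow> ('a \<Rightarrow> real) \<Rightarrow> bool" where
  "dirichlet_laplacian \<Omega> u f \<longleftrightarrow> in_L2 \<Omega> f \<and>
     (\<exists>g. in_H10 \<Omega> u g \<and>
        (\<forall>v gv. in_H10 \<Omega> v gv \<longrightarrow>
           (LINT x|lebesgue_on \<Omega>. g x \<bullet> gv x) = (LINT x|lebesgue_on \<Omega>. f x * v x)))"

definition independent_L2 :: "'a::euclidean_space set \<Rightarrow> nat \<Rightarrow> (nat \<Rightarrow> 'a \<Rightarrow> real) \<Rightarrow> bool" where
  "independent_L2 \<Omega> n u \<longleftrightarrow>
     (\<forall>c. (AE x in lebesgue_on \<Omega>. (\<Sum>i<n. c i * u i x) = 0) \<longrightarrow> (\<forall>i<n. c i = 0))"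

definition independent_eigenfunctions :: "'a::euclidean_space set \<Rightarrow> real \<Rightarrow> nat \<Rightarrow> bool" where
  "independent_eigenfunctions \<Omega> \<mu> n \<longleftrightarrow>
     (\<exists>u. (\<forall>i<n. dirichlet_laplacian \<Omega> (u i) (\<lambda>x. \<mu> * u i x)) \<and> independent_L2 \<Omega> n u)"

text \<open>\<open>eigenspace_dim \<Omega> \<mu> m\<close>: the eigenspace of \<open>\<mu>\<close> has finite dimension \<open>m\<close>, where \<open>m = 0\<close> means
  that \<open>\<mu>\<close> is not an eigenvalue.\<close>

definition eigenspace_dim :: "'a::euclidean_space set \<Rightarrow> real \<Rightarrow> nat \<Rightarrow> bool" where
  "eigenspace_dim \<Omega> \<mu> m \<longleftrightarrow>
     independent_eigenfunctions \<Omega> \<mu> m \<and> \<not> independent_eigenfunctions \<Omega> \<mu> (Suc m)"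

text \<open>\<open>\<lambda> 1 \<le> \<lambda> 2 \<le> \<dots>\<close> are all the eigenvalues, repeated according to multiplicity; the value
  \<open>\<lambda> 0\<close> plays no role.\<close>

definition dirichlet_eigenvalues :: "'a::euclidean_space set \<Rightarrow> (nat \<Rightarrow> real) \<Rightarrow> bool" where
  "dirichlet_eigenvalues \<Omega> lam \<longleftrightarrow> mono_on {1..} lam \<and>
     (\<forall>\<mu>. finite {j. 1 \<le> j \<and> lam j = \<mu>} \<and> eigenspace_dim \<Omega> \<mu> (card {j. 1 \<le> j \<and> lam j = \<mu>}))"


section \<open>Geometric quantities\<close>

text \<open>The \<open>s\<close>-dimensional Hausdorff measure for \<open>s > 0\<close>, normalised so that it is the surface area
  for integer \<open>s\<close>. (For \<open>s = 0\<close> the convention \<open>0 powr 0 = 0\<close> would give a wrong result.)\<close>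

definition hausdorff_content :: "real \<Rightarrow> real \<Rightarrow> 'a::euclidean_space set \<Rightarrow> ennreal" where
  "hausdorff_content s \<delta> A =
     (INF U \<in> {U :: nat \<Rightarrow> 'a set. A \<subseteq> (\<Union>i. U i) \<and> (\<forall>i. bounded (U i) \<and> diameter (U i) \<le> \<delta>)}.
        \<Sum>i. ennreal (unit_ball_vol s * (diameter (U i) / 2) powr s))"

definition hausdorff_measure :: "real \<Rightarrow> 'a::euclidean_space set \<Rightarrow> ennreal" where
  "hausdorff_measure s A = (SUP \<delta>\<in>{0<..}. hausdorff_content s \<delta> A)"

definition boundary_area :: "'a::euclidean_space set \<Rightarrow> ennreal" where
  "boundary_area \<Omega> = hausdorff_measure (real DIM('a) - 1) (frontier \<Omega>)"

definition boundary_layer :: "'a::euclidean_space set \<Rightarrow> real \<Rightarrow> 'a set" where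
  "boundary_layer \<Omega> h = {x \<in> \<Omega>. infdist x (frontier \<Omega>) \<le> h}"

text \<open>For a nonempty bounded open set the supremum is a maximum, since the distance to the boundary
  is continuous on the compact closure and vanishes on the boundary.\<close>

definition inradius :: "'a::euclidean_space set \<Rightarrow> real" where
  "inradius \<Omega> = (SUP x\<in>\<Omega>. infdist x (frontier \<Omega>))"

definition C_const :: "nat \<Rightarrow> real" where
  "C_const d = 4 * pi\<^sup>2 * unit_ball_vol (real d) powr (- 2 / real d)"

definition layer_width :: "nat \<Rightarrow> real \<Rightarrow> nat \<Rightarrow> real" where
  "layer_width d V k =
     (real d + 2) powr (1/2) * (2 * C_const d) powr (-1/2) * V powr (1 / real d) * real k powr (- 1 / real d)"

end

theory Submission
  imports Defs "HOL-Complex_Analysis.Great_Picard" "HOL-Probability.Characteristic_Functions"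
    "HOL-Real_Asymp.Real_Asymp" "HOL-Library.Diagonal_Subsequence"
begin

text \<open>
  Let \<open>w\<^sub>i\<close> be the first \<open>k\<close> eigenfunctions and \<open>z\<close> the \<open>k\<close>-th eigenvalue. Since the energy is at least
  \<open>z\<close> on the complement of their span, \<open>z \<parallel>f\<parallel>\<^sup>2 - \<parallel>\<nabla>f\<parallel>\<^sup>2 \<le> \<Sum>\<^sub>i (z - \<mu>\<^sub>i) \<langle>f, w\<^sub>i\<rangle>\<^sup>2\<close> for all \<open>f\<close> in
  the form domain. This is applied to \<open>\<phi> cos (p \<bullet> x)\<close> and \<open>\<phi> sin (p \<bullet> x)\<close> for a cutoff function
  \<open>0 \<le> \<phi> \<le> 1\<close>, and integrated over \<open>norm p \<le> \<rho>\<close>; by Plancherel's inequality for \<open>\<phi> w\<^sub>i\<close> each coefficient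
  on the right contributes at most \<open>(2 pi)\<^sup>d\<close>. The choice of \<open>\<rho>\<close> that makes \<open>z\<close> cancel gives
  \<open>1/k \<Sum> \<lambda>\<^sub>j \<le> d/(d+2) C\<^sub>d (k / \<parallel>\<phi>\<parallel>\<^sup>2) powr (2/d) + \<parallel>\<nabla>\<phi>\<parallel>\<^sup>2 / \<parallel>\<phi>\<parallel>\<^sup>2\<close>. For \<open>\<phi>\<close> close to
  \<open>min 1 (dist / h)\<close> the mass is at least \<open>|\<Omega>| - |\<omega>\<^sub>h|\<close> and the energy at most \<open>|\<omega>\<^sub>h| / h\<^sup>2\<close>, and \<open>h(k)\<close>
  minimizes the leading terms. The eigenfunctions themselves are found by successive minimization, where
  Rellich's theorem provides the compactness.
\<close>

section \<open>Smooth functions\<close>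

text \<open>The numbers \<open>lam j\<close> are known only through the dimensions of eigenspaces;
  no basis of eigenfunctions and no min-max formula is given for them. The proof therefore builds
  its own system \<open>w\<close>, \<open>\<mu>\<close> and compares by counting multiplicities:
  \<open>lam j \<le> \<mu> (j - 1)\<close>, and this one-sided inequality suffices for an upper
  bound. Since each value has finite multiplicity, the list \<open>lam\<close> has infinitely many
  values, which keeps the successive minimization from stopping.

  The factor 2 in the second term is a balance of two corrections. Put K = (k/V)^(1/d) and B = (2
  C_d/(d+2))^(1/2), and let the layer have volume about S h. Replacing V by V minus this volume in
  the leading term costs about B^2 K^2 S h / V, and the energy of the cutoff costs about S / (h V).
  Their sum is least at h = 1/(B K), which is h(k), and there each of them equals B K S / V.\<close>

lemma C_k_Suc_imp: "C_k (Suc n) f \<Longrightarrow> C_k n f"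
proof (induction n arbitrary: f)
  case 0
  then obtain G where "\<And>x. GDERIV f x :> G x" by auto
  then show ?case
    by (auto simp: gderiv_def continuous_on_eq_continuous_at intro: has_derivative_continuous)
next
  case (Suc n)
  then show ?case by (metis C_k.simps(2))
qed

lemma C_k_imp_continuous: "C_k n f \<Longrightarrow> continuous_on UNIV f"
proof (induction n)
  case (Suc n)
  then show ?case using C_k_Suc_imp by blast
qed simp

lemma C_k_const: "C_k n (\<lambda>x. c)"
proof (induction n arbitrary: c)
  case (Suc n)
  then show ?case
    unfolding C_k.simps by (intro exI[of _ "\<lambda>x. 0"]) (simp add: GDERIV_const)
qed simp

lemma C_k_inner: "C_k n (\<lambda>x. x \<bullet> p)"
proof (cases n)
  case (Suc m)
  have "GDERIV (\<lambda>x. x \<bullet> p) x :> p" for x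
    unfolding gderiv_def by (rule bounded_linear_imp_has_derivative[OF bounded_linear_inner_left])
  then show ?thesis
    unfolding Suc C_k.simps by (intro exI[of _ "\<lambda>x. p"]) (simp add: C_k_const)
qed (simp add: continuous_on_inner)

lemma C_k_add: "C_k n f \<Longrightarrow> C_k n g \<Longrightarrow> C_k n (\<lambda>x. f x + g x)"
proof (induction n arbitrary: f g)
  case (Suc n)
  obtain F where F: "\<And>x. GDERIV f x :> F x" "\<And>b. b \<in> Basis \<Longrightarrow> C_k n (\<lambda>x. F x \<bullet> b)"
    using Suc.prems(1) by auto
  obtain G where G: "\<And>x. GDERIV g x :> G x" "\<And>b. b \<in> Basis \<Longrightarrow> C_k n (\<lambda>x. G x \<bullet> b)"
    using Suc.prems(2) by auto
  note * = F G
  show ?case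
    unfolding C_k.simps
    by (rule exI[of _ "\<lambda>x. F x + G x"])
       (auto intro!: GDERIV_add * Suc.IH simp: inner_add_left)
qed (simp add: continuous_on_add)

lemma C_k_mult: "C_k n f \<Longrightarrow> C_k n g \<Longrightarrow> C_k n (\<lambda>x. f x * g x)"
proof (induction n arbitrary: f g)
  case (Suc n)
  obtain F where F: "\<And>x. GDERIV f x :> F x" "\<And>b. b \<in> Basis \<Longrightarrow> C_k n (\<lambda>x. F x \<bullet> b)"
    using Suc.prems(1) by auto
  obtain G where G: "\<And>x. GDERIV g x :> G x" "\<And>b. b \<in> Basis \<Longrightarrow> C_k n (\<lambda>x. G x \<bullet> b)"
    using Suc.prems(2) by auto
  note * = F G
  have "C_k n f" "C_k n g"
    using Suc.prems C_k_Suc_imp by blast+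
  then have "C_k n (\<lambda>x. f x * (G x \<bullet> b) + g x * (F x \<bullet> b))" if "b \<in> Basis" for b
    using * that by (intro C_k_add Suc.IH)
  then show ?case
    unfolding C_k.simps
    by (intro exI[of _ "\<lambda>x. f x *\<^sub>R G x + g x *\<^sub>R F x"]) (simp add: GDERIV_mult * inner_add_left)
qed (simp add: continuous_on_mult)

lemma C_k_sum: "(\<And>i. i \<in> A \<Longrightarrow> C_k n (f i)) \<Longrightarrow> C_k n (\<lambda>x. \<Sum>i\<in>A. f i x)"
  by (induction A rule: infinite_finite_induct) (auto intro!: C_k_const C_k_add)

text \<open>The induction on the order has to treat all \<open>g i\<close> together: differentiating
  one member gives a linear combination of members, times the gradient of \<open>q\<close>. This
  covers the pair sine and cosine as well as the functions \<open>flat_exp m\<close>.\<close>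

lemma C_k_compose_real:
  fixes g :: "'i \<Rightarrow> real \<Rightarrow> real"
  assumes g: "\<And>i t. (g i has_real_derivative (\<Sum>j\<in>J i. c i j * g j t)) (at t)"
    and q: "\<And>n. C_k n q"
  shows "C_k n (\<lambda>x. g i (q x))"
proof (induction n arbitrary: i)
  case 0
  have "continuous_on UNIV (g i)"
    using g by (meson DERIV_continuous_on DERIV_subset subset_UNIV)
  moreover have "continuous_on UNIV q" using q[of 0] by simp
  ultimately show ?case
    by (auto intro: continuous_on_compose2)
next
  case (Suc n)
  obtain Q where Q: "\<And>x. GDERIV q x :> Q x" "\<And>b. b \<in> Basis \<Longrightarrow> C_k n (\<lambda>x. Q x \<bullet> b)"
    using q[of "Suc n"] by auto
  show ?case
    unfolding C_k.simps
    by (rule exI[of _ "\<lambda>x. (\<Sum>j\<in>J i. c i j * g j (q x)) *\<^sub>R Q x"])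
       (auto intro!: GDERIV_DERIV_compose[OF Q(1) g] C_k_mult C_k_sum C_k_const Q Suc.IH)
qed

lemma C_k_cos: "C_k n (\<lambda>x. cos (x \<bullet> p))" and C_k_sin: "C_k n (\<lambda>x. sin (x \<bullet> p))"
proof -
  \<comment> \<open>The index \<open>True\<close> stands for cosine; differentiation exchanges the
    two indices up to the sign \<open>c\<close>.\<close>
  define g where "g = (\<lambda>b. if b then cos else (sin :: real \<Rightarrow> real))"
  define c where "c = (\<lambda>b (j::bool). if b then - 1 else (1::real))"
  have g: "(g i has_real_derivative (\<Sum>j\<in>{\<not> i}. c i j * g j t)) (at t)" for i t
    by (cases i) (auto simp: g_def c_def intro!: derivative_eq_intros)
  have "C_k n (\<lambda>x. g b (x \<bullet> p))" for b
    by (rule C_k_compose_real[OF g C_k_inner])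
  from this[of True] this[of False] show "C_k n (\<lambda>x. cos (x \<bullet> p))" "C_k n (\<lambda>x. sin (x \<bullet> p))"
    by (simp_all add: g_def)
qed

text \<open>The powers of 1/t make the family closed under differentiation, as
  \<open>C_k_compose_real\<close> requires; n = 0 is the classical smooth function that is flat at
  0.\<close>

definition flat_exp :: "nat \<Rightarrow> real \<Rightarrow> real" where
  "flat_exp n t = (if t > 0 then (1 / t) ^ n * exp (- 1 / t) else 0)"

text \<open>Only t = 0 is delicate: there the right-hand difference quotient is s^(n+1) / exp s with
  s = 1/t, which tends to 0.\<close>

lemma flat_exp_deriv:
  "(flat_exp n has_real_derivative flat_exp (n + 2) t - real n * flat_exp (n + 1) t) (at t)"
proof -
  consider "t > 0" | "t < 0" | "t = 0" by linarith
  then show ?thesis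
  proof cases
    case 1
    have "((\<lambda>t. (1 / t) ^ n * exp (- 1 / t)) has_real_derivative
        (1 / t) ^ (n + 2) * exp (- 1 / t) - real n * ((1 / t) ^ (n + 1) * exp (- 1 / t))) (at t)"
    proof -
      have 0: "((\<lambda>t. 1 / t) has_real_derivative - (1 / t)\<^sup>2) (at t)"
        using 1 by (auto intro!: derivative_eq_intros simp: power2_eq_square)
      have 2: "((\<lambda>t. - 1 / t) has_real_derivative (1 / t)\<^sup>2) (at t)"
        using DERIV_minus[OF 0] by simp
      have "((\<lambda>t. (1 / t) ^ n * exp (- 1 / t)) has_real_derivative
        (real n * ((1 / t) ^ (n - Suc 0) * - (1 / t)\<^sup>2)) * exp (- 1 / t) + (exp (- 1 / t) * (1 / t)\<^sup>2) * (1 / t) ^ n) (at t)"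
        using DERIV_mult[OF DERIV_power[OF 0, of n] DERIV_chain2[OF DERIV_exp 2]]
        by (simp add: mult_ac)
      moreover have "(real n * (s ^ (n - Suc 0) * - s\<^sup>2)) * e + (e * s\<^sup>2) * s ^ n
          = s ^ (n + 2) * e - real n * (s ^ (n + 1) * e)" for s e :: real
        by (cases n) (auto simp: power2_eq_square algebra_simps)
      ultimately show ?thesis by simp
    qed
    then show ?thesis
      using 1 by (auto simp: flat_exp_def elim!: has_field_derivative_transform_within_open[where S = "{0<..}"])
  next
    case 2
    have "(flat_exp n has_real_derivative 0) (at t)"
      by (rule has_field_derivative_transform_within_open[where f = "\<lambda>_. 0" and S = "{..<0}"])
         (use 2 in \<open>auto simp: flat_exp_def\<close>)
    then show ?thesis
      using 2 by (simp add: flat_exp_def)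
  next
    case 3
    have "((\<lambda>s::real. s ^ Suc n / exp s) \<longlongrightarrow> 0) at_top" by (rule tendsto_power_div_exp_0)
    then have "((\<lambda>h. inverse h ^ Suc n / exp (inverse h)) \<longlongrightarrow> 0) (at_right (0::real))"
      by (rule filterlim_compose[OF _ filterlim_inverse_at_top_right])
    then have "((\<lambda>h. (flat_exp n h - flat_exp n 0) / h) \<longlongrightarrow> 0) (at_right (0::real))"
    proof (rule Lim_transform_eventually)
      show "\<forall>\<^sub>F h in at_right 0. inverse h ^ Suc n / exp (inverse h) = (flat_exp n h - flat_exp n 0) / h"
        by (rule eventually_at_rightI[of 0 1])
           (auto simp: flat_exp_def exp_minus divide_inverse mult_ac)
    qed
    moreover have "((\<lambda>h. (flat_exp n h - flat_exp n 0) / h) \<longlongrightarrow> 0) (at_left (0::real))"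
    proof (rule tendsto_eventually)
      show "\<forall>\<^sub>F h in at_left 0. (flat_exp n h - flat_exp n 0) / h = 0"
        by (rule eventually_at_leftI[of "-1"]) (auto simp: flat_exp_def)
    qed
    ultimately have "((\<lambda>h. (flat_exp n h - flat_exp n 0) / h) \<longlongrightarrow> 0) (at (0::real))"
      using filterlim_split_at by blast
    then show ?thesis using 3
      by (simp add: DERIV_def flat_exp_def)
  qed
qed

lemma bump_exists:
  fixes r :: real
  assumes "r > 0"
  shows "\<exists>\<eta> :: 'a::euclidean_space \<Rightarrow> real. (\<forall>n. C_k n \<eta>) \<and> (\<forall>x. \<eta> x \<ge> 0) \<and> \<eta> 0 > 0 \<and> (\<forall>x. norm x \<ge> r \<longrightarrow> \<eta> x = 0)"
proof -
  \<comment> \<open>This is r^2 minus the squared norm, spelled out in coordinates so that the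
    closure rules for \<open>C_k\<close> apply.\<close>
  define q where "q = (\<lambda>x::'a. r\<^sup>2 + (-1) * (\<Sum>b\<in>Basis. (x \<bullet> b) * (x \<bullet> b)))"
  have q: "q x = r\<^sup>2 - (norm x)\<^sup>2" for x
    unfolding q_def power2_norm_eq_inner euclidean_inner[of x x] by simp
  have Cq: "C_k n q" for n
    unfolding q_def by (intro C_k_add C_k_mult C_k_sum C_k_const C_k_inner)
  define c where "c = (\<lambda>i j. if j = i + 2 then 1 else - real i)"
  have fe: "(flat_exp i has_real_derivative (\<Sum>j\<in>{i + 1, i + 2}. c i j * flat_exp j t)) (at t)" for i t
    using flat_exp_deriv[of i t] by (simp add: c_def)
  have C: "C_k n (\<lambda>x. flat_exp m (q x))" for n m
    by (rule C_k_compose_real[OF fe Cq])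
  have "flat_exp 0 (q x) = 0" if "norm x \<ge> r" for x
  proof -
    have "q x \<le> 0" using that assms by (simp add: q power_mono)
    then show ?thesis by (simp add: flat_exp_def)
  qed
  moreover have "flat_exp 0 (q x) \<ge> 0" for x
    by (simp add: flat_exp_def)
  moreover have "flat_exp 0 (q 0) > 0"
    using assms by (simp add: flat_exp_def q)
  ultimately show ?thesis using C
    by (intro exI[of _ "\<lambda>x. flat_exp 0 (q x)"]) blast
qed

section \<open>The space of square integrable functions\<close>

text \<open>Functions are not identified up to null sets, so this form is only positive semidefinite
  and \<open>L2_norm\<close> only a seminorm. The general codomain lets functions and gradients
  share one theory.\<close>

definition L2_inner :: "'a::euclidean_space set \<Rightarrow> ('a \<Rightarrow> 'b::euclidean_space) \<Rightarrow> ('a \<Rightarrow> 'b) \<Rightarrow> real" where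
  "L2_inner \<Omega> f g = (LINT x|lebesgue_on \<Omega>. f x \<bullet> g x)"

definition L2_norm :: "'a::euclidean_space set \<Rightarrow> ('a \<Rightarrow> 'b::euclidean_space) \<Rightarrow> real" where
  "L2_norm \<Omega> f = sqrt (L2_inner \<Omega> f f)"

lemma in_L2_measurable: "in_L2 \<Omega> f \<Longrightarrow> f \<in> borel_measurable (lebesgue_on \<Omega>)"
  by (simp add: in_L2_def)

lemma in_L2_boundI:
  assumes "f \<in> borel_measurable (lebesgue_on \<Omega>)" "integrable (lebesgue_on \<Omega>) h"
    and "\<And>x. (norm (f x))\<^sup>2 \<le> h x"
  shows "in_L2 \<Omega> f"
  unfolding in_L2_def
proof
  show "integrable (lebesgue_on \<Omega>) (\<lambda>x. (norm (f x))\<^sup>2)"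
    by (rule Bochner_Integration.integrable_bound[OF assms(2)])
       (use assms(1,3) in \<open>auto intro: order_trans[OF _ abs_ge_self]\<close>)
qed (rule assms(1))

lemma in_L2_zero: "in_L2 \<Omega> (\<lambda>x. 0)"
  by (simp add: in_L2_def)

lemma in_L2_scaleR: "in_L2 \<Omega> f \<Longrightarrow> in_L2 \<Omega> (\<lambda>x. c *\<^sub>R f x)"
  by (auto simp: in_L2_def power_mult_distrib)

lemma in_L2_add:
  assumes "in_L2 \<Omega> f" "in_L2 \<Omega> g"
  shows "in_L2 \<Omega> (\<lambda>x. f x + g x)"
proof (rule in_L2_boundI)
  show "(\<lambda>x. f x + g x) \<in> borel_measurable (lebesgue_on \<Omega>)"
    using assms by (auto simp: in_L2_def)
  show "integrable (lebesgue_on \<Omega>) (\<lambda>x. 2 * (norm (f x))\<^sup>2 + 2 * (norm (g x))\<^sup>2)"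
    using assms by (auto simp: in_L2_def)
  fix x
  have "(norm (f x + g x))\<^sup>2 \<le> (norm (f x) + norm (g x))\<^sup>2"
    by (simp add: norm_triangle_ineq power_mono)
  also have "\<dots> \<le> 2 * (norm (f x))\<^sup>2 + 2 * (norm (g x))\<^sup>2"
    using sum_squares_bound[of "norm (f x)" "norm (g x)"] by (simp add: power2_sum)
  finally show "(norm (f x + g x))\<^sup>2 \<le> 2 * (norm (f x))\<^sup>2 + 2 * (norm (g x))\<^sup>2" .
qed

lemma in_L2_diff: "in_L2 \<Omega> f \<Longrightarrow> in_L2 \<Omega> g \<Longrightarrow> in_L2 \<Omega> (\<lambda>x. f x - g x)"
  using in_L2_add[of \<Omega> f "\<lambda>x. -1 *\<^sub>R g x"] in_L2_scaleR[of \<Omega> g "-1"] by simp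

lemma in_L2_sum: "(\<And>i. i \<in> A \<Longrightarrow> in_L2 \<Omega> (f i)) \<Longrightarrow> in_L2 \<Omega> (\<lambda>x. \<Sum>i\<in>A. f i x)"
  by (induction A rule: infinite_finite_induct) (auto intro: in_L2_zero in_L2_add)

lemma integrable_L2_inner:
  assumes "in_L2 \<Omega> f" "in_L2 \<Omega> g"
  shows "integrable (lebesgue_on \<Omega>) (\<lambda>x. f x \<bullet> g x)"
proof (rule Bochner_Integration.integrable_bound)
  show "integrable (lebesgue_on \<Omega>) (\<lambda>x. (norm (f x))\<^sup>2 + (norm (g x))\<^sup>2)"
    using assms by (auto simp: in_L2_def)
  show "(\<lambda>x. f x \<bullet> g x) \<in> borel_measurable (lebesgue_on \<Omega>)"
    using assms by (auto simp: in_L2_def)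
  have "norm (f x \<bullet> g x) \<le> norm ((norm (f x))\<^sup>2 + (norm (g x))\<^sup>2)" for x
    using Cauchy_Schwarz_ineq2[of "f x" "g x"] sum_squares_bound[of "norm (f x)" "norm (g x)"] 
      zero_le_mult_iff[of "norm (f x)" "norm (g x)"]
    by (auto simp: power2_eq_square)
  then show "AE x in lebesgue_on \<Omega>. norm (f x \<bullet> g x) \<le> norm ((norm (f x))\<^sup>2 + (norm (g x))\<^sup>2)"
    by simp
qed

lemma L2_inner_commute: "L2_inner \<Omega> f g = L2_inner \<Omega> g f"
  by (simp add: L2_inner_def inner_commute)

lemma L2_inner_add_left:
  "in_L2 \<Omega> f \<Longrightarrow> in_L2 \<Omega> g \<Longrightarrow> in_L2 \<Omega> h \<Longrightarrow> L2_inner \<Omega> (\<lambda>x. f x + g x) h = L2_inner \<Omega> f h + L2_inner \<Omega> g h"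
  by (simp add: L2_inner_def inner_add_left integrable_L2_inner)

lemma L2_inner_diff_left:
  "in_L2 \<Omega> f \<Longrightarrow> in_L2 \<Omega> g \<Longrightarrow> in_L2 \<Omega> h \<Longrightarrow> L2_inner \<Omega> (\<lambda>x. f x - g x) h = L2_inner \<Omega> f h - L2_inner \<Omega> g h"
  by (simp add: L2_inner_def inner_diff_left integrable_L2_inner)

lemma L2_inner_scaleR_left: "L2_inner \<Omega> (\<lambda>x. c *\<^sub>R f x) h = c * L2_inner \<Omega> f h"
  by (simp add: L2_inner_def)

lemma L2_inner_sum_left:
  "(\<And>i. i \<in> A \<Longrightarrow> in_L2 \<Omega> (f i)) \<Longrightarrow> in_L2 \<Omega> h \<Longrightarrow>
    L2_inner \<Omega> (\<lambda>x. \<Sum>i\<in>A. f i x) h = (\<Sum>i\<in>A. L2_inner \<Omega> (f i) h)"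
  by (simp add: L2_inner_def inner_sum_left integrable_L2_inner)

lemma L2_inner_add_right:
  "in_L2 \<Omega> f \<Longrightarrow> in_L2 \<Omega> g \<Longrightarrow> in_L2 \<Omega> h \<Longrightarrow> L2_inner \<Omega> h (\<lambda>x. f x + g x) = L2_inner \<Omega> h f + L2_inner \<Omega> h g"
  by (simp add: L2_inner_commute[of \<Omega> h] L2_inner_add_left)

lemma L2_inner_diff_right:
  "in_L2 \<Omega> f \<Longrightarrow> in_L2 \<Omega> g \<Longrightarrow> in_L2 \<Omega> h \<Longrightarrow> L2_inner \<Omega> h (\<lambda>x. f x - g x) = L2_inner \<Omega> h f - L2_inner \<Omega> h g"
  by (simp add: L2_inner_commute[of \<Omega> h] L2_inner_diff_left)

lemma L2_inner_scaleR_right: "L2_inner \<Omega> h (\<lambda>x. c *\<^sub>R f x) = c * L2_inner \<Omega> h f"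
  by (simp add: L2_inner_def)

lemma L2_inner_sum_right:
  "(\<And>i. i \<in> A \<Longrightarrow> in_L2 \<Omega> (f i)) \<Longrightarrow> in_L2 \<Omega> h \<Longrightarrow>
    L2_inner \<Omega> h (\<lambda>x. \<Sum>i\<in>A. f i x) = (\<Sum>i\<in>A. L2_inner \<Omega> h (f i))"
  by (simp add: L2_inner_commute[of \<Omega> h] L2_inner_sum_left)

lemma L2_inner_self_nonneg: "L2_inner \<Omega> f f \<ge> 0"
  by (simp add: L2_inner_def)

lemma L2_norm_nonneg: "L2_norm \<Omega> f \<ge> 0"
  by (simp add: L2_norm_def L2_inner_self_nonneg)

lemma L2_norm_power2: "(L2_norm \<Omega> f)\<^sup>2 = L2_inner \<Omega> f f"
  by (simp add: L2_norm_def L2_inner_self_nonneg)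

lemma L2_norm_power2_integral: "(L2_norm \<Omega> f)\<^sup>2 = (LINT x|lebesgue_on \<Omega>. (norm (f x))\<^sup>2)"
  by (simp add: L2_norm_power2 L2_inner_def power2_norm_eq_inner)

lemma L2_norm_minus_commute: "L2_norm \<Omega> (\<lambda>x. f x - g x) = L2_norm \<Omega> (\<lambda>x. g x - f x)"
proof -
  have "(f x - g x) \<bullet> (f x - g x) = (g x - f x) \<bullet> (g x - f x)" for x
    by (metis inner_minus_left inner_minus_right minus_diff_eq minus_minus)
  then show ?thesis by (simp add: L2_norm_def L2_inner_def)
qed

lemma L2_norm_scaleR: "L2_norm \<Omega> (\<lambda>x. c *\<^sub>R f x) = \<bar>c\<bar> * L2_norm \<Omega> f"
  by (simp add: L2_norm_def L2_inner_scaleR_left L2_inner_scaleR_right real_sqrt_mult mult.assoc[symmetric])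

lemma L2_inner_add_scaleR_self:
  assumes "in_L2 \<Omega> f" "in_L2 \<Omega> g"
  shows "L2_inner \<Omega> (\<lambda>x. f x + t *\<^sub>R g x) (\<lambda>x. f x + t *\<^sub>R g x)
    = L2_inner \<Omega> f f + 2 * t * L2_inner \<Omega> f g + t\<^sup>2 * L2_inner \<Omega> g g"
  using assms
  by (simp add: L2_inner_add_left L2_inner_add_right in_L2_add in_L2_scaleR L2_inner_scaleR_left
      L2_inner_scaleR_right L2_inner_commute[of \<Omega> g f] power2_eq_square algebra_simps)

text \<open>The discriminant criterion. It yields Cauchy-Schwarz and, for \<open>a = 0\<close>, the
  vanishing of a first variation.\<close>

lemma quadratic_nonneg_imp_le:
  fixes a b c :: real
  assumes "\<And>t. 0 \<le> a + 2 * t * b + t\<^sup>2 * c" "c \<ge> 0"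
  shows "b\<^sup>2 \<le> a * c"
proof (cases "c = 0")
  case True
  have "b = 0"
  proof (rule ccontr)
    assume b: "b \<noteq> 0"
    have "0 \<le> a + 2 * (- (a + 1) / (2 * b)) * b" using assms(1)[of "- (a + 1) / (2 * b)"] True by simp
    also have "\<dots> = -1" using b by (simp add: field_simps)
    finally show False by simp
  qed
  then show ?thesis using True by simp
next
  case False
  then have c: "c > 0" using assms by simp
  have "0 \<le> a + 2 * (- b / c) * b + (- b / c)\<^sup>2 * c" by (rule assms)
  also have "\<dots> = a - b\<^sup>2 / c" using c by (simp add: field_simps power2_eq_square)
  finally show ?thesis using c by (simp add: field_simps)
qed

lemma L2_Cauchy_Schwarz:
  assumes "in_L2 \<Omega> f" "in_L2 \<Omega> g"
  shows "\<bar>L2_inner \<Omega> f g\<bar> \<le> L2_norm \<Omega> f * L2_norm \<Omega> g"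
proof -
  have "(L2_inner \<Omega> f g)\<^sup>2 \<le> L2_inner \<Omega> f f * L2_inner \<Omega> g g"
    by (rule quadratic_nonneg_imp_le)
       (simp_all add: L2_inner_add_scaleR_self[OF assms, symmetric] L2_inner_self_nonneg)
  then show ?thesis
    by (simp add: L2_norm_def real_sqrt_mult[symmetric] real_le_rsqrt)
qed

lemma L2_norm_triangle:
  assumes "in_L2 \<Omega> f" "in_L2 \<Omega> g"
  shows "L2_norm \<Omega> (\<lambda>x. f x + g x) \<le> L2_norm \<Omega> f + L2_norm \<Omega> g"
proof (rule power2_le_imp_le)
  have "(L2_norm \<Omega> (\<lambda>x. f x + g x))\<^sup>2 = (L2_norm \<Omega> f)\<^sup>2 + 2 * L2_inner \<Omega> f g + (L2_norm \<Omega> g)\<^sup>2"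
    using L2_inner_add_scaleR_self[OF assms, of 1] by (simp add: L2_norm_power2)
  also have "\<dots> \<le> (L2_norm \<Omega> f + L2_norm \<Omega> g)\<^sup>2"
    using L2_Cauchy_Schwarz[OF assms] by (simp add: power2_sum)
  finally show "(L2_norm \<Omega> (\<lambda>x. f x + g x))\<^sup>2 \<le> (L2_norm \<Omega> f + L2_norm \<Omega> g)\<^sup>2" .
qed (simp add: L2_norm_nonneg)

lemma L2_norm_diff_triangle:
  assumes "in_L2 \<Omega> f" "in_L2 \<Omega> g" "in_L2 \<Omega> h"
  shows "L2_norm \<Omega> (\<lambda>x. f x - h x) \<le> L2_norm \<Omega> (\<lambda>x. f x - g x) + L2_norm \<Omega> (\<lambda>x. g x - h x)"
  using L2_norm_triangle[OF in_L2_diff[OF assms(1,2)] in_L2_diff[OF assms(2,3)]] by simp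

lemma L2_norm_triangle_le:
  assumes "in_L2 \<Omega> f" "in_L2 \<Omega> g"
  shows "L2_norm \<Omega> f \<le> L2_norm \<Omega> g + L2_norm \<Omega> (\<lambda>x. f x - g x)"
  using L2_norm_triangle[OF assms(2) in_L2_diff[OF assms]] by simp

lemma tendsto_L2_inner:
  assumes "\<And>n. in_L2 \<Omega> (f n)" "in_L2 \<Omega> f'" "\<And>n. in_L2 \<Omega> (g n)" "in_L2 \<Omega> g'"
    and f: "(\<lambda>n. L2_norm \<Omega> (\<lambda>x. f n x - f' x)) \<longlonglongrightarrow> 0"
    and g: "(\<lambda>n. L2_norm \<Omega> (\<lambda>x. g n x - g' x)) \<longlonglongrightarrow> 0"
  shows "(\<lambda>n. L2_inner \<Omega> (f n) (g n)) \<longlonglongrightarrow> L2_inner \<Omega> f' g'"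
proof (rule LIM_zero_cancel, rule tendsto_rabs_zero_cancel,
    rule tendsto_sandwich[OF _ _ tendsto_const])
  show "(\<lambda>n. L2_norm \<Omega> (\<lambda>x. f n x - f' x) * L2_norm \<Omega> (\<lambda>x. g n x - g' x)
      + L2_norm \<Omega> (\<lambda>x. f n x - f' x) * L2_norm \<Omega> g' + L2_norm \<Omega> f' * L2_norm \<Omega> (\<lambda>x. g n x - g' x)) \<longlonglongrightarrow> 0"
    by (rule tendsto_eq_rhs, (rule tendsto_intros f g)+) simp
  have "\<bar>L2_inner \<Omega> (f n) (g n) - L2_inner \<Omega> f' g'\<bar> \<le> L2_norm \<Omega> (\<lambda>x. f n x - f' x) * L2_norm \<Omega> (\<lambda>x. g n x - g' x)
      + L2_norm \<Omega> (\<lambda>x. f n x - f' x) * L2_norm \<Omega> g' + L2_norm \<Omega> f' * L2_norm \<Omega> (\<lambda>x. g n x - g' x)" for n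
  proof -
    note L = assms(1-4)
    have "L2_inner \<Omega> (f n) (g n) - L2_inner \<Omega> f' g' = L2_inner \<Omega> (\<lambda>x. f n x - f' x) (\<lambda>x. g n x - g' x)
       + L2_inner \<Omega> (\<lambda>x. f n x - f' x) g' + L2_inner \<Omega> f' (\<lambda>x. g n x - g' x)"
      using L by (simp add: L2_inner_diff_left L2_inner_diff_right in_L2_diff)
    then show ?thesis
      using L2_Cauchy_Schwarz[OF in_L2_diff[OF L(1)[of n] L(2)] in_L2_diff[OF L(3)[of n] L(4)]]
       L2_Cauchy_Schwarz[OF in_L2_diff[OF L(1)[of n] L(2)] L(4)] L2_Cauchy_Schwarz[OF L(2) in_L2_diff[OF L(3)[of n] L(4)]]
      by linarith
  qed
  then show "\<forall>\<^sub>F n in sequentially. \<bar>L2_inner \<Omega> (f n) (g n) - L2_inner \<Omega> f' g'\<bar> \<le> L2_norm \<Omega> (\<lambda>x. f n x - f' x) * L2_norm \<Omega> (\<lambda>x. g n x - g' x)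
      + L2_norm \<Omega> (\<lambda>x. f n x - f' x) * L2_norm \<Omega> g' + L2_norm \<Omega> f' * L2_norm \<Omega> (\<lambda>x. g n x - g' x)"
    by simp
qed auto

text \<open>A subsequence whose consecutive differences are below 2^-k has summable L1 distances, as
  the measure is finite, and so converges almost everywhere. Fatou's lemma turns the Cauchy bounds
  into bounds on the distance to the pointwise limit.\<close>

lemma L2_complete:
  fixes f :: "nat \<Rightarrow> 'a::euclidean_space \<Rightarrow> 'b::euclidean_space"
  assumes \<Omega>: "\<Omega> \<in> lmeasurable" and f: "\<And>n. in_L2 \<Omega> (f n)"
    and Cauchy: "\<And>e. e > 0 \<Longrightarrow> \<exists>N. \<forall>m\<ge>N. \<forall>n\<ge>N. L2_norm \<Omega> (\<lambda>x. f m x - f n x) < e"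
  shows "\<exists>g. in_L2 \<Omega> g \<and> (\<lambda>n. L2_norm \<Omega> (\<lambda>x. f n x - g x)) \<longlonglongrightarrow> 0"
proof -
  let ?M = "lebesgue_on \<Omega>"
  interpret finite_measure ?M by (rule finite_measure_lebesgue_on[OF \<Omega>])
  note [measurable] = f[THEN in_L2_measurable]
  have "\<exists>N. \<forall>m\<ge>N. \<forall>n\<ge>N. L2_norm \<Omega> (\<lambda>x. f m x - f n x) < (1/2)^k" for k :: nat
    by (rule Cauchy) simp
  then obtain N where N: "\<And>k m n. m \<ge> N k \<Longrightarrow> n \<ge> N k \<Longrightarrow> L2_norm \<Omega> (\<lambda>x. f m x - f n x) < (1/2)^k"
    by metis
  \<comment> \<open>Summation makes \<open>r j\<close> at least \<open>N k\<close> for every k \<le>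
    j.\<close>
  define r where "r k = (\<Sum>i\<le>k. N i)" for k :: nat
  have r: "r j \<ge> N k" if "j \<ge> k" for j k
    unfolding r_def by (rule member_le_sum) (use that in auto)
  define h where "h k x = norm (f (r (Suc k)) x - f (r k) x)" for k x
  \<comment> \<open>Pairing with the constant 1 turns the L2 bounds into L1 bounds.\<close>
  have const: "in_L2 \<Omega> (\<lambda>x. 1::real)"
    by (simp add: in_L2_def)
  have h: "in_L2 \<Omega> (h k)" for k
    using in_L2_diff[OF f[of "r (Suc k)"] f[of "r k"]] by (simp add: in_L2_def h_def[abs_def])
  have [measurable]: "h k \<in> borel_measurable ?M" for k using h in_L2_measurable by blast
  have int_h: "integrable ?M (h k)" for k
    using integrable_L2_inner[OF h[of k] const] by simp
  have "(LINT x|?M. h k x) \<le> (1/2)^k * L2_norm \<Omega> (\<lambda>x. 1::real)" for k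
  proof -
    have "(LINT x|?M. h k x) = L2_inner \<Omega> (h k) (\<lambda>x. 1)"
      by (simp add: L2_inner_def)
    also have "\<dots> \<le> L2_norm \<Omega> (h k) * L2_norm \<Omega> (\<lambda>x. 1::real)"
      using L2_Cauchy_Schwarz[OF h const] by (rule order_trans[OF abs_ge_self])
    also have "L2_norm \<Omega> (h k) = L2_norm \<Omega> (\<lambda>x. f (r (Suc k)) x - f (r k) x)"
      by (simp add: L2_norm_def L2_inner_def h_def power2_norm_eq_inner[symmetric] power2_eq_square)
    also have "\<dots> \<le> (1/2)^k" using N[OF r r, of k "Suc k" k] by simp
    finally show ?thesis by (simp add: mult_right_mono L2_norm_nonneg)
  qed
  then have "ennreal (LINT x|?M. h k x) \<le> ennreal ((1/2)^k * L2_norm \<Omega> (\<lambda>x. 1::real))" for k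
    by (rule ennreal_leI)
  moreover have "(\<integral>\<^sup>+x. ennreal (h k x) \<partial>?M) = ennreal (LINT x|?M. h k x)" for k
    using int_h[of k] by (rule nn_integral_eq_integral) (simp add: h_def)
  ultimately have "(\<integral>\<^sup>+x. ennreal (h k x) \<partial>?M) \<le> ennreal ((1/2)^k * L2_norm \<Omega> (\<lambda>x. 1::real))" for k
    by simp
  then have "(\<Sum>k. \<integral>\<^sup>+x. ennreal (h k x) \<partial>?M) \<le> (\<Sum>k. ennreal ((1/2)^k * L2_norm \<Omega> (\<lambda>x. 1::real)))"
    by (intro suminf_le) auto
  also have "\<dots> < \<infinity>"
    by (subst suminf_ennreal2) (auto intro!: summable_mult2 summable_geometric mult_nonneg_nonneg simp: L2_norm_nonneg)
  finally have "(\<integral>\<^sup>+x. (\<Sum>k. ennreal (h k x)) \<partial>?M) \<noteq> \<infinity>"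
    by (subst nn_integral_suminf) auto
  then have "AE x in ?M. (\<Sum>k. ennreal (h k x)) \<noteq> \<infinity>"
    by (intro nn_integral_PInf_AE) auto
  then have conv: "AE x in ?M. convergent (\<lambda>k. f (r k) x)"
  proof eventually_elim
    case (elim x)
    then have "summable (\<lambda>k. h k x)"
      by (intro summable_suminf_not_top) (auto simp: h_def)
    then have "summable (\<lambda>k. f (r (Suc k)) x - f (r k) x)"
      unfolding h_def by (rule summable_norm_cancel)
    then have "(\<lambda>n. f (r 0) x + (\<Sum>k<n. f (r (Suc k)) x - f (r k) x)) \<longlonglongrightarrow> f (r 0) x + (\<Sum>k. f (r (Suc k)) x - f (r k) x)"
      by (intro tendsto_intros summable_LIMSEQ)
    moreover have "(\<Sum>k<n. f (r (Suc k)) x - f (r k) x) = f (r n) x - f (r 0) x" for n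
      by (rule sum_lessThan_telescope)
    ultimately show ?case by (auto simp: convergent_def)
  qed
  define g where "g x = lim (\<lambda>k. f (r k) x)" for x
  have [measurable]: "g \<in> borel_measurable ?M"
    unfolding g_def[abs_def] by (rule borel_measurable_lim_metric) measurable
  have bound: "(\<integral>\<^sup>+x. ennreal ((norm (f n x - g x))\<^sup>2) \<partial>?M) \<le> ennreal (((1/2)^k)\<^sup>2)" if n: "n \<ge> N k" for n k
  proof -
    have "(\<integral>\<^sup>+x. ennreal ((norm (f n x - g x))\<^sup>2) \<partial>?M)
       = (\<integral>\<^sup>+x. liminf (\<lambda>j. ennreal ((norm (f n x - f (r j) x))\<^sup>2)) \<partial>?M)"
    proof (rule nn_integral_cong_AE)
      show "AE x in ?M. ennreal ((norm (f n x - g x))\<^sup>2) = liminf (\<lambda>j. ennreal ((norm (f n x - f (r j) x))\<^sup>2))"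
        using conv
      proof eventually_elim
        case (elim x)
        then have "(\<lambda>k. f (r k) x) \<longlonglongrightarrow> g x" unfolding g_def by (simp add: convergent_LIMSEQ_iff)
        then have "(\<lambda>j. ennreal ((norm (f n x - f (r j) x))\<^sup>2)) \<longlonglongrightarrow> ennreal ((norm (f n x - g x))\<^sup>2)"
          by (intro tendsto_intros) auto
        then show ?case by (rule lim_imp_Liminf[OF trivial_limit_sequentially, symmetric])
      qed
    qed
    also have "\<dots> \<le> liminf (\<lambda>j. \<integral>\<^sup>+x. ennreal ((norm (f n x - f (r j) x))\<^sup>2) \<partial>?M)"
      by (rule nn_integral_liminf) measurable
    also have "\<dots> \<le> ennreal (((1/2)^k)\<^sup>2)"
    proof (rule Liminf_le)
      have "(\<integral>\<^sup>+x. ennreal ((norm (f n x - f (r j) x))\<^sup>2) \<partial>?M) \<le> ennreal (((1/2)^k)\<^sup>2)" if "j \<ge> k" for j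
      proof -
        have "(\<integral>\<^sup>+x. ennreal ((norm (f n x - f (r j) x))\<^sup>2) \<partial>?M) = ennreal ((L2_norm \<Omega> (\<lambda>x. f n x - f (r j) x))\<^sup>2)"
          unfolding L2_norm_power2_integral
          using in_L2_diff[OF f[of n] f[of "r j"]] by (intro nn_integral_eq_integral) (auto simp: in_L2_def)
        also have "\<dots> \<le> ennreal (((1/2)^k)\<^sup>2)"
          using N[OF n r[OF that]] by (intro ennreal_leI power_mono L2_norm_nonneg) simp
        finally show ?thesis .
      qed
      then show "\<forall>\<^sub>F j in sequentially. (\<integral>\<^sup>+x. ennreal ((norm (f n x - f (r j) x))\<^sup>2) \<partial>?M) \<le> ennreal (((1/2)^k)\<^sup>2)"
        by (auto simp: eventually_sequentially)
    qed simp
    finally show ?thesis .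
  qed
  have diff: "in_L2 \<Omega> (\<lambda>x. f n x - g x)" if "n \<ge> N k" for n k
    unfolding in_L2_def
  proof
    show "integrable ?M (\<lambda>x. (norm (f n x - g x))\<^sup>2)"
      using bound[OF that] by (intro integrableI_bounded) (auto simp: le_less_trans)
  qed measurable
  have L2g: "in_L2 \<Omega> g"
    using in_L2_diff[OF f[of "N 0"] diff[of 0 "N 0"]] by simp
  have "(\<lambda>n. L2_norm \<Omega> (\<lambda>x. f n x - g x)) \<longlonglongrightarrow> 0"
  proof (rule LIMSEQ_I)
    fix e :: real assume "e > 0"
    then obtain k where k: "(1/2)^k < e" using real_arch_pow_inv[of e "1/2"] by auto
    have "L2_norm \<Omega> (\<lambda>x. f n x - g x) < e" if n: "n \<ge> N k" for n
    proof -
      have "ennreal ((L2_norm \<Omega> (\<lambda>x. f n x - g x))\<^sup>2) = (\<integral>\<^sup>+x. ennreal ((norm (f n x - g x))\<^sup>2) \<partial>?M)"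
        unfolding L2_norm_power2_integral
        using diff[OF n] by (intro nn_integral_eq_integral[symmetric]) (auto simp: in_L2_def)
      also note bound[OF n]
      finally have "(L2_norm \<Omega> (\<lambda>x. f n x - g x))\<^sup>2 \<le> ((1/2)^k)\<^sup>2" by (simp add: ennreal_le_iff)
      then have "L2_norm \<Omega> (\<lambda>x. f n x - g x) \<le> (1/2)^k" by (rule power2_le_imp_le) simp
      then show ?thesis using k by simp
    qed
    then show "\<exists>no. \<forall>n\<ge>no. norm (L2_norm \<Omega> (\<lambda>x. f n x - g x) - 0) < e"
      by (intro exI[of _ "N k"]) (simp add: L2_norm_nonneg)
  qed
  with L2g show ?thesis by blast
qed

section \<open>Test functions and the Sobolev space\<close>

lemma continuous_compact_support_integrable:
  fixes f :: "'a::euclidean_space \<Rightarrow> 'b::euclidean_space"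
  assumes "continuous_on UNIV f" "compact K" "\<And>x. x \<notin> K \<Longrightarrow> f x = 0"
  shows "integrable lborel f"
proof -
  have "integrable lborel (\<lambda>x. indicator K x *\<^sub>R f x)"
    using assms by (intro borel_integrable_compact continuous_on_subset[OF assms(1)]) auto
  moreover have "(\<lambda>x. indicator K x *\<^sub>R f x) = f"
    using assms(3) by (auto simp: indicator_def fun_eq_iff)
  ultimately show ?thesis by simp
qed

text \<open>Functions vanishing outside \<open>\<Omega>\<close> can thus be handled on the whole
  space, where translations and Fubini are available.\<close>

lemma integral_lebesgue_on_eq_lborel:
  fixes f :: "'a::euclidean_space \<Rightarrow> 'b::euclidean_space"
  assumes "\<Omega> \<in> sets lebesgue" "f \<in> borel_measurable borel" "\<And>x. x \<notin> \<Omega> \<Longrightarrow> f x = 0"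
  shows "(LINT x|lebesgue_on \<Omega>. f x) = (LINT x|lborel. f x)"
    and "integrable (lebesgue_on \<Omega>) f \<longleftrightarrow> integrable lborel f"
proof -
  have *: "(\<lambda>x. indicator \<Omega> x *\<^sub>R f x) = f"
    using assms(3) by (auto simp: indicator_def fun_eq_iff)
  show "(LINT x|lebesgue_on \<Omega>. f x) = (LINT x|lborel. f x)"
    using assms by (subst integral_restrict_space) (auto simp: * integral_completion)
  show "integrable (lebesgue_on \<Omega>) f \<longleftrightarrow> integrable lborel f"
    using assms by (subst integrable_restrict_space) (auto simp: * integrable_completion set_integrable_def)
qed

lemma in_L2_continuous_compact_support:
  fixes f :: "'a::euclidean_space \<Rightarrow> 'b::euclidean_space"
  assumes "\<Omega> \<in> sets lebesgue" "continuous_on UNIV f" "compact K" "K \<subseteq> \<Omega>" "\<And>x. x \<notin> K \<Longrightarrow> f x = 0"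
  shows "in_L2 \<Omega> f"
  unfolding in_L2_def
proof
  have "f \<in> borel_measurable lebesgue"
    using assms(2) by (simp add: borel_measurable_continuous_onI measurable_completion)
  then show "f \<in> borel_measurable (lebesgue_on \<Omega>)"
    using measurable_restrict_space1 by blast
  have c: "continuous_on UNIV (\<lambda>x. (norm (f x))\<^sup>2)"
    using assms(2) by (intro continuous_intros)
  have "integrable lborel (\<lambda>x. (norm (f x))\<^sup>2)"
    by (rule continuous_compact_support_integrable[OF c assms(3)]) (use assms in auto)
  then show "integrable (lebesgue_on \<Omega>) (\<lambda>x. (norm (f x))\<^sup>2)"
    using assms c by (subst integral_lebesgue_on_eq_lborel(2)) (auto intro: borel_measurable_continuous_onI)
qed

lemma GDERIV_unique: "GDERIV f x :> D \<Longrightarrow> GDERIV f x :> E \<Longrightarrow> D = E"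
proof -
  assume "GDERIV f x :> D" "GDERIV f x :> E"
  then have "(\<lambda>h. h \<bullet> D) = (\<lambda>h. h \<bullet> E)"
    unfolding gderiv_def by (rule has_derivative_unique)
  then have "(D - E) \<bullet> (D - E) = 0"
    by (metis inner_diff_right diff_self)
  then show "D = E" by simp
qed

text \<open>An element of the graph of the gradient, matching the two function arguments of
  \<open>in_H10\<close>.\<close>

definition test_pair :: "'a::euclidean_space set \<Rightarrow> ('a \<Rightarrow> real) \<Rightarrow> ('a \<Rightarrow> 'a) \<Rightarrow> bool" where
  "test_pair \<Omega> \<phi> G \<longleftrightarrow> test_function \<Omega> \<phi> \<and> (\<forall>x. GDERIV \<phi> x :> G x)"

lemma test_pair_support:
  assumes "test_pair \<Omega> \<phi> G"
  shows "\<exists>K. compact K \<and> K \<subseteq> \<Omega> \<and> (\<forall>x. x \<notin> K \<longrightarrow> \<phi> x = 0) \<and> (\<forall>x. x \<notin> K \<longrightarrow> G x = 0)"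
proof (intro exI conjI allI impI)
  let ?K = "closure {x. \<phi> x \<noteq> 0}"
  show "compact ?K" "?K \<subseteq> \<Omega>" using assms by (auto simp: test_pair_def test_function_def)
  show \<phi>: "\<phi> x = 0" if "x \<notin> ?K" for x
    using that closure_subset[of "{x. \<phi> x \<noteq> 0}"] by auto
  fix x assume x: "x \<notin> ?K"
  have "(\<phi> has_derivative (\<lambda>h. 0)) (at x)"
  proof (rule has_derivative_transform_within_open)
    show "((\<lambda>x. 0) has_derivative (\<lambda>h. 0)) (at x)" by simp
    show "open (- ?K)" "x \<in> - ?K" using x by auto
    show "0 = \<phi> y" if "y \<in> - ?K" for y
      using \<phi>[of y] that by simp
  qed
  then have "GDERIV \<phi> x :> 0"
    by (simp add: gderiv_def)
  moreover have "GDERIV \<phi> x :> G x"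
    using assms unfolding test_pair_def by blast
  ultimately show "G x = 0"
    using GDERIV_unique by blast
qed

lemma test_pair_continuous:
  assumes "test_pair \<Omega> \<phi> G"
  shows "continuous_on UNIV \<phi>" "continuous_on UNIV G"
proof -
  have C: "C_k n \<phi>" for n
    using assms by (auto simp: test_pair_def test_function_def)
  have D: "GDERIV \<phi> x :> G x" for x
    using assms by (auto simp: test_pair_def)
  show "continuous_on UNIV \<phi>" using C[of 0] by simp
  obtain H where H: "\<And>x. GDERIV \<phi> x :> H x" "\<And>b. b \<in> Basis \<Longrightarrow> continuous_on UNIV (\<lambda>x. H x \<bullet> b)"
    using C[of "Suc 0"] by auto
  have "G = H" using GDERIV_unique[OF D H(1)] by auto
  have "continuous_on UNIV (\<lambda>x. \<Sum>b\<in>Basis. (H x \<bullet> b) *\<^sub>R b)"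
    by (intro continuous_on_sum continuous_on_scaleR H continuous_on_const)
  then show "continuous_on UNIV G" by (simp add: euclidean_representation \<open>G = H\<close>)
qed

lemma test_pair_in_L2:
  assumes "open \<Omega>" "test_pair \<Omega> \<phi> G"
  shows "in_L2 \<Omega> \<phi>" "in_L2 \<Omega> G"
proof -
  have \<Omega>: "\<Omega> \<in> sets lebesgue" using assms by auto
  obtain K where "compact K" "K \<subseteq> \<Omega>" "\<And>x. x \<notin> K \<Longrightarrow> \<phi> x = 0" "\<And>x. x \<notin> K \<Longrightarrow> G x = 0"
    using test_pair_support[OF assms(2)] by blast
  with test_pair_continuous[OF assms(2)] \<Omega> show "in_L2 \<Omega> \<phi>" "in_L2 \<Omega> G"
    by (auto intro: in_L2_continuous_compact_support)
qed

lemma test_functionI: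
  assumes "\<And>n. C_k n \<phi>" "compact K" "K \<subseteq> \<Omega>" "\<And>x. x \<notin> K \<Longrightarrow> \<phi> x = 0"
  shows "test_function \<Omega> \<phi>"
proof -
  have "closure {x. \<phi> x \<noteq> 0} \<subseteq> K"
    using assms by (intro closure_minimal) (auto intro: compact_imp_closed)
  moreover have "compact (closure {x. \<phi> x \<noteq> 0})"
    using assms(2,4) by (auto simp: compact_closure intro: bounded_subset compact_imp_bounded)
  ultimately show ?thesis
    using assms by (auto simp: test_function_def)
qed

lemma test_pair_mult:
  assumes "test_pair \<Omega> \<phi> G" "\<And>n. C_k n f" "\<And>x. GDERIV f x :> F x"
  shows "test_pair \<Omega> (\<lambda>x. \<phi> x * f x) (\<lambda>x. \<phi> x *\<^sub>R F x + f x *\<^sub>R G x)"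
proof -
  obtain K where "compact K" "K \<subseteq> \<Omega>" "\<And>x. x \<notin> K \<Longrightarrow> \<phi> x = 0" "\<And>x. x \<notin> K \<Longrightarrow> G x = 0"
    using test_pair_support[OF assms(1)] by blast
  then have "test_function \<Omega> (\<lambda>x. \<phi> x * f x)"
    using assms by (intro test_functionI[of _ K] C_k_mult) (auto simp: test_pair_def test_function_def)
  then show ?thesis
    using assms by (auto simp: test_pair_def intro!: GDERIV_mult)
qed

lemma test_pair_add:
  assumes "test_pair \<Omega> \<phi> G" "test_pair \<Omega> \<psi> H"
  shows "test_pair \<Omega> (\<lambda>x. \<phi> x + \<psi> x) (\<lambda>x. G x + H x)"
proof -
  obtain K where K: "compact K" "K \<subseteq> \<Omega>" "\<And>x. x \<notin> K \<Longrightarrow> \<phi> x = 0" "\<And>x. x \<notin> K \<Longrightarrow> G x = 0"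
    using test_pair_support[OF assms(1)] by blast
  obtain L where L: "compact L" "L \<subseteq> \<Omega>" "\<And>x. x \<notin> L \<Longrightarrow> \<psi> x = 0" "\<And>x. x \<notin> L \<Longrightarrow> H x = 0"
    using test_pair_support[OF assms(2)] by blast
  have "test_function \<Omega> (\<lambda>x. \<phi> x + \<psi> x)"
    using assms K L by (intro test_functionI[of _ "K \<union> L"] C_k_add) (auto simp: test_pair_def test_function_def)
  then show ?thesis
    using assms by (auto simp: test_pair_def intro!: GDERIV_add)
qed

lemma test_pair_scaleR:
  assumes "test_pair \<Omega> \<phi> G"
  shows "test_pair \<Omega> (\<lambda>x. c * \<phi> x) (\<lambda>x. c *\<^sub>R G x)"
  using test_pair_mult[OF assms, of "\<lambda>x. c" "\<lambda>x. 0"] by (simp add: C_k_const GDERIV_const mult.commute)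

text \<open>One simultaneous approximation of function and gradient replaces the two limits of
  integrals; closure under sums, multiples and limits then reduces to the triangle
  inequality.\<close>

lemma in_H10_iff:
  assumes "open \<Omega>"
  shows "in_H10 \<Omega> u g \<longleftrightarrow> in_L2 \<Omega> u \<and> in_L2 \<Omega> g \<and>
    (\<forall>e>0. \<exists>\<phi> G. test_pair \<Omega> \<phi> G \<and> L2_norm \<Omega> (\<lambda>x. \<phi> x - u x) < e \<and> L2_norm \<Omega> (\<lambda>x. G x - g x) < e)"
    (is "_ \<longleftrightarrow> _ \<and> _ \<and> ?A")
proof (intro iffI; (elim conjE)?)
  assume *: "in_H10 \<Omega> u g"
  then obtain \<phi> G where tp: "\<And>n. test_pair \<Omega> (\<phi> n) (G n)"
    and lim: "(\<lambda>n. LINT x|lebesgue_on \<Omega>. (\<phi> n x - u x)\<^sup>2) \<longlonglongrightarrow> 0"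
      "(\<lambda>n. LINT x|lebesgue_on \<Omega>. (norm (G n x - g x))\<^sup>2) \<longlonglongrightarrow> 0"
    unfolding in_H10_def test_pair_def by blast
  have "(\<lambda>n. sqrt ((L2_norm \<Omega> (\<lambda>x. \<phi> n x - u x))\<^sup>2)) \<longlonglongrightarrow> sqrt 0"
    using lim(1) by (intro tendsto_real_sqrt) (simp add: L2_norm_power2_integral)
  then have l1: "(\<lambda>n. L2_norm \<Omega> (\<lambda>x. \<phi> n x - u x)) \<longlonglongrightarrow> 0" by (simp add: L2_norm_nonneg)
  have "(\<lambda>n. sqrt ((L2_norm \<Omega> (\<lambda>x. G n x - g x))\<^sup>2)) \<longlonglongrightarrow> sqrt 0"
    using lim(2) by (intro tendsto_real_sqrt) (simp add: L2_norm_power2_integral)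
  then have l2: "(\<lambda>n. L2_norm \<Omega> (\<lambda>x. G n x - g x)) \<longlonglongrightarrow> 0" by (simp add: L2_norm_nonneg)
  have ?A
  proof (intro allI impI)
    fix e :: real assume "e > 0"
    then have "\<forall>\<^sub>F n in sequentially. L2_norm \<Omega> (\<lambda>x. \<phi> n x - u x) < e \<and> L2_norm \<Omega> (\<lambda>x. G n x - g x) < e"
      by (intro eventually_conj order_tendstoD(2)[OF l1] order_tendstoD(2)[OF l2])
    from eventually_happens'[OF sequentially_bot this]
    obtain n where "L2_norm \<Omega> (\<lambda>x. \<phi> n x - u x) < e" "L2_norm \<Omega> (\<lambda>x. G n x - g x) < e" by blast
    then show "\<exists>\<phi> G. test_pair \<Omega> \<phi> G \<and> L2_norm \<Omega> (\<lambda>x. \<phi> x - u x) < e \<and> L2_norm \<Omega> (\<lambda>x. G x - g x) < e"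
      using tp by blast
  qed
  with * show "in_L2 \<Omega> u \<and> in_L2 \<Omega> g \<and> ?A" by (simp add: in_H10_def)
next
  assume L2: "in_L2 \<Omega> u" "in_L2 \<Omega> g" and A: ?A
  define P where "P e p \<longleftrightarrow> test_pair \<Omega> (fst p) (snd p) \<and> L2_norm \<Omega> (\<lambda>x. fst p x - u x) < e \<and>
    L2_norm \<Omega> (\<lambda>x. snd p x - g x) < e" for e p
  have "\<forall>n. \<exists>p. P (inverse (real (Suc n))) p"
  proof
    fix n
    have "0 < inverse (real (Suc n))" by simp
    with A obtain \<phi> G where "P (inverse (real (Suc n))) (\<phi>, G)" unfolding P_def fst_conv snd_conv by blast
    then show "\<exists>p. P (inverse (real (Suc n))) p" by blast
  qed
  from choice[OF this] obtain p where p: "P (inverse (real (Suc n))) (p n)" for n by blast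
  define \<phi> G where "\<phi> n = fst (p n)" and "G n = snd (p n)" for n
  have *: "test_pair \<Omega> (\<phi> n) (G n)" "L2_norm \<Omega> (\<lambda>x. \<phi> n x - u x) < inverse (real (Suc n))"
    "L2_norm \<Omega> (\<lambda>x. G n x - g x) < inverse (real (Suc n))" for n
    using p[of n] by (simp_all add: P_def \<phi>_def G_def)
  have "(\<lambda>n. L2_norm \<Omega> (\<lambda>x. \<phi> n x - u x)) \<longlonglongrightarrow> 0"
    by (rule tendsto_sandwich[OF _ _ tendsto_const LIMSEQ_inverse_real_of_nat])
       (auto intro!: always_eventually simp: L2_norm_nonneg less_imp_le[OF *(2)] simp del: of_nat_Suc)
  from tendsto_power[OF this, of 2] have 1: "(\<lambda>n. LINT x|lebesgue_on \<Omega>. (\<phi> n x - u x)\<^sup>2) \<longlonglongrightarrow> 0"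
    by (simp add: L2_norm_power2_integral)
  have "(\<lambda>n. L2_norm \<Omega> (\<lambda>x. G n x - g x)) \<longlonglongrightarrow> 0"
    by (rule tendsto_sandwich[OF _ _ tendsto_const LIMSEQ_inverse_real_of_nat])
       (auto intro!: always_eventually simp: L2_norm_nonneg less_imp_le[OF *(3)] simp del: of_nat_Suc)
  from tendsto_power[OF this, of 2] have 2: "(\<lambda>n. LINT x|lebesgue_on \<Omega>. (norm (G n x - g x))\<^sup>2) \<longlonglongrightarrow> 0"
    by (simp add: L2_norm_power2_integral)
  show "in_H10 \<Omega> u g"
    unfolding in_H10_def using L2 1 2 *(1) by (auto simp: test_pair_def intro!: exI[of _ \<phi>] exI[of _ G])
qed

lemma in_H10_L2: "in_H10 \<Omega> u g \<Longrightarrow> in_L2 \<Omega> u" "in_H10 \<Omega> u g \<Longrightarrow> in_L2 \<Omega> g"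
  by (auto simp: in_H10_def)

lemma L2_norm_zero: "L2_norm \<Omega> (\<lambda>x. 0) = 0"
  by (simp add: L2_norm_def L2_inner_def)

lemma test_pair_in_H10: "open \<Omega> \<Longrightarrow> test_pair \<Omega> \<phi> G \<Longrightarrow> in_H10 \<Omega> \<phi> G"
  unfolding in_H10_iff
  by (intro conjI allI impI exI[of _ \<phi>] exI[of _ G]) (simp_all add: test_pair_in_L2 L2_norm_zero)

lemma in_H10_closed:
  assumes "open \<Omega>" "in_L2 \<Omega> u" "in_L2 \<Omega> g"
    and "\<And>e. e > 0 \<Longrightarrow> \<exists>v h. in_H10 \<Omega> v h \<and> L2_norm \<Omega> (\<lambda>x. v x - u x) < e \<and> L2_norm \<Omega> (\<lambda>x. h x - g x) < e"
  shows "in_H10 \<Omega> u g"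
  unfolding in_H10_iff[OF assms(1)]
proof (intro conjI assms allI impI)
  fix e :: real assume "e > 0"
  then obtain v h where vh: "in_H10 \<Omega> v h" "L2_norm \<Omega> (\<lambda>x. v x - u x) < e / 2" "L2_norm \<Omega> (\<lambda>x. h x - g x) < e / 2"
    using assms(4)[of "e / 2"] by auto
  obtain \<phi> G where tp: "test_pair \<Omega> \<phi> G" "L2_norm \<Omega> (\<lambda>x. \<phi> x - v x) < e / 2" "L2_norm \<Omega> (\<lambda>x. G x - h x) < e / 2"
    using vh(1) \<open>e > 0\<close> unfolding in_H10_iff[OF assms(1)] by (meson half_gt_zero)
  note L = test_pair_in_L2[OF assms(1) tp(1)] in_H10_L2[OF vh(1)]
  have "L2_norm \<Omega> (\<lambda>x. \<phi> x - u x) < e" "L2_norm \<Omega> (\<lambda>x. G x - g x) < e"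
    using L2_norm_diff_triangle[OF L(1,3) assms(2)] L2_norm_diff_triangle[OF L(2,4) assms(3)] vh tp by auto
  with tp show "\<exists>\<phi> G. test_pair \<Omega> \<phi> G \<and> L2_norm \<Omega> (\<lambda>x. \<phi> x - u x) < e \<and> L2_norm \<Omega> (\<lambda>x. G x - g x) < e"
    by blast
qed

lemma in_H10_add:
  assumes "open \<Omega>" "in_H10 \<Omega> u g" "in_H10 \<Omega> v h"
  shows "in_H10 \<Omega> (\<lambda>x. u x + v x) (\<lambda>x. g x + h x)"
  unfolding in_H10_iff[OF assms(1)]
proof (intro conjI in_L2_add in_H10_L2[OF assms(2)] in_H10_L2[OF assms(3)] allI impI)
  fix e :: real assume "e > 0"
  then obtain \<phi> G where 1: "test_pair \<Omega> \<phi> G" "L2_norm \<Omega> (\<lambda>x. \<phi> x - u x) < e / 2" "L2_norm \<Omega> (\<lambda>x. G x - g x) < e / 2"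
    using assms(2) unfolding in_H10_iff[OF assms(1)] by (meson half_gt_zero)
  obtain \<psi> H where 2: "test_pair \<Omega> \<psi> H" "L2_norm \<Omega> (\<lambda>x. \<psi> x - v x) < e / 2" "L2_norm \<Omega> (\<lambda>x. H x - h x) < e / 2"
    using assms(3) \<open>e > 0\<close> unfolding in_H10_iff[OF assms(1)] by (meson half_gt_zero)
  note L = in_L2_diff[OF test_pair_in_L2(1)[OF assms(1) 1(1)] in_H10_L2(1)[OF assms(2)]]
    in_L2_diff[OF test_pair_in_L2(2)[OF assms(1) 1(1)] in_H10_L2(2)[OF assms(2)]]
    in_L2_diff[OF test_pair_in_L2(1)[OF assms(1) 2(1)] in_H10_L2(1)[OF assms(3)]]
    in_L2_diff[OF test_pair_in_L2(2)[OF assms(1) 2(1)] in_H10_L2(2)[OF assms(3)]]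
  have "L2_norm \<Omega> (\<lambda>x. \<phi> x + \<psi> x - (u x + v x)) < e" "L2_norm \<Omega> (\<lambda>x. G x + H x - (g x + h x)) < e"
    using L2_norm_triangle[OF L(1,3)] L2_norm_triangle[OF L(2,4)] 1 2 by (auto simp: algebra_simps)
  with test_pair_add[OF 1(1) 2(1)]
  show "\<exists>\<phi> G. test_pair \<Omega> \<phi> G \<and> L2_norm \<Omega> (\<lambda>x. \<phi> x - (u x + v x)) < e \<and> L2_norm \<Omega> (\<lambda>x. G x - (g x + h x)) < e"
    by blast
qed

lemma in_H10_scaleR:
  assumes "open \<Omega>" "in_H10 \<Omega> u g"
  shows "in_H10 \<Omega> (\<lambda>x. c *\<^sub>R u x) (\<lambda>x. c *\<^sub>R g x)"
  unfolding in_H10_iff[OF assms(1)]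
proof (intro conjI allI impI)
  show "in_L2 \<Omega> (\<lambda>x. c *\<^sub>R u x)" "in_L2 \<Omega> (\<lambda>x. c *\<^sub>R g x)"
    by (rule in_L2_scaleR, rule in_H10_L2[OF assms(2)])+
  fix e :: real assume "e > 0"
  then have e: "e / (\<bar>c\<bar> + 1) > 0" by simp
  then obtain \<phi> G where 1: "test_pair \<Omega> \<phi> G" "L2_norm \<Omega> (\<lambda>x. \<phi> x - u x) < e / (\<bar>c\<bar> + 1)" "L2_norm \<Omega> (\<lambda>x. G x - g x) < e / (\<bar>c\<bar> + 1)"
    using assms(2) unfolding in_H10_iff[OF assms(1)] by blast
  have less: "\<bar>c\<bar> * a < e" if "a < e / (\<bar>c\<bar> + 1)" for a
  proof -
    have "\<bar>c\<bar> * a \<le> \<bar>c\<bar> * (e / (\<bar>c\<bar> + 1))" using that by (intro mult_left_mono) auto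
    also have "\<dots> < e" using \<open>e > 0\<close> by (simp add: field_simps)
    finally show ?thesis .
  qed
  have "L2_norm \<Omega> (\<lambda>x. c * \<phi> x - c *\<^sub>R u x) = \<bar>c\<bar> * L2_norm \<Omega> (\<lambda>x. \<phi> x - u x)"
    using L2_norm_scaleR[of \<Omega> c "\<lambda>x. \<phi> x - u x"] by (simp add: algebra_simps)
  moreover have "L2_norm \<Omega> (\<lambda>x. c *\<^sub>R G x - c *\<^sub>R g x) = \<bar>c\<bar> * L2_norm \<Omega> (\<lambda>x. G x - g x)"
    using L2_norm_scaleR[of \<Omega> c "\<lambda>x. G x - g x"] by (simp add: algebra_simps)
  ultimately show "\<exists>\<phi> G. test_pair \<Omega> \<phi> G \<and> L2_norm \<Omega> (\<lambda>x. \<phi> x - c *\<^sub>R u x) < e \<and> L2_norm \<Omega> (\<lambda>x. G x - c *\<^sub>R g x) < e"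
    using test_pair_scaleR[OF 1(1), of c] less[OF 1(2)] less[OF 1(3)]
    by (intro exI[of _ "\<lambda>x. c * \<phi> x"] exI[of _ "\<lambda>x. c *\<^sub>R G x"]) simp
qed

lemma in_H10_zero: "open \<Omega> \<Longrightarrow> in_H10 \<Omega> (\<lambda>x. 0) (\<lambda>x. 0)"
  by (rule test_pair_in_H10) (simp_all add: test_pair_def test_function_def C_k_const GDERIV_const)

lemma in_H10_diff:
  assumes "open \<Omega>" "in_H10 \<Omega> u g" "in_H10 \<Omega> v h"
  shows "in_H10 \<Omega> (\<lambda>x. u x - v x) (\<lambda>x. g x - h x)"
  using in_H10_add[OF assms(1,2) in_H10_scaleR[OF assms(1,3), of "-1"]] by simp

lemma in_H10_sum:
  assumes "open \<Omega>" "\<And>i. i \<in> A \<Longrightarrow> in_H10 \<Omega> (u i) (g i)"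
  shows "in_H10 \<Omega> (\<lambda>x. \<Sum>i\<in>A. u i x) (\<lambda>x. \<Sum>i\<in>A. g i x)"
  using assms(2)
proof (induction A rule: infinite_finite_induct)
  case (insert a A)
  then have "in_H10 \<Omega> (\<lambda>x. u a x + (\<Sum>i\<in>A. u i x)) (\<lambda>x. g a x + (\<Sum>i\<in>A. g i x))"
    by (intro in_H10_add[OF assms(1)]) simp_all
  with insert show ?case by simp
qed (simp_all add: in_H10_zero[OF assms(1)])

text \<open>Completeness of the form domain. That the limit of the gradients is the gradient of the
  limit holds because the relation \<open>in_H10\<close> is closed.\<close>

lemma H10_limit:
  assumes "open \<Omega>" "\<Omega> \<in> lmeasurable" "\<And>n. in_H10 \<Omega> (u n) (g n)"
    and "\<And>e. e > 0 \<Longrightarrow> \<exists>N. \<forall>m\<ge>N. \<forall>n\<ge>N. L2_norm \<Omega> (\<lambda>x. u m x - u n x) < e"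
    and "\<And>e. e > 0 \<Longrightarrow> \<exists>N. \<forall>m\<ge>N. \<forall>n\<ge>N. L2_norm \<Omega> (\<lambda>x. g m x - g n x) < e"
  obtains v h where "in_H10 \<Omega> v h" "(\<lambda>n. L2_norm \<Omega> (\<lambda>x. u n x - v x)) \<longlonglongrightarrow> 0"
    "(\<lambda>n. L2_norm \<Omega> (\<lambda>x. g n x - h x)) \<longlonglongrightarrow> 0"
proof -
  have "\<exists>v. in_L2 \<Omega> v \<and> (\<lambda>n. L2_norm \<Omega> (\<lambda>x. u n x - v x)) \<longlonglongrightarrow> 0"
  proof (rule L2_complete[OF assms(2)])
    show "in_L2 \<Omega> (u n)" for n using in_H10_L2(1)[OF assms(3)] .
    show "\<exists>N. \<forall>m\<ge>N. \<forall>n\<ge>N. L2_norm \<Omega> (\<lambda>x. u m x - u n x) < e" if "e > 0" for e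
      using assms(4)[OF that] .
  qed
  then obtain v where v: "in_L2 \<Omega> v" "(\<lambda>n. L2_norm \<Omega> (\<lambda>x. u n x - v x)) \<longlonglongrightarrow> 0"
    by blast
  have "\<exists>h. in_L2 \<Omega> h \<and> (\<lambda>n. L2_norm \<Omega> (\<lambda>x. g n x - h x)) \<longlonglongrightarrow> 0"
  proof (rule L2_complete[OF assms(2)])
    show "in_L2 \<Omega> (g n)" for n using in_H10_L2(2)[OF assms(3)] .
    show "\<exists>N. \<forall>m\<ge>N. \<forall>n\<ge>N. L2_norm \<Omega> (\<lambda>x. g m x - g n x) < e" if "e > 0" for e
      using assms(5)[OF that] .
  qed
  then obtain h where h: "in_L2 \<Omega> h" "(\<lambda>n. L2_norm \<Omega> (\<lambda>x. g n x - h x)) \<longlonglongrightarrow> 0"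
    by blast
  have "in_H10 \<Omega> v h"
  proof (rule in_H10_closed[OF assms(1) v(1) h(1)])
    fix e :: real assume "e > 0"
    then have "\<forall>\<^sub>F n in sequentially. L2_norm \<Omega> (\<lambda>x. u n x - v x) < e \<and> L2_norm \<Omega> (\<lambda>x. g n x - h x) < e"
      by (intro eventually_conj order_tendstoD(2)[OF v(2)] order_tendstoD(2)[OF h(2)])
    from eventually_happens'[OF sequentially_bot this]
    obtain n where "L2_norm \<Omega> (\<lambda>x. u n x - v x) < e" "L2_norm \<Omega> (\<lambda>x. g n x - h x) < e" by blast
    with assms(3)[of n] show "\<exists>w k. in_H10 \<Omega> w k \<and> L2_norm \<Omega> (\<lambda>x. w x - v x) < e \<and> L2_norm \<Omega> (\<lambda>x. k x - h x) < e"
      by blast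
  qed
  from that[OF this v(2) h(2)] show ?thesis .
qed

section \<open>The compact embedding of the Sobolev space\<close>

lemma nn_integral_lborel_translate:
  fixes f :: "'a::euclidean_space \<Rightarrow> ennreal"
  assumes [measurable]: "f \<in> borel_measurable borel"
  shows "(\<integral>\<^sup>+x. f (x + v) \<partial>lborel) = (\<integral>\<^sup>+x. f x \<partial>lborel)"
proof -
  have "(\<integral>\<^sup>+x. f x \<partial>lborel) = (\<integral>\<^sup>+x. f x \<partial>distr lborel borel ((+) v))"
    by (simp only: lborel_distr_plus)
  also have "\<dots> = (\<integral>\<^sup>+x. f (v + x) \<partial>lborel)"
    by (rule nn_integral_distr) simp_all
  finally show ?thesis by (simp add: add.commute)
qed

text \<open>Nonnegativity of the variance; stated in \<open>ennreal\<close> so that an infinite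
  second moment is covered.\<close>

lemma (in prob_space) expectation_power2_le:
  fixes h :: "'a \<Rightarrow> real"
  assumes "integrable M h"
  shows "ennreal ((expectation h)\<^sup>2) \<le> (\<integral>\<^sup>+x. ennreal ((h x)\<^sup>2) \<partial>M)"
proof (cases "(\<integral>\<^sup>+x. ennreal ((h x)\<^sup>2) \<partial>M) = \<infinity>")
  case False
  have [measurable]: "h \<in> borel_measurable M" using assms by auto
  have sq: "integrable M (\<lambda>x. (h x)\<^sup>2)"
    using False by (intro integrableI_bounded) (auto simp: less_top)
  have "variance h = expectation (\<lambda>x. (h x)\<^sup>2) - (expectation h)\<^sup>2"
    by (rule variance_eq[OF assms sq])
  moreover have "variance h \<ge> 0" by (rule variance_positive)
  ultimately have "(expectation h)\<^sup>2 \<le> expectation (\<lambda>x. (h x)\<^sup>2)" by simp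
  then show ?thesis
    by (subst nn_integral_eq_integral[OF sq]) (auto intro: ennreal_leI)
qed simp

text \<open>The difference f(x + v) - f(x) is the mean over t in [0,1] of the derivative along the
  segment. Jensen bounds its square, and integrating over x before t removes the shift by t
  v.\<close>

lemma translation_estimate:
  fixes f :: "'a::euclidean_space \<Rightarrow> real"
  assumes D: "\<And>x. GDERIV f x :> G x" and G: "continuous_on UNIV G"
  shows "(\<integral>\<^sup>+x. ennreal ((f (x + v) - f x)\<^sup>2) \<partial>lborel)
    \<le> ennreal ((norm v)\<^sup>2) * (\<integral>\<^sup>+x. ennreal ((norm (G x))\<^sup>2) \<partial>lborel)"
proof -
  let ?P = "restrict_space lborel {0..1::real}"
  interpret P: prob_space ?P
    by (rule prob_spaceI) (simp add: space_restrict_space emeasure_restrict_space)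
  interpret pair_sigma_finite lborel ?P ..
  have [measurable]: "G \<in> borel_measurable borel"
    using G by (rule borel_measurable_continuous_onI)
  have pointwise: "ennreal ((f (x + v) - f x)\<^sup>2) \<le> (\<integral>\<^sup>+t. ennreal ((norm v)\<^sup>2) * ennreal ((norm (G (x + t *\<^sub>R v)))\<^sup>2) \<partial>?P)" for x
  proof -
    have cont: "continuous_on {0..1} (\<lambda>t. G (x + t *\<^sub>R v) \<bullet> v)"
      by (intro continuous_on_inner continuous_on_const continuous_on_compose2[OF G] continuous_on_add
          continuous_on_scaleR continuous_on_id) auto
    have "((\<lambda>t. f (x + t *\<^sub>R v)) has_vector_derivative G (x + t *\<^sub>R v) \<bullet> v) (at t within {0..1})" for t :: real
    proof -
      have "((\<lambda>t. x + t *\<^sub>R v) has_derivative (\<lambda>s. s *\<^sub>R v)) (at t within {0..1})"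
        by (auto intro!: derivative_eq_intros)
      moreover have "(f has_derivative (\<lambda>h. h \<bullet> G (x + t *\<^sub>R v))) (at (x + t *\<^sub>R v))"
        using D by (simp add: gderiv_def)
      ultimately have "((\<lambda>t. f (x + t *\<^sub>R v)) has_derivative (\<lambda>s. (s *\<^sub>R v) \<bullet> G (x + t *\<^sub>R v))) (at t within {0..1})"
        by (rule has_derivative_compose)
      then show ?thesis
        by (simp add: has_vector_derivative_def inner_commute)
    qed
    then have "(\<integral>t. indicator {0..1} t *\<^sub>R (G (x + t *\<^sub>R v) \<bullet> v) \<partial>lborel) = f (x + 1 *\<^sub>R v) - f (x + 0 *\<^sub>R v)"
      by (intro integral_FTC_atLeastAtMost cont) auto
    then have "f (x + v) - f x = P.expectation (\<lambda>t. G (x + t *\<^sub>R v) \<bullet> v)"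
      by (subst integral_restrict_space) auto
    moreover have "integrable ?P (\<lambda>t. G (x + t *\<^sub>R v) \<bullet> v)"
      using borel_integrable_compact[OF compact_Icc cont]
      by (subst integrable_restrict_space) (auto simp: set_integrable_def)
    ultimately have "ennreal ((f (x + v) - f x)\<^sup>2) \<le> (\<integral>\<^sup>+t. ennreal ((G (x + t *\<^sub>R v) \<bullet> v)\<^sup>2) \<partial>?P)"
      using P.expectation_power2_le by simp
    also have "\<dots> \<le> (\<integral>\<^sup>+t. ennreal ((norm v)\<^sup>2) * ennreal ((norm (G (x + t *\<^sub>R v)))\<^sup>2) \<partial>?P)"
    proof (rule nn_integral_mono)
      fix t
      have "(G (x + t *\<^sub>R v) \<bullet> v)\<^sup>2 \<le> (norm v)\<^sup>2 * (norm (G (x + t *\<^sub>R v)))\<^sup>2"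
        using Cauchy_Schwarz_ineq[of "G (x + t *\<^sub>R v)" v] by (simp add: power2_norm_eq_inner mult.commute)
      then show "ennreal ((G (x + t *\<^sub>R v) \<bullet> v)\<^sup>2) \<le> ennreal ((norm v)\<^sup>2) * ennreal ((norm (G (x + t *\<^sub>R v)))\<^sup>2)"
        by (simp add: ennreal_mult[symmetric] ennreal_leI)
    qed
    finally show ?thesis .
  qed
  have meas: "(\<lambda>t. t) \<in> borel_measurable ?P"
    by (simp add: measurable_restrict_space1)
  have [measurable]: "(\<lambda>(x, t). ennreal ((norm v)\<^sup>2) * ennreal ((norm (G (x + t *\<^sub>R v)))\<^sup>2)) \<in> borel_measurable (lborel \<Otimes>\<^sub>M ?P)"
    using meas by measurable
  have "(\<integral>\<^sup>+x. ennreal ((f (x + v) - f x)\<^sup>2) \<partial>lborel)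
    \<le> (\<integral>\<^sup>+x. \<integral>\<^sup>+t. ennreal ((norm v)\<^sup>2) * ennreal ((norm (G (x + t *\<^sub>R v)))\<^sup>2) \<partial>?P \<partial>lborel)"
    by (intro nn_integral_mono pointwise)
  also have "\<dots> = (\<integral>\<^sup>+t. \<integral>\<^sup>+x. ennreal ((norm v)\<^sup>2) * ennreal ((norm (G (x + t *\<^sub>R v)))\<^sup>2) \<partial>lborel \<partial>?P)"
    by (rule Fubini'[symmetric]) measurable
  also have "\<dots> = (\<integral>\<^sup>+t. ennreal ((norm v)\<^sup>2) * (\<integral>\<^sup>+x. ennreal ((norm (G x))\<^sup>2) \<partial>lborel) \<partial>?P)"
    by (subst nn_integral_cmult) (auto simp: nn_integral_lborel_translate[of "\<lambda>x. ennreal ((norm (G x))\<^sup>2)"])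
  also have "\<dots> = ennreal ((norm v)\<^sup>2) * (\<integral>\<^sup>+x. ennreal ((norm (G x))\<^sup>2) \<partial>lborel)"
    using P.emeasure_space_1 by (simp add: space_restrict_space)
  finally show ?thesis .
qed

text \<open>The smoothing behind Rellich's theorem: for fixed r the averages are bounded and
  equi-Lipschitz in terms of the L2 norms of function and gradient, and they differ from f by at
  most r times the gradient norm.\<close>

definition ball_average :: "real \<Rightarrow> ('a::euclidean_space \<Rightarrow> real) \<Rightarrow> 'a \<Rightarrow> real" where
  "ball_average r f x = (LINT y|uniform_measure lborel (ball 0 r). f (x + y))"

lemma prob_space_uniform_ball: "r > 0 \<Longrightarrow> prob_space (uniform_measure lborel (ball (0::'a::euclidean_space) r))"
  using emeasure_bounded_finite[of "ball (0::'a) r"] content_ball_pos[of r "0::'a"]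
  by (intro prob_space_uniform_measure) (auto simp: measure_def)

lemma nn_integral_uniform_ball_le:
  fixes h :: "'a::euclidean_space \<Rightarrow> ennreal"
  assumes "r > 0" and [measurable]: "h \<in> borel_measurable borel"
  shows "(\<integral>\<^sup>+y. h y \<partial>uniform_measure lborel (ball 0 r)) \<le> (\<integral>\<^sup>+y. h y \<partial>lborel) / emeasure lborel (ball (0::'a) r)"
proof -
  have "(\<integral>\<^sup>+y. h y \<partial>uniform_measure lborel (ball 0 r)) = (\<integral>\<^sup>+y. h y * indicator (ball 0 r) y \<partial>lborel) / emeasure lborel (ball (0::'a) r)"
    by (rule nn_integral_uniform_measure) auto
  also have "\<dots> \<le> (\<integral>\<^sup>+y. h y \<partial>lborel) / emeasure lborel (ball (0::'a) r)"
    by (intro divide_right_mono_ennreal nn_integral_mono) (auto simp: indicator_def)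
  finally show ?thesis .
qed

context
  fixes r :: real and f :: "'a::euclidean_space \<Rightarrow> real" and G :: "'a \<Rightarrow> 'a" and K :: "'a set"
  assumes r: "r > 0" and D: "\<And>x. GDERIV f x :> G x" and f: "continuous_on UNIV f" and G: "continuous_on UNIV G"
    and K: "compact K" "\<And>x. x \<notin> K \<Longrightarrow> f x = 0"
begin

private lemma f_measurable: "f \<in> borel_measurable borel"
  using f by (rule borel_measurable_continuous_onI)

private lemma f_bounded: "\<exists>B. \<forall>x. \<bar>f x\<bar> \<le> B"
proof -
  have "compact (f ` K)"
    by (rule compact_continuous_image[OF continuous_on_subset[OF f] K(1)]) simp
  then obtain B where "\<forall>y\<in>f ` K. norm y \<le> B"
    using compact_imp_bounded bounded_iff by blast
  then have "\<bar>f x\<bar> \<le> max B 0" for x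
    using K(2)[of x] by (cases "x \<in> K") (auto simp: le_max_iff_disj)
  then show ?thesis by blast
qed

private lemma f_translate_integrable: "integrable (uniform_measure lborel (ball (0::'a) r)) (\<lambda>y. f (x + y))"
proof -
  note [measurable] = f_measurable
  interpret P: prob_space "uniform_measure lborel (ball (0::'a) r)"
    by (rule prob_space_uniform_ball[OF r])
  obtain B where B: "\<And>x. \<bar>f x\<bar> \<le> B" using f_bounded by blast
  show ?thesis
    by (rule P.integrable_const_bound[where B = B]) (auto intro!: always_eventually B)
qed

text \<open>Jensen leads to the mean of the squared differences. Enlarging the ball to the whole
  space leaves the factor 1 / volume and a pure translation by x - x'.\<close>

lemma ball_average_Lipschitz:
  "ennreal ((ball_average r f x - ball_average r f x')\<^sup>2)
    \<le> ennreal ((norm (x - x'))\<^sup>2) * (\<integral>\<^sup>+x. ennreal ((norm (G x))\<^sup>2) \<partial>lborel) / emeasure lborel (ball (0::'a) r)"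
proof -
  note [measurable] = f_measurable
  let ?P = "uniform_measure lborel (ball (0::'a) r)"
  interpret P: prob_space ?P by (rule prob_space_uniform_ball[OF r])
  have "ball_average r f x - ball_average r f x' = P.expectation (\<lambda>y. f (x + y) - f (x' + y))"
    unfolding ball_average_def
    by (rule Bochner_Integration.integral_diff[symmetric]; rule f_translate_integrable)
  then have "ennreal ((ball_average r f x - ball_average r f x')\<^sup>2) \<le> (\<integral>\<^sup>+y. ennreal ((f (x + y) - f (x' + y))\<^sup>2) \<partial>?P)"
    using P.expectation_power2_le[of "\<lambda>y. f (x + y) - f (x' + y)"] f_translate_integrable by simp
  also have "\<dots> \<le> (\<integral>\<^sup>+y. ennreal ((f (x + y) - f (x' + y))\<^sup>2) \<partial>lborel) / emeasure lborel (ball (0::'a) r)"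
    by (rule nn_integral_uniform_ball_le[OF r]) measurable
  also have "(\<integral>\<^sup>+y. ennreal ((f (x + y) - f (x' + y))\<^sup>2) \<partial>lborel) = (\<integral>\<^sup>+y. ennreal ((f (y + (x - x')) - f y)\<^sup>2) \<partial>lborel)"
    using nn_integral_lborel_translate[of "\<lambda>y. ennreal ((f (y + (x - x')) - f y)\<^sup>2)" x', symmetric]
    by (simp add: algebra_simps)
  also have "\<dots> / emeasure lborel (ball (0::'a) r) \<le> ennreal ((norm (x - x'))\<^sup>2) * (\<integral>\<^sup>+x. ennreal ((norm (G x))\<^sup>2) \<partial>lborel) / emeasure lborel (ball (0::'a) r)"
    by (intro divide_right_mono_ennreal translation_estimate[OF D G])
  finally show ?thesis .
qed

lemma ball_average_bounded:
  "ennreal ((ball_average r f x)\<^sup>2) \<le> (\<integral>\<^sup>+x. ennreal ((f x)\<^sup>2) \<partial>lborel) / emeasure lborel (ball (0::'a) r)"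
proof -
  note [measurable] = f_measurable
  let ?P = "uniform_measure lborel (ball (0::'a) r)"
  interpret P: prob_space ?P by (rule prob_space_uniform_ball[OF r])
  have "ennreal ((ball_average r f x)\<^sup>2) \<le> (\<integral>\<^sup>+y. ennreal ((f (x + y))\<^sup>2) \<partial>?P)"
    unfolding ball_average_def by (rule P.expectation_power2_le[OF f_translate_integrable])
  also have "\<dots> \<le> (\<integral>\<^sup>+y. ennreal ((f (x + y))\<^sup>2) \<partial>lborel) / emeasure lborel (ball (0::'a) r)"
    by (rule nn_integral_uniform_ball_le[OF r]) measurable
  also have "(\<integral>\<^sup>+y. ennreal ((f (x + y))\<^sup>2) \<partial>lborel) = (\<integral>\<^sup>+y. ennreal ((f y)\<^sup>2) \<partial>lborel)"
    using nn_integral_lborel_translate[of "\<lambda>y. ennreal ((f y)\<^sup>2)" x] by (simp add: add.commute)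
  finally show ?thesis .
qed

text \<open>By the translation estimate each shift y with norm y < r moves f by at most r times the
  gradient norm, and averaging over y keeps this bound.\<close>

lemma ball_average_close:
  "(\<integral>\<^sup>+x. ennreal ((f x - ball_average r f x)\<^sup>2) \<partial>lborel) \<le> ennreal (r\<^sup>2) * (\<integral>\<^sup>+x. ennreal ((norm (G x))\<^sup>2) \<partial>lborel)"
proof -
  note [measurable] = f_measurable
  let ?P = "uniform_measure lborel (ball (0::'a) r)"
  interpret P: prob_space ?P by (rule prob_space_uniform_ball[OF r])
  interpret pair_sigma_finite lborel ?P ..
  have P1: "P.prob UNIV = 1" using P.prob_space by simp
  have "ennreal ((f x - ball_average r f x)\<^sup>2) \<le> (\<integral>\<^sup>+y. ennreal ((f (x + y) - f x)\<^sup>2) \<partial>?P)" for x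
  proof -
    have int: "integrable ?P (\<lambda>y. f (x + y) - f x)"
      by (intro Bochner_Integration.integrable_diff f_translate_integrable) simp
    have "ball_average r f x - f x = P.expectation (\<lambda>y. f (x + y) - f x)"
      unfolding ball_average_def
      by (subst Bochner_Integration.integral_diff) (auto simp: f_translate_integrable P1)
    then have "(P.expectation (\<lambda>y. f (x + y) - f x))\<^sup>2 = (f x - ball_average r f x)\<^sup>2"
      by (metis power2_commute)
    with P.expectation_power2_le[OF int] show ?thesis by simp
  qed
  then have "(\<integral>\<^sup>+x. ennreal ((f x - ball_average r f x)\<^sup>2) \<partial>lborel) \<le> (\<integral>\<^sup>+x. \<integral>\<^sup>+y. ennreal ((f (x + y) - f x)\<^sup>2) \<partial>?P \<partial>lborel)"
    by (intro nn_integral_mono)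
  also have "\<dots> = (\<integral>\<^sup>+y. \<integral>\<^sup>+x. ennreal ((f (x + y) - f x)\<^sup>2) \<partial>lborel \<partial>?P)"
    by (rule Fubini'[symmetric]) measurable
  also have "\<dots> \<le> (\<integral>\<^sup>+y. ennreal (r\<^sup>2) * (\<integral>\<^sup>+x. ennreal ((norm (G x))\<^sup>2) \<partial>lborel) \<partial>?P)"
  proof (rule nn_integral_mono_AE)
    have "AE y in ?P. y \<in> ball 0 r"
      using r by (intro AE_uniform_measureI) auto
    then show "AE y in ?P. (\<integral>\<^sup>+x. ennreal ((f (x + y) - f x)\<^sup>2) \<partial>lborel) \<le> ennreal (r\<^sup>2) * (\<integral>\<^sup>+x. ennreal ((norm (G x))\<^sup>2) \<partial>lborel)"
    proof eventually_elim
      case (elim y)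
      have "(\<integral>\<^sup>+x. ennreal ((f (x + y) - f x)\<^sup>2) \<partial>lborel) \<le> ennreal ((norm y)\<^sup>2) * (\<integral>\<^sup>+x. ennreal ((norm (G x))\<^sup>2) \<partial>lborel)"
        by (rule translation_estimate[OF D G])
      also have "\<dots> \<le> ennreal (r\<^sup>2) * (\<integral>\<^sup>+x. ennreal ((norm (G x))\<^sup>2) \<partial>lborel)"
        using elim by (intro mult_right_mono ennreal_leI power_mono) auto
      finally show ?case .
    qed
  qed
  also have "\<dots> = ennreal (r\<^sup>2) * (\<integral>\<^sup>+x. ennreal ((norm (G x))\<^sup>2) \<partial>lborel)"
    using P.emeasure_space_1 by simp
  finally show ?thesis .
qed

end

section \<open>Rellich's theorem\<close>

lemma nn_integral_test_pair:
  assumes \<Omega>: "open \<Omega>" and tp: "test_pair \<Omega> \<phi> G"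
  shows "(\<integral>\<^sup>+x. ennreal ((\<phi> x)\<^sup>2) \<partial>lborel) = ennreal ((L2_norm \<Omega> \<phi>)\<^sup>2)"
    and "(\<integral>\<^sup>+x. ennreal ((norm (G x))\<^sup>2) \<partial>lborel) = ennreal ((L2_norm \<Omega> G)\<^sup>2)"
proof -
  obtain K where K: "compact K" "K \<subseteq> \<Omega>" "\<And>x. x \<notin> K \<Longrightarrow> \<phi> x = 0" "\<And>x. x \<notin> K \<Longrightarrow> G x = 0"
    using test_pair_support[OF tp] by blast
  note cont = test_pair_continuous[OF tp]
  have c1: "continuous_on UNIV (\<lambda>x. (\<phi> x)\<^sup>2)" using cont(1) by (rule continuous_on_power)
  have c2: "continuous_on UNIV (\<lambda>x. (norm (G x))\<^sup>2)" using cont(2) by (intro continuous_on_power continuous_on_norm)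
  have \<Omega>': "\<Omega> \<in> sets lebesgue" using \<Omega> by simp
  have i1: "integrable lborel (\<lambda>x. (\<phi> x)\<^sup>2)"
    by (rule continuous_compact_support_integrable[OF c1 K(1)]) (simp add: K(3))
  have i2: "integrable lborel (\<lambda>x. (norm (G x))\<^sup>2)"
    by (rule continuous_compact_support_integrable[OF c2 K(1)]) (simp add: K(4))
  have "(L2_norm \<Omega> \<phi>)\<^sup>2 = (LINT x|lborel. (\<phi> x)\<^sup>2)"
    unfolding L2_norm_power2_integral using K(2,3) c1
    by (subst integral_lebesgue_on_eq_lborel(1)[OF \<Omega>', symmetric]) (auto simp: borel_measurable_continuous_onI)
  then show "(\<integral>\<^sup>+x. ennreal ((\<phi> x)\<^sup>2) \<partial>lborel) = ennreal ((L2_norm \<Omega> \<phi>)\<^sup>2)"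
    using nn_integral_eq_integral[OF i1] by simp
  have "(L2_norm \<Omega> G)\<^sup>2 = (LINT x|lborel. (norm (G x))\<^sup>2)"
    unfolding L2_norm_power2_integral using K(2,4) c2
    by (subst integral_lebesgue_on_eq_lborel(1)[OF \<Omega>', symmetric]) (auto simp: borel_measurable_continuous_onI)
  then show "(\<integral>\<^sup>+x. ennreal ((norm (G x))\<^sup>2) \<partial>lborel) = ennreal ((L2_norm \<Omega> G)\<^sup>2)"
    using nn_integral_eq_integral[OF i2] by simp
qed

lemma nn_integral_lebesgue_on_le:
  fixes h :: "'a::euclidean_space \<Rightarrow> ennreal"
  assumes "\<Omega> \<in> sets lebesgue" "h \<in> borel_measurable borel"
  shows "(\<integral>\<^sup>+x. h x \<partial>lebesgue_on \<Omega>) \<le> (\<integral>\<^sup>+x. h x \<partial>lborel)"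
proof -
  have "(\<integral>\<^sup>+x. h x \<partial>lebesgue_on \<Omega>) = (\<integral>\<^sup>+x. h x * indicator \<Omega> x \<partial>lebesgue)"
    using assms by (subst nn_integral_restrict_space) auto
  also have "\<dots> \<le> (\<integral>\<^sup>+x. h x \<partial>lebesgue)"
    by (intro nn_integral_mono) (auto simp: indicator_def)
  also have "\<dots> = (\<integral>\<^sup>+x. h x \<partial>lborel)"
    by (rule nn_integral_completion)
  finally show ?thesis .
qed

lemma L2_norm_le_nn_integral:
  fixes f :: "'a::euclidean_space \<Rightarrow> real"
  assumes "\<Omega> \<in> sets lebesgue" "f \<in> borel_measurable borel" "in_L2 \<Omega> f" "c \<ge> 0"
    and "(\<integral>\<^sup>+x. ennreal ((f x)\<^sup>2) \<partial>lborel) \<le> ennreal (c\<^sup>2)"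
  shows "L2_norm \<Omega> f \<le> c"
proof -
  have "ennreal ((L2_norm \<Omega> f)\<^sup>2) = (\<integral>\<^sup>+x. ennreal ((f x)\<^sup>2) \<partial>lebesgue_on \<Omega>)"
    unfolding L2_norm_power2_integral using assms(3)
    by (subst nn_integral_eq_integral) (auto simp: in_L2_def)
  also have "\<dots> \<le> (\<integral>\<^sup>+x. ennreal ((f x)\<^sup>2) \<partial>lborel)"
    using assms(1,2) by (intro nn_integral_lebesgue_on_le) auto
  also note assms(5)
  finally have "(L2_norm \<Omega> f)\<^sup>2 \<le> c\<^sup>2" by simp
  then show ?thesis using assms(4) by (rule power2_le_imp_le)
qed

lemma in_L2_bounded_continuous:
  fixes f :: "'a::euclidean_space \<Rightarrow> 'b::euclidean_space"
  assumes "\<Omega> \<in> lmeasurable" "continuous_on UNIV f" "\<And>x. norm (f x) \<le> B"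
  shows "in_L2 \<Omega> f"
proof (rule in_L2_boundI)
  interpret finite_measure "lebesgue_on \<Omega>" by (rule finite_measure_lebesgue_on[OF assms(1)])
  have "f \<in> borel_measurable lebesgue"
    using assms(2) by (simp add: borel_measurable_continuous_onI measurable_completion)
  then show "f \<in> borel_measurable (lebesgue_on \<Omega>)"
    using measurable_restrict_space1 by blast
  show "integrable (lebesgue_on \<Omega>) (\<lambda>x. B\<^sup>2)" by simp
  show "(norm (f x))\<^sup>2 \<le> B\<^sup>2" for x
    using assms(3) by (simp add: power_mono)
qed

lemma L2_norm_le_const:
  fixes f :: "'a::euclidean_space \<Rightarrow> real"
  assumes "\<Omega> \<in> lmeasurable" "in_L2 \<Omega> f" "c \<ge> 0" "\<And>x. x \<in> \<Omega> \<Longrightarrow> \<bar>f x\<bar> \<le> c"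
  shows "L2_norm \<Omega> f \<le> c * sqrt (measure lebesgue \<Omega>)"
proof (rule power2_le_imp_le)
  interpret finite_measure "lebesgue_on \<Omega>" by (rule finite_measure_lebesgue_on[OF assms(1)])
  have "(L2_norm \<Omega> f)\<^sup>2 \<le> (LINT x|lebesgue_on \<Omega>. c\<^sup>2)"
    unfolding L2_norm_power2_integral
  proof (rule integral_mono)
    show "integrable (lebesgue_on \<Omega>) (\<lambda>x. (norm (f x))\<^sup>2)" using assms(2) by (simp add: in_L2_def)
    show "(norm (f x))\<^sup>2 \<le> c\<^sup>2" if "x \<in> space (lebesgue_on \<Omega>)" for x
      using that assms(3,4) by (simp add: space_restrict_space abs_le_square_iff[symmetric])
  qed simp
  also have "\<dots> = c\<^sup>2 * measure lebesgue \<Omega>"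
    using assms(1) by (simp add: measure_restrict_space space_restrict_space fmeasurableD)
  finally show "(L2_norm \<Omega> f)\<^sup>2 \<le> (c * sqrt (measure lebesgue \<Omega>))\<^sup>2"
    by (simp add: power_mult_distrib)
qed (use assms in simp)

text \<open>At a fixed scale r the averages satisfy the hypotheses of Arzela-Ascoli on the compact
  closure of \<open>\<Omega>\<close>. Since r depends on e, this gives only a subsequence whose
  members are within e of each other; a diagonal argument comes later.\<close>

lemma rellich_test_pairs:
  fixes \<phi> :: "nat \<Rightarrow> 'a::euclidean_space \<Rightarrow> real"
  assumes \<Omega>: "open \<Omega>" "bounded \<Omega>" and tp: "\<And>n. test_pair \<Omega> (\<phi> n) (G n)"
    and B: "\<And>n. L2_norm \<Omega> (\<phi> n) \<le> B" "\<And>n. L2_norm \<Omega> (G n) \<le> B" and e: "e > 0"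
  shows "\<exists>k :: nat \<Rightarrow> nat. strict_mono k \<and> (\<forall>m n. L2_norm \<Omega> (\<lambda>x. \<phi> (k m) x - \<phi> (k n) x) < e)"
proof -
  have \<Omega>': "\<Omega> \<in> lmeasurable" using \<Omega> by (simp add: lmeasurable_open)
  have \<Omega>'': "\<Omega> \<in> sets lebesgue" using \<Omega> by simp
  have B0: "B \<ge> 0" using B(1)[of 0] L2_norm_nonneg order_trans by blast
  \<comment> \<open>Chosen so that averaging moves each function by at most
    \<open>r * B < e / 4\<close>.\<close>
  define r where "r = e / (4 * (B + 1))"
  have r: "r > 0" using B0 e by (simp add: r_def)
  define c where "c = measure lborel (ball (0::'a) r)"
  have c: "c > 0" using content_ball_pos[OF r] by (simp add: c_def)
  have em: "emeasure lborel (ball (0::'a) r) = ennreal c"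
    unfolding c_def by (rule emeasure_eq_ennreal_measure) (use emeasure_bounded_finite[of "ball (0::'a) r"] in auto)
  define F where "F n = ball_average r (\<phi> n)" for n
  note cont = test_pair_continuous[OF tp]
  have D: "\<And>x. GDERIV (\<phi> n) x :> G n x" for n using tp by (auto simp: test_pair_def)
  have "\<exists>K. compact K \<and> (\<forall>x. x \<notin> K \<longrightarrow> \<phi> n x = 0)" for n
    using test_pair_support[OF tp[of n]] by blast
  then obtain K where K: "\<And>n. compact (K n)" "\<And>n x. x \<notin> K n \<Longrightarrow> \<phi> n x = 0"
    by metis
  have Lip: "\<bar>F n x - F n y\<bar> \<le> B / sqrt c * norm (x - y)" for n x y
  proof -
    have "ennreal ((F n x - F n y)\<^sup>2) \<le> ennreal ((norm (x - y))\<^sup>2) * ennreal ((L2_norm \<Omega> (G n))\<^sup>2) / ennreal c"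
      using ball_average_Lipschitz[OF r D[of n] cont(1)[of n] cont(2)[of n] K(1)[of n] K(2)[where n = n], where x = x and x' = y] nn_integral_test_pair(2)[OF \<Omega>(1) tp[of n]]
      by (simp add: F_def em)
    also have "\<dots> = ennreal ((norm (x - y))\<^sup>2 * (L2_norm \<Omega> (G n))\<^sup>2 / c)"
      using c by (simp add: ennreal_mult[symmetric] divide_ennreal)
    also have "\<dots> \<le> ennreal ((norm (x - y))\<^sup>2 * B\<^sup>2 / c)"
      using c by (intro ennreal_leI divide_right_mono mult_left_mono power_mono B L2_norm_nonneg) auto
    finally have "(F n x - F n y)\<^sup>2 \<le> (norm (x - y))\<^sup>2 * B\<^sup>2 / c"
      using c by simp
    also have "\<dots> = (B / sqrt c * norm (x - y))\<^sup>2"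
      using c by (simp add: power_mult_distrib power_divide)
    finally show ?thesis
      using B0 c by (simp add: abs_le_square_iff[symmetric] abs_mult)
  qed
  have bnd: "\<bar>F n x\<bar> \<le> B / sqrt c" for n x
  proof -
    have "ennreal ((F n x)\<^sup>2) \<le> ennreal ((L2_norm \<Omega> (\<phi> n))\<^sup>2) / ennreal c"
      using ball_average_bounded[OF r D[of n] cont(1)[of n] cont(2)[of n] K(1)[of n] K(2)[where n = n], where x = x] nn_integral_test_pair(1)[OF \<Omega>(1) tp[of n]]
      by (simp add: F_def em)
    also have "\<dots> = ennreal ((L2_norm \<Omega> (\<phi> n))\<^sup>2 / c)"
      using c by (simp add: divide_ennreal)
    also have "\<dots> \<le> ennreal (B\<^sup>2 / c)"
      using c by (intro ennreal_leI divide_right_mono power_mono B L2_norm_nonneg) auto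
    finally have "(F n x)\<^sup>2 \<le> B\<^sup>2 / c"
      using c by simp
    also have "\<dots> = (B / sqrt c)\<^sup>2"
      using c by (simp add: power_divide)
    finally show ?thesis
      using B0 c by (simp add: abs_le_square_iff[symmetric])
  qed
  have contF: "continuous_on UNIV (F n)" for n
  proof (rule lipschitz_on_continuous_on)
    show "(B / sqrt c)-lipschitz_on UNIV (F n)"
      using Lip B0 c by (auto simp: lipschitz_on_def dist_norm)
  qed
  have L2F: "in_L2 \<Omega> (F n)" for n
    by (rule in_L2_bounded_continuous[OF \<Omega>' contF]) (use bnd in auto)
  have L2\<phi>: "in_L2 \<Omega> (\<phi> n)" for n
    by (rule test_pair_in_L2(1)[OF \<Omega>(1) tp])
  have close: "L2_norm \<Omega> (\<lambda>x. \<phi> n x - F n x) \<le> r * B" for n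
  proof (rule L2_norm_le_nn_integral[OF \<Omega>''])
    show "(\<lambda>x. \<phi> n x - F n x) \<in> borel_measurable borel"
      using cont(1)[of n] contF[of n] by (intro borel_measurable_continuous_onI continuous_on_diff)
    show "in_L2 \<Omega> (\<lambda>x. \<phi> n x - F n x)" by (intro in_L2_diff L2\<phi> L2F)
    have "(\<integral>\<^sup>+x. ennreal ((\<phi> n x - F n x)\<^sup>2) \<partial>lborel) \<le> ennreal (r\<^sup>2) * ennreal ((L2_norm \<Omega> (G n))\<^sup>2)"
      using ball_average_close[OF r D[of n] cont(1)[of n] cont(2)[of n] K(1)[of n] K(2)[where n = n]] nn_integral_test_pair(2)[OF \<Omega>(1) tp[of n]]
      by (simp add: F_def)
    also have "\<dots> \<le> ennreal (r\<^sup>2) * ennreal (B\<^sup>2)"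
      by (intro mult_left_mono ennreal_leI power_mono B L2_norm_nonneg) simp
    finally show "(\<integral>\<^sup>+x. ennreal ((\<phi> n x - F n x)\<^sup>2) \<partial>lborel) \<le> ennreal ((r * B)\<^sup>2)"
      by (simp add: ennreal_mult[symmetric] power_mult_distrib)
  qed (use r B0 in simp)
  define L where "L = B / sqrt c + 1"
  have L: "L > 0" using B0 c by (simp add: L_def add_nonneg_pos)
  obtain g k where k: "strict_mono (k :: nat \<Rightarrow> nat)"
    and unif: "\<And>e. 0 < e \<Longrightarrow> \<exists>N. \<forall>n x. n \<ge> N \<and> x \<in> closure \<Omega> \<longrightarrow> norm (F (k n) x - g x) < e"
  proof (rule Arzela_Ascoli[where S = "closure \<Omega>" and \<F> = F and M = "B / sqrt c"])
    show "compact (closure \<Omega>)" using \<Omega> by (simp add: compact_closure)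
    show "norm (F n x) \<le> B / sqrt c" for n x using bnd by simp
    fix x :: 'a and e' :: real assume e': "0 < e'"
    show "\<exists>d>0. \<forall>n y. y \<in> closure \<Omega> \<and> norm (x - y) < d \<longrightarrow> norm (F n x - F n y) < e'"
    proof (intro exI[of _ "e' / L"] conjI allI impI)
      show "e' / L > 0" using e' L by simp
      fix n y assume y: "y \<in> closure \<Omega> \<and> norm (x - y) < e' / L"
      have "norm (F n x - F n y) \<le> B / sqrt c * norm (x - y)"
        using Lip[of n x y] by simp
      also have "\<dots> \<le> L * norm (x - y)"
        by (rule mult_right_mono) (simp_all add: L_def)
      also have "\<dots> < e'" using y L by (simp add: field_simps)
      finally show "norm (F n x - F n y) < e'" .
    qed
  qed blast
  define v where "v = sqrt (measure lebesgue \<Omega>)"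
  have v: "v \<ge> 0" by (simp add: v_def)
  \<comment> \<open>Two averages then differ uniformly by at most 2 e1, hence by at most e / 2 in
    L2; the two averaging errors take the other half.\<close>
  define e1 where "e1 = e / (4 * (v + 1))"
  have e1: "e1 > 0" using e v by (simp add: e1_def)
  obtain N where N: "\<And>n x. n \<ge> N \<Longrightarrow> x \<in> closure \<Omega> \<Longrightarrow> norm (F (k n) x - g x) < e1"
    using unif[OF e1] by blast
  define k' where "k' n = k (n + N)" for n
  have "strict_mono k'"
    using k by (simp add: k'_def strict_mono_def)
  moreover have "L2_norm \<Omega> (\<lambda>x. \<phi> (k' m) x - \<phi> (k' n) x) < e" for m n
  proof -
    let ?a = "\<phi> (k' m)" and ?b = "\<phi> (k' n)" and ?A = "F (k' m)" and ?B = "F (k' n)"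
    have "\<bar>?A x - ?B x\<bar> \<le> 2 * e1" if "x \<in> \<Omega>" for x
      using N[of "m + N" x] N[of "n + N" x] that closure_subset[of \<Omega>] by (auto simp: k'_def)
    then have "L2_norm \<Omega> (\<lambda>x. ?A x - ?B x) \<le> 2 * e1 * v"
      unfolding v_def using e1 by (intro L2_norm_le_const \<Omega>' in_L2_diff L2F) auto
    moreover have "L2_norm \<Omega> (\<lambda>x. ?B x - ?b x) \<le> r * B"
      using close[of "k' n"] L2_norm_minus_commute[of \<Omega> ?B ?b] by simp
    moreover have "L2_norm \<Omega> (\<lambda>x. ?a x - ?b x) \<le> L2_norm \<Omega> (\<lambda>x. ?a x - ?A x) + L2_norm \<Omega> (\<lambda>x. ?A x - ?b x)"
      by (rule L2_norm_diff_triangle[OF L2\<phi> L2F L2\<phi>])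
    moreover have "L2_norm \<Omega> (\<lambda>x. ?A x - ?b x) \<le> L2_norm \<Omega> (\<lambda>x. ?A x - ?B x) + L2_norm \<Omega> (\<lambda>x. ?B x - ?b x)"
      by (rule L2_norm_diff_triangle[OF L2F L2F L2\<phi>])
    moreover have "r * B < e / 4"
      using e B0 by (simp add: r_def field_simps)
    moreover have "2 * e1 * v \<le> e / 2"
      using e v by (simp add: e1_def field_simps)
    ultimately show ?thesis using close[of "k' m"] by linarith
  qed
  ultimately show ?thesis by blast
qed

lemma rellich_eps:
  fixes u :: "nat \<Rightarrow> 'a::euclidean_space \<Rightarrow> real"
  assumes \<Omega>: "open \<Omega>" "bounded \<Omega>" and H: "\<And>n. in_H10 \<Omega> (u n) (g n)"
    and B: "\<And>n. L2_norm \<Omega> (u n) \<le> B" "\<And>n. L2_norm \<Omega> (g n) \<le> B" and e: "e > 0"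
  shows "\<exists>k :: nat \<Rightarrow> nat. strict_mono k \<and> (\<forall>m n. L2_norm \<Omega> (\<lambda>x. u (k m) x - u (k n) x) < e)"
proof -
  \<comment> \<open>The 1 keeps the norms of the approximations below B + 1; two errors of e / 4
    leave e / 2 for \<open>rellich_test_pairs\<close>.\<close>
  define d where "d = min 1 (e / 4)"
  have d: "d > 0" using e by (simp add: d_def)
  have "\<exists>p. test_pair \<Omega> (fst p) (snd p) \<and> L2_norm \<Omega> (\<lambda>x. fst p x - u n x) < d \<and> L2_norm \<Omega> (\<lambda>x. snd p x - g n x) < d" for n
    using H[of n] d unfolding in_H10_iff[OF \<Omega>(1)] by fastforce
  then have "\<forall>n. \<exists>p. test_pair \<Omega> (fst p) (snd p) \<and> L2_norm \<Omega> (\<lambda>x. fst p x - u n x) < d \<and> L2_norm \<Omega> (\<lambda>x. snd p x - g n x) < d"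
    by blast
  from choice[OF this] obtain p where p: "\<And>n. test_pair \<Omega> (fst (p n)) (snd (p n))"
    "\<And>n. L2_norm \<Omega> (\<lambda>x. fst (p n) x - u n x) < d" "\<And>n. L2_norm \<Omega> (\<lambda>x. snd (p n) x - g n x) < d"
    by blast
  note L = test_pair_in_L2[OF \<Omega>(1) p(1)] in_H10_L2[OF H]
  have B1: "L2_norm \<Omega> (fst (p n)) \<le> B + 1" for n
    using L2_norm_triangle_le[OF L(1)[of n] L(3)[of n]] B(1)[of n] p(2)[of n] by (simp add: d_def)
  have B2: "L2_norm \<Omega> (snd (p n)) \<le> B + 1" for n
    using L2_norm_triangle_le[OF L(2)[of n] L(4)[of n]] B(2)[of n] p(3)[of n] by (simp add: d_def)
  have "e / 2 > 0" using e by simp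
  from rellich_test_pairs[where \<phi> = "\<lambda>n. fst (p n)" and G = "\<lambda>n. snd (p n)", OF \<Omega> p(1) B1 B2 this]
  obtain k :: "nat \<Rightarrow> nat" where k: "strict_mono k" "\<And>m n. L2_norm \<Omega> (\<lambda>x. fst (p (k m)) x - fst (p (k n)) x) < e / 2"
    by blast
  have "L2_norm \<Omega> (\<lambda>x. u (k m) x - u (k n) x) < e" for m n
  proof -
    have "L2_norm \<Omega> (\<lambda>x. u (k m) x - u (k n) x) \<le> L2_norm \<Omega> (\<lambda>x. u (k m) x - fst (p (k m)) x) + L2_norm \<Omega> (\<lambda>x. fst (p (k m)) x - u (k n) x)"
      by (rule L2_norm_diff_triangle[OF L(3) L(1) L(3)])
    moreover have "L2_norm \<Omega> (\<lambda>x. fst (p (k m)) x - u (k n) x) \<le> L2_norm \<Omega> (\<lambda>x. fst (p (k m)) x - fst (p (k n)) x) + L2_norm \<Omega> (\<lambda>x. fst (p (k n)) x - u (k n) x)"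
      by (rule L2_norm_diff_triangle[OF L(1) L(1) L(3)])
    moreover have "L2_norm \<Omega> (\<lambda>x. u (k m) x - fst (p (k m)) x) < d"
      using p(2)[of "k m"] L2_norm_minus_commute[of \<Omega> "u (k m)" "fst (p (k m))"] by simp
    moreover have "d \<le> e / 4" by (simp add: d_def)
    ultimately show ?thesis using k(2)[of m n] p(2)[of "k n"] by linarith
  qed
  with k(1) show ?thesis by blast
qed

text \<open>Diagonal argument over the tolerances 1/(i+1). The property \<open>P i\<close> is
  inherited by subsequences, and from index i + 1 on the diagonal sequence runs inside the
  subsequence chosen for \<open>P i\<close>.\<close>

theorem rellich:
  fixes u :: "nat \<Rightarrow> 'a::euclidean_space \<Rightarrow> real"
  assumes \<Omega>: "open \<Omega>" "bounded \<Omega>" and H: "\<And>n. in_H10 \<Omega> (u n) (g n)"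
    and B: "\<And>n. L2_norm \<Omega> (u n) \<le> B" "\<And>n. L2_norm \<Omega> (g n) \<le> B"
  shows "\<exists>k :: nat \<Rightarrow> nat. strict_mono k \<and> (\<forall>e>0. \<exists>N. \<forall>m\<ge>N. \<forall>n\<ge>N. L2_norm \<Omega> (\<lambda>x. u (k m) x - u (k n) x) < e)"
proof -
  define P where "P i s \<longleftrightarrow> (\<forall>m n. L2_norm \<Omega> (\<lambda>x. u (s m) x - u (s n) x) < inverse (real (Suc i)))"
    for i and s :: "nat \<Rightarrow> nat"
  interpret subseqs P
  proof
    fix i and s :: "nat \<Rightarrow> nat"
    have "\<exists>k :: nat \<Rightarrow> nat. strict_mono k \<and> (\<forall>m n. L2_norm \<Omega> (\<lambda>x. u (s (k m)) x - u (s (k n)) x) < inverse (real (Suc i)))"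
      by (rule rellich_eps[where u = "\<lambda>n. u (s n)" and g = "\<lambda>n. g (s n)", OF \<Omega> H B]) simp
    then show "\<exists>r'. strict_mono r' \<and> P i (s \<circ> r')"
      by (simp add: P_def)
  qed
  have P: "P i (diagseq \<circ> (+) (Suc i))" for i
    by (rule diagseq_holds) (simp add: P_def)
  have "\<exists>N. \<forall>m\<ge>N. \<forall>n\<ge>N. L2_norm \<Omega> (\<lambda>x. u (diagseq m) x - u (diagseq n) x) < e" if e: "e > 0" for e
  proof -
    obtain i where i: "inverse (real (Suc i)) < e" using reals_Archimedean[OF e] by blast
    have "L2_norm \<Omega> (\<lambda>x. u (diagseq m) x - u (diagseq n) x) < e" if "m \<ge> Suc i" "n \<ge> Suc i" for m n
    proof -
      have "L2_norm \<Omega> (\<lambda>x. u (diagseq (Suc i + (m - Suc i))) x - u (diagseq (Suc i + (n - Suc i))) x) < inverse (real (Suc i))"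
        using P[of i] unfolding P_def comp_def by blast
      with that i show ?thesis by simp
    qed
    then show ?thesis by blast
  qed
  with subseq_diagseq show ?thesis by blast
qed

section \<open>Plancherel's inequality\<close>

lemma lborel_integral_prod:
  fixes f :: "'a::euclidean_space \<Rightarrow> real \<Rightarrow> 'b::{real_normed_field, banach, second_countable_topology}"
  assumes "\<And>b. b \<in> Basis \<Longrightarrow> integrable lborel (f b)"
  shows "integrable lborel (\<lambda>x::'a. \<Prod>b\<in>Basis. f b (x \<bullet> b))"
    and "(LINT x|lborel. (\<Prod>b\<in>Basis. f b (x \<bullet> b))) = (\<Prod>b\<in>Basis. (LINT t|lborel. f b t))"
proof -
  interpret product_sigma_finite "\<lambda>_::'a. lborel :: real measure" by standard
  let ?T = "\<lambda>g. \<Sum>b\<in>(Basis::'a set). g b *\<^sub>R b"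
  have [measurable]: "f b \<in> borel_measurable borel" if "b \<in> Basis" for b
    using assms[OF that] by auto
  have T: "?T \<in> measurable (\<Pi>\<^sub>M b\<in>Basis. lborel) borel" by measurable
  have meas: "(\<lambda>x::'a. \<Prod>b\<in>Basis. f b (x \<bullet> b)) \<in> borel_measurable borel"
    by measurable
  have eq: "(\<Prod>b\<in>Basis. f b (?T g \<bullet> b)) = (\<Prod>b\<in>Basis. f b (g b))" for g
    by (rule prod.cong) (simp_all add: inner_sum_left inner_Basis if_distrib cong: if_cong)
  have "integrable (distr (\<Pi>\<^sub>M b\<in>Basis. lborel) borel ?T) (\<lambda>x::'a. \<Prod>b\<in>Basis. f b (x \<bullet> b))"
    unfolding integrable_distr_eq[OF T meas] eq
    by (rule product_integrable_prod[OF finite_Basis assms])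
  then show "integrable lborel (\<lambda>x::'a. \<Prod>b\<in>Basis. f b (x \<bullet> b))"
    by (simp only: lborel_eq[symmetric])
  have "(LINT x|distr (\<Pi>\<^sub>M b\<in>Basis. lborel) borel ?T. (\<Prod>b\<in>Basis. f b (x \<bullet> b))) = (\<Prod>b\<in>Basis. (LINT t|lborel. f b t))"
    unfolding integral_distr[OF T meas] eq
    by (rule product_integral_prod[OF finite_Basis assms])
  then show "(LINT x|lborel. (\<Prod>b\<in>Basis. f b (x \<bullet> b))) = (\<Prod>b\<in>Basis. (LINT t|lborel. f b t))"
    by (simp only: lborel_eq[symmetric])
qed

text \<open>This is the characteristic function of the standard normal distribution at a / s after
  the substitution x = s t.\<close>

lemma gaussian_fourier_real:
  fixes s a :: real
  assumes s: "s > 0"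
  shows "integrable lborel (\<lambda>t. exp (complex_of_real (- (s\<^sup>2 * t\<^sup>2 / 2)) + \<i> * complex_of_real (t * a)))"
    and "(LINT t|lborel. exp (complex_of_real (- (s\<^sup>2 * t\<^sup>2 / 2)) + \<i> * complex_of_real (t * a)))
      = complex_of_real (sqrt (2 * pi) / s * exp (- (a\<^sup>2 / (2 * s\<^sup>2))))"
proof -
  define f where "f x = std_normal_density x *\<^sub>R iexp (a / s * x)" for x
  have f: "integrable lborel f"
    unfolding f_def by (rule Bochner_Integration.integrable_bound[OF integrable_normal_density[where \<mu> = 0 and \<sigma> = 1]]) auto
  have "char std_normal_distribution (a / s) = (LINT x|lborel. f x)"
    unfolding char_def f_def by (rule integral_density) auto
  then have int_f: "(LINT x|lborel. f x) = complex_of_real (exp (- (a / s)\<^sup>2 / 2))"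
    by (simp add: char_std_normal_distribution)
  have eq: "sqrt (2 * pi) *\<^sub>R f (0 + s * t) = exp (complex_of_real (- (s\<^sup>2 * t\<^sup>2 / 2)) + \<i> * complex_of_real (t * a))" for t
  proof -
    have 1: "sqrt (2 * pi) * std_normal_density (s * t) = exp (- (s\<^sup>2 * t\<^sup>2 / 2))"
      by (simp add: std_normal_density_def power_mult_distrib)
    have 2: "a / s * (s * t) = t * a" using s by simp
    have "sqrt (2 * pi) *\<^sub>R f (0 + s * t) = (sqrt (2 * pi) * std_normal_density (s * t)) *\<^sub>R iexp (a / s * (s * t))"
      by (simp only: f_def add_0 scaleR_scaleR)
    also have "\<dots> = complex_of_real (exp (- (s\<^sup>2 * t\<^sup>2 / 2))) * iexp (t * a)"
      unfolding 1 2 by (rule scaleR_conv_of_real)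
    finally show ?thesis by (simp only: exp_add exp_of_real)
  qed
  have "integrable lborel (\<lambda>t. sqrt (2 * pi) *\<^sub>R f (0 + s * t))"
    using s by (intro integrable_scaleR_right lborel_integrable_real_affine f) auto
  then show "integrable lborel (\<lambda>t. exp (complex_of_real (- (s\<^sup>2 * t\<^sup>2 / 2)) + \<i> * complex_of_real (t * a)))"
    unfolding eq .
  have "(LINT x|lborel. f x) = s *\<^sub>R (LINT t|lborel. f (0 + s * t))"
    using lborel_integral_real_affine[of s f 0] s by simp
  then have "(LINT t|lborel. f (0 + s * t)) = (1 / s) *\<^sub>R complex_of_real (exp (- (a / s)\<^sup>2 / 2))"
    using s int_f by (simp add: field_simps scaleR_conv_of_real)
  then have "(LINT t|lborel. sqrt (2 * pi) *\<^sub>R f (0 + s * t)) = sqrt (2 * pi) *\<^sub>R (1 / s) *\<^sub>R complex_of_real (exp (- (a / s)\<^sup>2 / 2))"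
    by (simp only: integral_scaleR_right)
  then show "(LINT t|lborel. exp (complex_of_real (- (s\<^sup>2 * t\<^sup>2 / 2)) + \<i> * complex_of_real (t * a)))
      = complex_of_real (sqrt (2 * pi) / s * exp (- (a\<^sup>2 / (2 * s\<^sup>2))))"
    unfolding eq by (simp add: scaleR_conv_of_real power_divide)
qed

text \<open>The complex exponential factors over the coordinates, which the cosine does not; real
  parts are taken at the end.\<close>

lemma gaussian_fourier:
  fixes z :: "'a::euclidean_space"
  assumes s: "s > 0"
  shows "integrable lborel (\<lambda>p::'a. exp (- (s\<^sup>2 * (norm p)\<^sup>2 / 2)) * cos (z \<bullet> p))"
    and "(LINT p|lborel. exp (- (s\<^sup>2 * (norm p)\<^sup>2 / 2)) * cos (z \<bullet> p))
      = (sqrt (2 * pi) / s) ^ DIM('a) * exp (- ((norm z)\<^sup>2 / (2 * s\<^sup>2)))"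
proof -
  define f where "f b t = exp (complex_of_real (- (s\<^sup>2 * t\<^sup>2 / 2)) + \<i> * complex_of_real (t * (z \<bullet> b)))" for b :: 'a and t
  have norm2: "(norm x)\<^sup>2 = (\<Sum>b\<in>Basis. (x \<bullet> b)\<^sup>2)" for x :: 'a
    unfolding power2_norm_eq_inner euclidean_inner[of x x] by (simp add: power2_eq_square)
  have prod: "(\<Prod>b\<in>Basis. f b (p \<bullet> b)) = exp (complex_of_real (- (s\<^sup>2 * (norm p)\<^sup>2 / 2)) + \<i> * complex_of_real (z \<bullet> p))" for p
  proof -
    have "(\<Sum>b\<in>Basis. complex_of_real (- (s\<^sup>2 * (p \<bullet> b)\<^sup>2 / 2)) + \<i> * complex_of_real (p \<bullet> b * (z \<bullet> b)))
       = complex_of_real (- (s\<^sup>2 * (\<Sum>b\<in>Basis. (p \<bullet> b)\<^sup>2) / 2)) + \<i> * complex_of_real (\<Sum>b\<in>Basis. p \<bullet> b * (z \<bullet> b))"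
      by (simp add: sum.distrib sum_negf sum_subtractf sum_distrib_left sum_divide_distrib)
    also have "(\<Sum>b\<in>Basis. p \<bullet> b * (z \<bullet> b)) = z \<bullet> p"
      by (subst inner_commute) (rule euclidean_inner[symmetric])
    finally show ?thesis
      unfolding f_def norm2 by (simp only: exp_sum[OF finite_Basis, symmetric])
  qed
  have re: "Re (\<Prod>b\<in>Basis. f b (p \<bullet> b)) = exp (- (s\<^sup>2 * (norm p)\<^sup>2 / 2)) * cos (z \<bullet> p)" for p
    unfolding prod by (simp add: Re_exp)
  have int1: "integrable lborel (f b)" for b
    unfolding f_def using gaussian_fourier_real(1)[OF s] by blast
  have int: "integrable lborel (\<lambda>p. \<Prod>b\<in>Basis. f b (p \<bullet> b))"
    by (rule lborel_integral_prod(1)) (rule int1)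
  from integrable_Re[OF int] show "integrable lborel (\<lambda>p::'a. exp (- (s\<^sup>2 * (norm p)\<^sup>2 / 2)) * cos (z \<bullet> p))"
    unfolding re .
  have "(LINT p|lborel. Re (\<Prod>b\<in>Basis. f b (p \<bullet> b))) = Re (LINT p|lborel. (\<Prod>b\<in>Basis. f b (p \<bullet> b)))"
    by (rule integral_Re[OF int])
  also have "(LINT p|lborel. (\<Prod>b\<in>Basis. f b (p \<bullet> b))) = (\<Prod>b\<in>Basis. (LINT t|lborel. f b t))"
    by (rule lborel_integral_prod(2)) (rule int1)
  also have "\<dots> = (\<Prod>b\<in>Basis. complex_of_real (sqrt (2 * pi) / s * exp (- ((z \<bullet> b)\<^sup>2 / (2 * s\<^sup>2)))))"
    unfolding f_def gaussian_fourier_real(2)[OF s] ..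
  also have "\<dots> = complex_of_real (\<Prod>b\<in>Basis. sqrt (2 * pi) / s * exp (- ((z \<bullet> b)\<^sup>2 / (2 * s\<^sup>2))))"
    by (rule of_real_prod[symmetric])
  also have "(\<Prod>b\<in>Basis. sqrt (2 * pi) / s * exp (- ((z \<bullet> b)\<^sup>2 / (2 * s\<^sup>2))))
     = (sqrt (2 * pi) / s) ^ DIM('a) * exp (\<Sum>b\<in>Basis. - ((z \<bullet> b)\<^sup>2 / (2 * s\<^sup>2)))"
    by (simp only: prod.distrib prod_constant exp_sum[OF finite_Basis, symmetric])
  also have "(\<Sum>b\<in>Basis. - ((z \<bullet> b)\<^sup>2 / (2 * s\<^sup>2))) = - ((norm z)\<^sup>2 / (2 * s\<^sup>2))"
    by (simp add: norm2 sum_negf sum_divide_distrib)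
  finally show "(LINT p|lborel. exp (- (s\<^sup>2 * (norm p)\<^sup>2 / 2)) * cos (z \<bullet> p))
      = (sqrt (2 * pi) / s) ^ DIM('a) * exp (- ((norm z)\<^sup>2 / (2 * s\<^sup>2)))"
    unfolding re by simp
qed

text \<open>The transform at frequency 0 with 1 / s in place of s. The width s cancels, so (2 pi)^d
  can serve as the Plancherel constant for all s.\<close>

lemma nn_integral_gaussian_kernel:
  assumes s: "s > 0"
  shows "(\<integral>\<^sup>+z. ennreal ((sqrt (2 * pi) / s) ^ DIM('a::euclidean_space) * exp (- ((norm (z::'a))\<^sup>2 / (2 * s\<^sup>2)))) \<partial>lborel) = ennreal ((2 * pi) ^ DIM('a))"
proof -
  have s': "1 / s > 0" using s by simp
  have e: "exp (- ((1 / s)\<^sup>2 * (norm z)\<^sup>2 / 2)) * cos (0 \<bullet> z) = exp (- ((norm z)\<^sup>2 / (2 * s\<^sup>2)))" for z :: 'a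
    by (simp add: power_divide)
  note * = gaussian_fourier[OF s', of "0::'a", unfolded e]
  have "(\<integral>\<^sup>+z. ennreal ((sqrt (2 * pi) / s) ^ DIM('a) * exp (- ((norm (z::'a))\<^sup>2 / (2 * s\<^sup>2)))) \<partial>lborel)
      = ennreal ((sqrt (2 * pi) / s) ^ DIM('a) * (sqrt (2 * pi) / (1 / s)) ^ DIM('a))"
    using * s by (subst nn_integral_eq_integral) auto
  also have "(sqrt (2 * pi) / s) ^ DIM('a) * (sqrt (2 * pi) / (1 / s)) ^ DIM('a) = (2 * pi) ^ DIM('a)"
  proof -
    have "sqrt (2 * pi) / s * (sqrt (2 * pi) / (1 / s)) = 2 * pi" using s by simp
    then show ?thesis by (simp only: power_mult_distrib[symmetric])
  qed
  finally show ?thesis .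
qed

text \<open>A layer-cake computation instead of polar coordinates: rho^2 - (norm p)^2 is the
  integral of 2 t over t from norm p to rho, and after the exchange of integrals the inner one is
  the volume of the ball of radius t.\<close>

lemma ball_second_moment:
  assumes \<rho>: "\<rho> \<ge> 0"
  shows "integrable lborel (\<lambda>p::'a::euclidean_space. indicator (cball 0 \<rho>) p * (norm p)\<^sup>2)"
    and "(LINT p|lborel. indicator (cball (0::'a) \<rho>) p * (norm p)\<^sup>2)
      = real DIM('a) / (real DIM('a) + 2) * unit_ball_vol (real DIM('a)) * \<rho> ^ (DIM('a) + 2)"
proof -
  let ?d = "DIM('a)" and ?B = "cball (0::'a) \<rho>" and ?S = "{(t, p::'a). norm p \<le> t \<and> t \<le> \<rho>}"
  define w where "w = unit_ball_vol (real ?d)"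
  have w: "w \<ge> 0" by (simp add: w_def)
  have tri: "ennreal (indicator ?B p * (\<rho>\<^sup>2 - (norm p)\<^sup>2)) = (\<integral>\<^sup>+t. ennreal (2 * t) * indicator ?S (t, p) \<partial>lborel)" for p :: 'a
  proof (cases "norm p \<le> \<rho>")
    case True
    have "(\<integral>\<^sup>+t. ennreal (2 * t) * indicator {norm p..\<rho>} t \<partial>lborel) = ennreal (\<rho>\<^sup>2 - (norm p)\<^sup>2)"
    proof (rule nn_integral_FTC_Icc)
      show "((\<lambda>t. t\<^sup>2) has_real_derivative 2 * t) (at t)" for t :: real
        by (auto intro!: derivative_eq_intros)
    qed (use True in \<open>auto intro: order_trans[OF norm_ge_zero]\<close>)
    then show ?thesis using True by (simp add: indicator_def cong: if_cong)
  next
    case False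
    then have *: "indicator ?S (t, p) = (0::ennreal)" for t
      by (auto simp: indicator_def)
    have "indicator ?B p = (0::real)" using False by simp
    then show ?thesis unfolding * by simp
  qed
  have "?S = {x. norm (snd x) \<le> fst x} \<inter> {x. fst x \<le> \<rho>}"
    by auto
  also have "closed \<dots>"
    by (intro closed_Int closed_Collect_le continuous_intros)
  finally have [measurable]: "?S \<in> sets borel"
    by (rule borel_closed)
  have "(\<integral>\<^sup>+p. ennreal (indicator ?B p * (\<rho>\<^sup>2 - (norm p)\<^sup>2)) \<partial>lborel)
     = (\<integral>\<^sup>+p. \<integral>\<^sup>+t. ennreal (2 * t) * indicator ?S (t, p) \<partial>lborel \<partial>lborel)"
    unfolding tri ..
  also have "\<dots> = (\<integral>\<^sup>+t. \<integral>\<^sup>+p. ennreal (2 * t) * indicator ?S (t, p) \<partial>lborel \<partial>lborel)"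
  proof (rule lborel_pair.Fubini')
    have "(\<lambda>x. indicator ?S x :: ennreal) \<in> borel_measurable (lborel \<Otimes>\<^sub>M lborel)"
      by (subst lborel_prod) simp
    then have "(\<lambda>x. ennreal (2 * fst x) * indicator ?S x :: ennreal) \<in> borel_measurable (lborel \<Otimes>\<^sub>M lborel)"
      by measurable
    then show "(\<lambda>(t, p::'a). ennreal (2 * t) * indicator ?S (t, p)) \<in> borel_measurable (lborel \<Otimes>\<^sub>M lborel)"
      by (simp add: case_prod_unfold)
  qed
  also have "\<dots> = (\<integral>\<^sup>+t. ennreal (2 * w * t ^ (?d + 1)) * indicator {0..\<rho>} t \<partial>lborel)"
  proof (rule nn_integral_cong)
    fix t :: real
    show "(\<integral>\<^sup>+p. ennreal (2 * t) * indicator ?S (t, p) \<partial>lborel) = ennreal (2 * w * t ^ (?d + 1)) * indicator {0..\<rho>} t"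
    proof (cases "0 \<le> t \<and> t \<le> \<rho>")
      case True
      then have *: "indicator ?S (t, p) = (indicator (cball 0 t) p :: ennreal)" for p :: 'a
        by (auto simp: indicator_def)
      have "(\<integral>\<^sup>+p. ennreal (2 * t) * indicator ?S (t, p) \<partial>lborel) = ennreal (2 * t) * emeasure lborel (cball (0::'a) t)"
        unfolding * by (rule nn_integral_cmult_indicator) simp
      also have "\<dots> = ennreal (2 * t) * ennreal (w * t ^ ?d)"
        using True by (simp add: emeasure_cball w_def)
      finally show ?thesis using True w by (simp add: ennreal_mult[symmetric] mult_ac)
    next
      case False
      then have *: "indicator ?S (t, p) = (0 :: ennreal)" for p :: 'a
        using norm_ge_zero[of p] by (auto simp: indicator_def simp del: norm_ge_zero)
      have "indicator {0..\<rho>} t = (0 :: ennreal)" using False by simp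
      then show ?thesis unfolding * by simp
    qed
  qed
  also have "\<dots> = ennreal (2 * w * \<rho> ^ (?d + 2) / (real ?d + 2) - 2 * w * 0 ^ (?d + 2) / (real ?d + 2))"
  proof -
    have 1: "((\<lambda>t. t ^ (?d + 2)) has_real_derivative (real ?d + 2) * t ^ (?d + 1)) (at t)" for t :: real
      using DERIV_pow[of "?d + 2" t] by (simp add: add.commute)
    have 2: "2 * w * ((real ?d + 2) * t ^ (?d + 1)) / (real ?d + 2) = 2 * w * t ^ (?d + 1)" for t
      by (simp add: field_simps)
    have 3: "((\<lambda>t. 2 * w * t ^ (?d + 2) / (real ?d + 2)) has_real_derivative 2 * w * t ^ (?d + 1)) (at t)" for t
      using DERIV_cdivide[OF DERIV_cmult[OF 1, of "2 * w"], of "real ?d + 2"] unfolding 2 .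
    show ?thesis
      by (rule nn_integral_FTC_Icc[OF _ 3]) (use w \<rho> in auto)
  qed
  finally have nn: "(\<integral>\<^sup>+p. ennreal (indicator ?B p * (\<rho>\<^sup>2 - (norm p)\<^sup>2)) \<partial>lborel) = ennreal (2 * w * \<rho> ^ (?d + 2) / (real ?d + 2))"
    by simp
  have nonneg: "0 \<le> indicator ?B p * (\<rho>\<^sup>2 - (norm p)\<^sup>2)" for p :: 'a
    by (auto simp: indicator_def intro: power_mono)
  have meas: "(\<lambda>p::'a. indicator ?B p * (\<rho>\<^sup>2 - (norm p)\<^sup>2)) \<in> borel_measurable lborel"
    by (intro borel_measurable_times borel_measurable_indicator borel_measurable_diff borel_measurable_power
        borel_measurable_norm) auto
  have hb: "has_bochner_integral lborel (\<lambda>p::'a. indicator ?B p * (\<rho>\<^sup>2 - (norm p)\<^sup>2)) (2 * w * \<rho> ^ (?d + 2) / (real ?d + 2))"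
    by (rule has_bochner_integral_nn_integral[OF meas _ _ nn]) (use nonneg w \<rho> in \<open>auto intro!: always_eventually\<close>)
  have "has_bochner_integral lborel (\<lambda>p::'a. indicator ?B p *\<^sub>R \<rho>\<^sup>2) (measure lborel ?B *\<^sub>R \<rho>\<^sup>2)"
    by (rule has_bochner_integral_indicator) (simp, rule emeasure_bounded_finite[OF bounded_cball])
  then have "has_bochner_integral lborel (\<lambda>p::'a. indicator ?B p * \<rho>\<^sup>2) (w * \<rho> ^ ?d * \<rho>\<^sup>2)"
    using \<rho> by (simp add: content_cball w_def)
  from has_bochner_integral_diff[OF this hb]
  have "has_bochner_integral lborel (\<lambda>p::'a. indicator ?B p * (norm p)\<^sup>2) (w * \<rho> ^ ?d * \<rho>\<^sup>2 - 2 * w * \<rho> ^ (?d + 2) / (real ?d + 2))"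
    by (simp add: algebra_simps)
  moreover have "w * \<rho> ^ ?d * \<rho>\<^sup>2 - 2 * w * \<rho> ^ (?d + 2) / (real ?d + 2) = real ?d / (real ?d + 2) * w * \<rho> ^ (?d + 2)"
    by (simp add: power_add field_simps power2_eq_square)
  ultimately show "integrable lborel (\<lambda>p::'a. indicator ?B p * (norm p)\<^sup>2)"
    "(LINT p|lborel. indicator ?B p * (norm p)\<^sup>2) = real ?d / (real ?d + 2) * unit_ball_vol (real ?d) * \<rho> ^ (?d + 2)"
    by (auto simp: has_bochner_integral_iff w_def)
qed

section \<open>Plancherel's inequality through Gaussian weights\<close>

lemma (in pair_sigma_finite) integrable_times:
  fixes f :: "'a \<Rightarrow> real" and g :: "'b \<Rightarrow> real"
  assumes f: "integrable M1 f" and g: "integrable M2 g"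
  shows "integrable (M1 \<Otimes>\<^sub>M M2) (\<lambda>z. f (fst z) * g (snd z))"
    and "(LINT z|(M1 \<Otimes>\<^sub>M M2). f (fst z) * g (snd z)) = (LINT x|M1. f x) * (LINT y|M2. g y)"
proof -
  have [measurable]: "f \<in> borel_measurable M1" "g \<in> borel_measurable M2" using f g by auto
  show int: "integrable (M1 \<Otimes>\<^sub>M M2) (\<lambda>z. f (fst z) * g (snd z))"
  proof (rule Fubini_integrable)
    show "integrable M1 (\<lambda>x. LINT y|M2. norm (f (fst (x, y)) * g (snd (x, y))))"
      using f by (simp add: abs_mult)
    show "AE x in M1. integrable M2 (\<lambda>y. f (fst (x, y)) * g (snd (x, y)))"
      using g by simp
  qed measurable
  show "(LINT z|(M1 \<Otimes>\<^sub>M M2). f (fst z) * g (snd z)) = (LINT x|M1. f x) * (LINT y|M2. g y)"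
    using integral_fst'[OF int] by simp
qed

text \<open>Fubini turns the left-hand side into a quadratic form with a nonnegative kernel, to which
  \<open>v x * v y \<le> (v x\<^sup>2 + v y\<^sup>2) / 2\<close> applies.\<close>

lemma gaussian_plancherel:
  fixes v :: "'a::euclidean_space \<Rightarrow> real"
  assumes \<Omega>: "\<Omega> \<in> lmeasurable" and v: "in_L2 \<Omega> v" and s: "s > 0"
  shows "(LINT p|lborel. exp (- (s\<^sup>2 * (norm p)\<^sup>2 / 2)) *
      ((L2_inner \<Omega> v (\<lambda>x. cos (x \<bullet> p)))\<^sup>2 + (L2_inner \<Omega> v (\<lambda>x. sin (x \<bullet> p)))\<^sup>2))
    \<le> (2 * pi) ^ DIM('a) * (L2_norm \<Omega> v)\<^sup>2"
    and "integrable lborel (\<lambda>p. exp (- (s\<^sup>2 * (norm p)\<^sup>2 / 2)) *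
      ((L2_inner \<Omega> v (\<lambda>x. cos (x \<bullet> p)))\<^sup>2 + (L2_inner \<Omega> v (\<lambda>x. sin (x \<bullet> p)))\<^sup>2))"
proof -
  let ?M = "lebesgue_on \<Omega>"
  let ?N = "?M \<Otimes>\<^sub>M ?M"
  interpret M: finite_measure ?M by (rule finite_measure_lebesgue_on[OF \<Omega>])
  interpret N: finite_measure ?N by (intro finite_measure_pair_measure M.finite_measure_axioms)
  interpret MM: pair_sigma_finite ?M ?M ..
  interpret P: pair_sigma_finite lborel ?N ..
  have id [measurable]: "(\<lambda>x. x) \<in> measurable ?M borel"
    by (rule measurable_restrict_space1) (simp add: measurable_completion)
  have [measurable]: "v \<in> borel_measurable ?M" using v by (rule in_L2_measurable)
  have sq: "integrable ?M (\<lambda>x. (v x)\<^sup>2)" using v by (simp add: in_L2_def)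
  have one: "in_L2 \<Omega> (\<lambda>x. 1::real)" by (simp add: in_L2_def)
  have int_v: "integrable ?M v" using integrable_L2_inner[OF v one] by simp
  define w where "w p = exp (- (s\<^sup>2 * (norm p)\<^sup>2 / 2))" for p :: 'a
  have [measurable]: "w \<in> borel_measurable borel" unfolding w_def by measurable
  have int_w: "integrable lborel w"
    using gaussian_fourier(1)[OF s, of "0::'a"] by (simp add: w_def[abs_def])
  define c where "c = (sqrt (2 * pi) / s) ^ DIM('a)"
  have c: "c \<ge> 0" using s by (simp add: c_def)
  \<comment> \<open>By \<open>gaussian_fourier\<close> this is the transform of the weight
    \<open>w\<close> at the difference of the two points.\<close>
  define k where "k z = c * exp (- ((norm (fst z - snd z))\<^sup>2 / (2 * s\<^sup>2)))" for z :: "'a \<times> 'a"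
  have k0: "0 \<le> k z" and kc: "k z \<le> c" for z
    using c mult_left_mono[of "exp (- ((norm (fst z - snd z))\<^sup>2 / (2 * s\<^sup>2)))" 1 c] by (auto simp: k_def)
  have [measurable]: "k \<in> borel_measurable ?N" unfolding k_def[abs_def] by measurable
  define vv where "vv z = v (fst z) * v (snd z)" for z
  have [measurable]: "vv \<in> borel_measurable ?N" unfolding vv_def[abs_def] by measurable
  have int_vv: "integrable ?N vv"
    unfolding vv_def[abs_def] by (rule MM.integrable_times(1)[OF int_v int_v])
  define F where "F p z = w p * (vv z * cos ((fst z - snd z) \<bullet> p))" for p z
  have measF: "(\<lambda>(p, z). F p z) \<in> borel_measurable (lborel \<Otimes>\<^sub>M ?N)"
    unfolding F_def by measurable
  have intF: "integrable (lborel \<Otimes>\<^sub>M ?N) (\<lambda>(p, z). F p z)"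
  proof (rule Bochner_Integration.integrable_bound[OF P.integrable_times(1)[OF int_w int_vv] measF])
    have "\<bar>F p z\<bar> \<le> \<bar>w p * vv z\<bar>" for p z
      using mult_left_mono[OF abs_cos_le_one[of "(fst z - snd z) \<bullet> p"], of "\<bar>w p * vv z\<bar>"]
      by (simp add: F_def abs_mult mult_ac)
    then show "AE x in lborel \<Otimes>\<^sub>M ?N. norm (case x of (p, z) \<Rightarrow> F p z) \<le> norm (w (fst x) * vv (snd x))"
      by (auto simp: case_prod_unfold)
  qed
  have trig: "integrable ?M (\<lambda>x. v x * cos (x \<bullet> p))" "integrable ?M (\<lambda>x. v x * sin (x \<bullet> p))" for p
  proof -
    have "\<bar>v x * cos (x \<bullet> p)\<bar> \<le> \<bar>v x\<bar>" "\<bar>v x * sin (x \<bullet> p)\<bar> \<le> \<bar>v x\<bar>" for x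
      using mult_left_mono[OF abs_cos_le_one[of "x \<bullet> p"], of "\<bar>v x\<bar>"] mult_left_mono[OF abs_sin_le_one[of "x \<bullet> p"], of "\<bar>v x\<bar>"]
      by (simp_all add: abs_mult)
    then show "integrable ?M (\<lambda>x. v x * cos (x \<bullet> p))" "integrable ?M (\<lambda>x. v x * sin (x \<bullet> p))"
      by (auto intro!: Bochner_Integration.integrable_bound[OF int_v])
  qed
  \<comment> \<open>Each square is a double integral, and the formula for the cosine of a difference
    merges the two.\<close>
  have square: "(L2_inner \<Omega> v (\<lambda>x. cos (x \<bullet> p)))\<^sup>2 + (L2_inner \<Omega> v (\<lambda>x. sin (x \<bullet> p)))\<^sup>2
     = (LINT z|?N. vv z * cos ((fst z - snd z) \<bullet> p))" for p
  proof -
    note 1 = MM.integrable_times[OF trig(1)[of p] trig(1)[of p]]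
    note 2 = MM.integrable_times[OF trig(2)[of p] trig(2)[of p]]
    have "vv z * cos ((fst z - snd z) \<bullet> p) = (v (fst z) * cos (fst z \<bullet> p)) * (v (snd z) * cos (snd z \<bullet> p))
       + (v (fst z) * sin (fst z \<bullet> p)) * (v (snd z) * sin (snd z \<bullet> p))" for z
      by (simp add: vv_def inner_diff_left cos_diff algebra_simps)
    then show ?thesis
      by (simp add: Bochner_Integration.integral_add[OF 1(1) 2(1)] 1(2) 2(2) L2_inner_def power2_eq_square)
  qed
  have lhs: "w p * ((L2_inner \<Omega> v (\<lambda>x. cos (x \<bullet> p)))\<^sup>2 + (L2_inner \<Omega> v (\<lambda>x. sin (x \<bullet> p)))\<^sup>2) = (LINT z|?N. F p z)" for p
    unfolding square F_def by simp
  have intp: "integrable lborel (\<lambda>p. LINT z|?N. F p z)"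
    using P.integrable_fst'[OF intF] by simp
  then show "integrable lborel (\<lambda>p. exp (- (s\<^sup>2 * (norm p)\<^sup>2 / 2)) *
      ((L2_inner \<Omega> v (\<lambda>x. cos (x \<bullet> p)))\<^sup>2 + (L2_inner \<Omega> v (\<lambda>x. sin (x \<bullet> p)))\<^sup>2))"
    unfolding lhs[symmetric] w_def .
  have Fk: "(LINT p|lborel. F p z) = vv z * k z" for z
  proof -
    have "(LINT p|lborel. F p z) = (LINT p|lborel. vv z * (exp (- (s\<^sup>2 * (norm p)\<^sup>2 / 2)) * cos ((fst z - snd z) \<bullet> p)))"
      by (simp add: F_def w_def mult_ac)
    also have "\<dots> = vv z * (LINT p|lborel. exp (- (s\<^sup>2 * (norm p)\<^sup>2 / 2)) * cos ((fst z - snd z) \<bullet> p))"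
      by (rule integral_mult_right_zero)
    also have "\<dots> = vv z * k z"
      unfolding gaussian_fourier(2)[OF s] k_def c_def ..
    finally show ?thesis .
  qed
  have bounded_k: "integrable ?N (\<lambda>z. g z * k z)" if g: "integrable ?N g" for g
  proof (rule Bochner_Integration.integrable_bound)
    show "integrable ?N (\<lambda>z. c * g z)" using g by simp
    show "(\<lambda>z. g z * k z) \<in> borel_measurable ?N" using g by measurable
    have "\<bar>g z * k z\<bar> \<le> \<bar>c * g z\<bar>" for z
      using mult_left_mono[OF kc[of z], of "\<bar>g z\<bar>"] k0[of z] c by (simp add: abs_mult mult_ac)
    then show "AE z in ?N. norm (g z * k z) \<le> norm (c * g z)" by simp
  qed
  have oneM: "integrable ?M (\<lambda>x. 1::real)" by simp
  have i1: "integrable ?N (\<lambda>z. (v (fst z))\<^sup>2)"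
    using MM.integrable_times(1)[OF sq oneM] by simp
  have i2: "integrable ?N (\<lambda>z. (v (snd z))\<^sup>2)"
    using MM.integrable_times(1)[OF oneM sq] by simp
  \<comment> \<open>The bound of Schur's test: over \<open>\<Omega>\<close> the kernel integrates to
    at most its integral over the whole space, in either variable.\<close>
  have kint: "(LINT y|?M. k (x, y)) \<le> (2 * pi) ^ DIM('a)" "(LINT y|?M. k (y, x)) \<le> (2 * pi) ^ DIM('a)"
    and kint': "integrable ?M (\<lambda>y. k (x, y))" "integrable ?M (\<lambda>y. k (y, x))" for x
  proof -
    have sym: "k (x, y) = k (y, x)" for x y by (simp add: k_def norm_minus_commute)
    let ?h = "\<lambda>z::'a. c * exp (- ((norm z)\<^sup>2 / (2 * s\<^sup>2)))"
    have [measurable]: "?h \<in> borel_measurable borel" by measurable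
    have "(\<integral>\<^sup>+y. ennreal (k (y, x)) \<partial>?M) = (\<integral>\<^sup>+y. ennreal (?h (y - x)) * indicator \<Omega> y \<partial>lebesgue)"
      using \<Omega> by (subst nn_integral_restrict_space) (auto simp: k_def)
    also have "\<dots> \<le> (\<integral>\<^sup>+y. ennreal (?h (y - x)) \<partial>lebesgue)"
      by (intro nn_integral_mono) (auto simp: indicator_def)
    also have "\<dots> = (\<integral>\<^sup>+y. ennreal (?h (y - x)) \<partial>lborel)"
      by (rule nn_integral_completion)
    also have "\<dots> = (\<integral>\<^sup>+y. ennreal (?h (- x + y)) \<partial>lborel)" by simp
    also have "\<dots> = (\<integral>\<^sup>+y. ennreal (?h y) \<partial>distr lborel borel ((+) (- x)))"
      by (subst nn_integral_distr) auto
    also have "\<dots> = ennreal ((2 * pi) ^ DIM('a))"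
      unfolding lborel_distr_plus c_def by (rule nn_integral_gaussian_kernel[OF s])
    finally have nn: "(\<integral>\<^sup>+y. ennreal (k (y, x)) \<partial>?M) \<le> ennreal ((2 * pi) ^ DIM('a))" .
    have mk: "(\<lambda>y. k (y, x)) \<in> borel_measurable ?M" unfolding k_def fst_conv snd_conv by measurable
    show i: "integrable ?M (\<lambda>y. k (y, x))"
      using nn mk k0 by (intro integrableI_bounded) (auto simp: le_less_trans)
    then show "integrable ?M (\<lambda>y. k (x, y))" by (simp add: sym[of x])
    have "ennreal (LINT y|?M. k (y, x)) \<le> ennreal ((2 * pi) ^ DIM('a))"
      using nn k0 i by (subst nn_integral_eq_integral[symmetric]) auto
    then show "(LINT y|?M. k (y, x)) \<le> (2 * pi) ^ DIM('a)" by (simp add: ennreal_le_iff)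
    then show "(LINT y|?M. k (x, y)) \<le> (2 * pi) ^ DIM('a)" by (simp add: sym[of x])
  qed
  have norm_v: "(LINT x|?M. (v x)\<^sup>2) = (L2_norm \<Omega> v)\<^sup>2" by (simp add: L2_norm_power2_integral)
  have b1: "(LINT z|?N. (v (fst z))\<^sup>2 * k z) \<le> (2 * pi) ^ DIM('a) * (L2_norm \<Omega> v)\<^sup>2"
  proof -
    have "(LINT z|?N. (v (fst z))\<^sup>2 * k z) = (LINT x|?M. LINT y|?M. (v x)\<^sup>2 * k (x, y))"
      using MM.integral_fst'[OF bounded_k[OF i1]] by simp
    also have "\<dots> = (LINT x|?M. (v x)\<^sup>2 * (LINT y|?M. k (x, y)))" by simp
    also have "\<dots> \<le> (LINT x|?M. (v x)\<^sup>2 * (2 * pi) ^ DIM('a))"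
    proof (rule integral_mono)
      show "integrable ?M (\<lambda>x. (v x)\<^sup>2 * (LINT y|?M. k (x, y)))"
        using MM.integrable_fst'[OF bounded_k[OF i1]] by simp
    qed (use sq kint in \<open>auto intro: mult_left_mono\<close>)
    finally show ?thesis by (simp add: norm_v mult_ac)
  qed
  have b2: "(LINT z|?N. (v (snd z))\<^sup>2 * k z) \<le> (2 * pi) ^ DIM('a) * (L2_norm \<Omega> v)\<^sup>2"
  proof -
    note i = bounded_k[OF i2]
    have "(LINT z|?N. (v (snd z))\<^sup>2 * k z) = (LINT z|?N. (\<lambda>(x, y). (v x)\<^sup>2 * k (y, x)) z)"
      using MM.integral_product_swap[of "\<lambda>z. (v (snd z))\<^sup>2 * k z"] by (simp add: case_prod_unfold)
    also have "\<dots> = (LINT x|?M. LINT y|?M. (v x)\<^sup>2 * k (y, x))"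
      using MM.integral_fst'[OF MM.integrable_product_swap[OF i]] by (simp add: case_prod_unfold)
    also have "\<dots> = (LINT x|?M. (v x)\<^sup>2 * (LINT y|?M. k (y, x)))" by simp
    also have "\<dots> \<le> (LINT x|?M. (v x)\<^sup>2 * (2 * pi) ^ DIM('a))"
    proof (rule integral_mono)
      show "integrable ?M (\<lambda>x. (v x)\<^sup>2 * (LINT y|?M. k (y, x)))"
        using MM.integrable_fst'[OF MM.integrable_product_swap[OF i]] by (simp add: case_prod_unfold)
    qed (use sq kint in \<open>auto intro: mult_left_mono\<close>)
    finally show ?thesis by (simp add: norm_v mult_ac)
  qed
  have "(LINT p|lborel. LINT z|?N. F p z) = (LINT z|?N. LINT p|lborel. F p z)"
    by (rule P.Fubini_integral[symmetric, OF intF])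
  also have "\<dots> = (LINT z|?N. vv z * k z)" unfolding Fk ..
  also have "\<dots> \<le> (LINT z|?N. ((v (fst z))\<^sup>2 * k z + (v (snd z))\<^sup>2 * k z) / 2)"
  proof (rule integral_mono)
    show "vv z * k z \<le> ((v (fst z))\<^sup>2 * k z + (v (snd z))\<^sup>2 * k z) / 2" for z
      using mult_right_mono[OF sum_squares_bound[of "v (fst z)" "v (snd z)"] k0[of z]] by (simp add: vv_def algebra_simps)
  qed (use bounded_k[OF i1] bounded_k[OF i2] bounded_k[OF int_vv] in auto)
  also have "\<dots> = ((LINT z|?N. (v (fst z))\<^sup>2 * k z) + (LINT z|?N. (v (snd z))\<^sup>2 * k z)) / 2"
    using bounded_k[OF i1] bounded_k[OF i2] by simp
  also have "\<dots> \<le> (2 * pi) ^ DIM('a) * (L2_norm \<Omega> v)\<^sup>2" using b1 b2 by simp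
  finally show "(LINT p|lborel. exp (- (s\<^sup>2 * (norm p)\<^sup>2 / 2)) *
      ((L2_inner \<Omega> v (\<lambda>x. cos (x \<bullet> p)))\<^sup>2 + (L2_inner \<Omega> v (\<lambda>x. sin (x \<bullet> p)))\<^sup>2))
    \<le> (2 * pi) ^ DIM('a) * (L2_norm \<Omega> v)\<^sup>2"
    unfolding lhs[symmetric] w_def .
qed

text \<open>On the ball the Gaussian weight is at least exp(-s^2 rho^2 / 2). So the indicator is at
  most exp(s^2 rho^2 / 2) times the weight, and this factor tends to 1 as s tends to 0.\<close>

lemma plancherel_ball:
  fixes v :: "'a::euclidean_space \<Rightarrow> real"
  assumes \<Omega>: "\<Omega> \<in> lmeasurable" and v: "in_L2 \<Omega> v" and \<rho>: "\<rho> \<ge> 0"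
  defines "q p \<equiv> (L2_inner \<Omega> v (\<lambda>x. cos (x \<bullet> p)))\<^sup>2 + (L2_inner \<Omega> v (\<lambda>x. sin (x \<bullet> p)))\<^sup>2"
  shows "integrable lborel (\<lambda>p. indicator (cball 0 \<rho>) p * q p)"
    and "(LINT p|lborel. indicator (cball 0 \<rho>) p * q p) \<le> (2 * pi) ^ DIM('a) * (L2_norm \<Omega> v)\<^sup>2"
proof -
  have q0: "q p \<ge> 0" for p by (simp add: q_def)
  note pl = gaussian_plancherel[OF \<Omega> v, folded q_def]
  have pw: "indicator (cball 0 \<rho>) p * q p \<le> exp (s\<^sup>2 * \<rho>\<^sup>2 / 2) * (exp (- (s\<^sup>2 * (norm p)\<^sup>2 / 2)) * q p)" for s :: real and p
  proof (cases "norm p \<le> \<rho>")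
    case True
    then have "s\<^sup>2 * (norm p)\<^sup>2 \<le> s\<^sup>2 * \<rho>\<^sup>2" by (intro mult_left_mono power_mono) auto
    then have "1 \<le> exp (s\<^sup>2 * \<rho>\<^sup>2 / 2) * exp (- (s\<^sup>2 * (norm p)\<^sup>2 / 2))"
      by (simp add: exp_add[symmetric])
    from mult_right_mono[OF this q0[of p]] show ?thesis using True by (simp add: mult_ac)
  qed (use q0 in simp)
  have one: "0 < (1::real)" by simp
  \<comment> \<open>Measurability of \<open>q\<close> is recovered from the integrable weighted
    function by multiplying the weight for s = 1 away.\<close>
  have m1: "(\<lambda>p. exp (- (1\<^sup>2 * (norm p)\<^sup>2 / 2)) * q p) \<in> borel_measurable lborel"
    using pl(2)[OF one] by (rule borel_measurable_integrable)
  have m2: "(\<lambda>p::'a. exp ((norm p)\<^sup>2 / 2)) \<in> borel_measurable lborel" by measurable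
  have "exp ((norm p)\<^sup>2 / 2) * (exp (- (1\<^sup>2 * (norm p)\<^sup>2 / 2)) * q p) = q p" for p
    by (simp add: mult.assoc[symmetric] exp_add[symmetric])
  with borel_measurable_times[OF m2 m1] have "q \<in> borel_measurable lborel" by (simp only:)
  then have meas: "(\<lambda>p. indicator (cball 0 \<rho>) p * q p) \<in> borel_measurable lborel"
    by (intro borel_measurable_times borel_measurable_indicator) auto
  have int: "integrable lborel (\<lambda>p. indicator (cball 0 \<rho>) p * q p)"
    by (rule Bochner_Integration.integrable_bound[OF integrable_mult_right[OF pl(2)[OF one], of "exp (1\<^sup>2 * \<rho>\<^sup>2 / 2)"] meas])
       (use pw[of _ 1] q0 in \<open>auto simp: abs_mult intro!: always_eventually\<close>)
  then show "integrable lborel (\<lambda>p. indicator (cball 0 \<rho>) p * q p)" .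
  have le: "(LINT p|lborel. indicator (cball 0 \<rho>) p * q p) \<le> exp (s\<^sup>2 * \<rho>\<^sup>2 / 2) * ((2 * pi) ^ DIM('a) * (L2_norm \<Omega> v)\<^sup>2)" if s: "s > 0" for s
  proof -
    have "(LINT p|lborel. indicator (cball 0 \<rho>) p * q p) \<le> (LINT p|lborel. exp (s\<^sup>2 * \<rho>\<^sup>2 / 2) * (exp (- (s\<^sup>2 * (norm p)\<^sup>2 / 2)) * q p))"
      by (rule integral_mono[OF int integrable_mult_right[OF pl(2)[OF s]] pw])
    also have "\<dots> = exp (s\<^sup>2 * \<rho>\<^sup>2 / 2) * (LINT p|lborel. exp (- (s\<^sup>2 * (norm p)\<^sup>2 / 2)) * q p)"
      by (rule integral_mult_right_zero)
    also have "\<dots> \<le> exp (s\<^sup>2 * \<rho>\<^sup>2 / 2) * ((2 * pi) ^ DIM('a) * (L2_norm \<Omega> v)\<^sup>2)"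
      by (rule mult_left_mono[OF pl(1)[OF s]]) simp
    finally show ?thesis .
  qed
  have "((\<lambda>s. exp (s\<^sup>2 * \<rho>\<^sup>2 / 2) * ((2 * pi) ^ DIM('a) * (L2_norm \<Omega> v)\<^sup>2)) \<longlongrightarrow> exp (0\<^sup>2 * \<rho>\<^sup>2 / 2) * ((2 * pi) ^ DIM('a) * (L2_norm \<Omega> v)\<^sup>2)) (at_right (0::real))"
    by (intro tendsto_intros) auto
  moreover have "\<forall>\<^sub>F s in at_right 0. (LINT p|lborel. indicator (cball 0 \<rho>) p * q p) \<le> exp (s\<^sup>2 * \<rho>\<^sup>2 / 2) * ((2 * pi) ^ DIM('a) * (L2_norm \<Omega> v)\<^sup>2)"
    by (rule eventually_at_rightI[of 0 1]) (use le in auto)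
  ultimately have "(LINT p|lborel. indicator (cball 0 \<rho>) p * q p) \<le> exp (0\<^sup>2 * \<rho>\<^sup>2 / 2) * ((2 * pi) ^ DIM('a) * (L2_norm \<Omega> v)\<^sup>2)"
    by (rule tendsto_lowerbound) simp
  then show "(LINT p|lborel. indicator (cball 0 \<rho>) p * q p) \<le> (2 * pi) ^ DIM('a) * (L2_norm \<Omega> v)\<^sup>2"
    by simp
qed

section \<open>Eigenfunctions by successive minimization\<close>

text \<open>The last clause replaces the completeness of the eigenfunctions.\<close>

definition eigen_system ::
  "'a::euclidean_space set \<Rightarrow> nat \<Rightarrow> (nat \<Rightarrow> 'a \<Rightarrow> real) \<Rightarrow> (nat \<Rightarrow> 'a \<Rightarrow> 'a) \<Rightarrow> (nat \<Rightarrow> real) \<Rightarrow> bool" where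
  "eigen_system \<Omega> n w g \<mu> \<longleftrightarrow>
    (\<forall>i<n. in_H10 \<Omega> (w i) (g i)) \<and>
    (\<forall>i<n. \<forall>j<n. L2_inner \<Omega> (w i) (w j) = (if i = j then 1 else 0)) \<and>
    (\<forall>i<n. \<forall>v gv. in_H10 \<Omega> v gv \<longrightarrow> L2_inner \<Omega> (g i) gv = \<mu> i * L2_inner \<Omega> (w i) v) \<and>
    (\<forall>i j. i \<le> j \<longrightarrow> j < n \<longrightarrow> \<mu> i \<le> \<mu> j) \<and>
    (\<forall>v gv. in_H10 \<Omega> v gv \<longrightarrow> (\<forall>j<n. L2_inner \<Omega> v (w j) = 0) \<longrightarrow>
      (\<forall>i<n. \<mu> i * L2_inner \<Omega> v v \<le> L2_inner \<Omega> gv gv))"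

lemma eigen_systemD:
  assumes "eigen_system \<Omega> n w g \<mu>"
  shows "\<And>i. i < n \<Longrightarrow> in_H10 \<Omega> (w i) (g i)"
    and "\<And>i j. i < n \<Longrightarrow> j < n \<Longrightarrow> L2_inner \<Omega> (w i) (w j) = (if i = j then 1 else 0)"
    and "\<And>i v gv. i < n \<Longrightarrow> in_H10 \<Omega> v gv \<Longrightarrow> L2_inner \<Omega> (g i) gv = \<mu> i * L2_inner \<Omega> (w i) v"
    and "\<And>i j. i \<le> j \<Longrightarrow> j < n \<Longrightarrow> \<mu> i \<le> \<mu> j"
    and "\<And>v gv i. in_H10 \<Omega> v gv \<Longrightarrow> (\<And>j. j < n \<Longrightarrow> L2_inner \<Omega> v (w j) = 0) \<Longrightarrow> i < n \<Longrightarrow>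
      \<mu> i * L2_inner \<Omega> v v \<le> L2_inner \<Omega> gv gv"
  using assms unfolding eigen_system_def by blast+

lemma L2_inner_diff_self:
  assumes "in_L2 \<Omega> f" "in_L2 \<Omega> g"
  shows "L2_inner \<Omega> (\<lambda>x. f x - g x) (\<lambda>x. f x - g x) = L2_inner \<Omega> f f - 2 * L2_inner \<Omega> f g + L2_inner \<Omega> g g"
  using L2_inner_add_scaleR_self[OF assms, of "-1"] by simp

text \<open>Since the \<open>w j\<close> are eigenfunctions, subtracting the L2 projection onto
  their span is an orthogonal decomposition for the energy as well; Pythagoras therefore holds for
  both forms with the same coefficients.\<close>

lemma eigen_projection:
  fixes v :: "'a::euclidean_space \<Rightarrow> real"
  assumes \<Omega>: "open \<Omega>" and E: "eigen_system \<Omega> n w g \<mu>" and v: "in_H10 \<Omega> v gv"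
  defines "c \<equiv> \<lambda>j. L2_inner \<Omega> v (w j)"
  defines "r \<equiv> \<lambda>x. v x - (\<Sum>j<n. c j *\<^sub>R w j x)" and "gr \<equiv> \<lambda>x. gv x - (\<Sum>j<n. c j *\<^sub>R g j x)"
  shows "in_H10 \<Omega> r gr" and "\<And>i. i < n \<Longrightarrow> L2_inner \<Omega> r (w i) = 0"
    and "L2_inner \<Omega> v v = L2_inner \<Omega> r r + (\<Sum>j<n. (c j)\<^sup>2)"
    and "L2_inner \<Omega> gv gv = L2_inner \<Omega> gr gr + (\<Sum>j<n. \<mu> j * (c j)\<^sup>2)"
proof -
  note D = eigen_systemD[OF E]
  define W where "W x = (\<Sum>j<n. c j *\<^sub>R w j x)" for x
  define G where "G x = (\<Sum>j<n. c j *\<^sub>R g j x)" for x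
  have WG: "in_H10 \<Omega> W G"
    unfolding W_def[abs_def] G_def[abs_def]
    by (rule in_H10_sum[OF \<Omega>], rule in_H10_scaleR[OF \<Omega>], rule D(1)) simp
  have r: "r = (\<lambda>x. v x - W x)" and gr: "gr = (\<lambda>x. gv x - G x)"
    by (simp_all add: r_def gr_def W_def G_def)
  show "in_H10 \<Omega> r gr" unfolding r gr by (rule in_H10_diff[OF \<Omega> v WG])
  note L = in_H10_L2[OF v] in_H10_L2[OF WG]
  have Lw: "in_L2 \<Omega> (w i)" "in_L2 \<Omega> (g i)" if "i < n" for i using in_H10_L2[OF D(1)[OF that]] .
  have Wexp: "L2_inner \<Omega> W h = (\<Sum>j<n. c j * L2_inner \<Omega> (w j) h)" if "in_L2 \<Omega> h" for h
  proof -
    have "L2_inner \<Omega> W h = (\<Sum>j<n. L2_inner \<Omega> (\<lambda>x. c j *\<^sub>R w j x) h)"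
      unfolding W_def[abs_def] by (rule L2_inner_sum_left[OF _ that]) (rule in_L2_scaleR, rule Lw, simp)
    then show ?thesis by (simp only: L2_inner_scaleR_left)
  qed
  have Gexp: "L2_inner \<Omega> G h = (\<Sum>j<n. c j * L2_inner \<Omega> (g j) h)" if "in_L2 \<Omega> h" for h
  proof -
    have "L2_inner \<Omega> G h = (\<Sum>j<n. L2_inner \<Omega> (\<lambda>x. c j *\<^sub>R g j x) h)"
      unfolding G_def[abs_def] by (rule L2_inner_sum_left[OF _ that]) (rule in_L2_scaleR, rule Lw, simp)
    then show ?thesis by (simp only: L2_inner_scaleR_left)
  qed
  have Wc: "L2_inner \<Omega> W (w i) = c i" if "i < n" for i
  proof -
    have "L2_inner \<Omega> W (w i) = (\<Sum>j<n. if j = i then c j else 0)"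
      unfolding Wexp[OF Lw(1)[OF that]] by (rule sum.cong) (use D(2) that in auto)
    then show ?thesis using that by simp
  qed
  show "L2_inner \<Omega> r (w i) = 0" if "i < n" for i
    unfolding r L2_inner_diff_left[OF L(1) L(3) Lw(1)[OF that]] Wc[OF that] by (simp add: c_def)
  have vW: "L2_inner \<Omega> v W = (\<Sum>j<n. (c j)\<^sup>2)"
    unfolding L2_inner_commute[of \<Omega> v W] Wexp[OF L(1)]
    by (simp add: c_def L2_inner_commute[of \<Omega> v] power2_eq_square)
  have WW: "L2_inner \<Omega> W W = (\<Sum>j<n. (c j)\<^sup>2)"
    unfolding Wexp[OF L(3)] by (rule sum.cong) (simp_all add: L2_inner_commute[of \<Omega> _ W] Wc power2_eq_square)
  show "L2_inner \<Omega> v v = L2_inner \<Omega> r r + (\<Sum>j<n. (c j)\<^sup>2)"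
    unfolding r L2_inner_diff_self[OF L(1) L(3)] vW WW by simp
  have gG: "L2_inner \<Omega> gv G = (\<Sum>j<n. \<mu> j * (c j)\<^sup>2)"
    unfolding L2_inner_commute[of \<Omega> gv G] Gexp[OF L(2)]
    by (rule sum.cong) (simp_all add: D(3)[OF _ v] c_def L2_inner_commute[of \<Omega> v] power2_eq_square)
  have GG: "L2_inner \<Omega> G G = (\<Sum>j<n. \<mu> j * (c j)\<^sup>2)"
    unfolding Gexp[OF L(4)]
    by (rule sum.cong) (simp_all add: D(3)[OF _ WG] L2_inner_commute[of \<Omega> _ W] Wc power2_eq_square)
  show "L2_inner \<Omega> gv gv = L2_inner \<Omega> gr gr + (\<Sum>j<n. \<mu> j * (c j)\<^sup>2)"
    unfolding gr L2_inner_diff_self[OF L(2) L(4)] gG GG by simp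
qed

text \<open>By the parallelogram law a minimizing sequence that is Cauchy in \<open>L\<^sup>2\<close> has Cauchy gradients.\<close>

lemma minimizer_exists:
  fixes w :: "nat \<Rightarrow> 'a::euclidean_space \<Rightarrow> real"
  assumes \<Omega>: "open \<Omega>" "bounded \<Omega>" and w: "\<And>j. j < n \<Longrightarrow> in_L2 \<Omega> (w j)"
    and ex: "in_H10 \<Omega> v0 g0" "\<And>j. j < n \<Longrightarrow> L2_inner \<Omega> v0 (w j) = 0" "L2_inner \<Omega> v0 v0 \<noteq> 0"
  shows "\<exists>f gf. in_H10 \<Omega> f gf \<and> (\<forall>j<n. L2_inner \<Omega> f (w j) = 0) \<and> L2_inner \<Omega> f f = 1 \<and>
    (\<forall>v gv. in_H10 \<Omega> v gv \<longrightarrow> (\<forall>j<n. L2_inner \<Omega> v (w j) = 0) \<longrightarrow> L2_inner \<Omega> gf gf * L2_inner \<Omega> v v \<le> L2_inner \<Omega> gv gv)"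
proof -
  have \<Omega>': "\<Omega> \<in> lmeasurable" using \<Omega> by (simp add: lmeasurable_open)
  define S where "S = {p. in_H10 \<Omega> (fst p) (snd p) \<and> (\<forall>j<n. L2_inner \<Omega> (fst p) (w j) = 0) \<and> L2_inner \<Omega> (fst p) (fst p) = 1}"
  define Q where "Q p = L2_inner \<Omega> (snd p) (snd p)" for p :: "('a \<Rightarrow> real) \<times> ('a \<Rightarrow> 'a)"
  have normalise: "\<exists>p\<in>S. L2_inner \<Omega> gv gv = Q p * L2_inner \<Omega> v v"
    if v: "in_H10 \<Omega> v gv" "\<forall>j<n. L2_inner \<Omega> v (w j) = 0" "L2_inner \<Omega> v v \<noteq> 0" for v gv
  proof -
    define t where "t = 1 / sqrt (L2_inner \<Omega> v v)"
    have pos: "L2_inner \<Omega> v v > 0" using v(3) L2_inner_self_nonneg[of \<Omega> v] by simp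
    then have t: "t\<^sup>2 * L2_inner \<Omega> v v = 1" by (simp add: t_def power_divide)
    have "L2_inner \<Omega> (\<lambda>x. t *\<^sub>R v x) (\<lambda>x. t *\<^sub>R v x) = 1"
      unfolding L2_inner_scaleR_left L2_inner_scaleR_right using t by (simp add: power2_eq_square mult.assoc)
    moreover have "\<forall>j<n. L2_inner \<Omega> (\<lambda>x. t *\<^sub>R v x) (w j) = 0"
      unfolding L2_inner_scaleR_left using v(2) by simp
    ultimately have "((\<lambda>x. t *\<^sub>R v x), (\<lambda>x. t *\<^sub>R gv x)) \<in> S"
      unfolding S_def using in_H10_scaleR[OF \<Omega>(1) v(1)] by simp
    moreover have "Q ((\<lambda>x. t *\<^sub>R v x), (\<lambda>x. t *\<^sub>R gv x)) * L2_inner \<Omega> v v = (t\<^sup>2 * L2_inner \<Omega> v v) * L2_inner \<Omega> gv gv"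
      unfolding Q_def snd_conv L2_inner_scaleR_left L2_inner_scaleR_right by (simp add: power2_eq_square mult_ac)
    ultimately show ?thesis using t by (metis mult_1)
  qed
  have "S \<noteq> {}" using normalise[OF ex(1) _ ex(3)] ex(2) by blast
  define m where "m = Inf (Q ` S)"
  have Q0: "Q p \<ge> 0" for p by (simp add: Q_def L2_inner_self_nonneg)
  have bdd: "bdd_below (Q ` S)" using Q0 by (auto intro: bdd_belowI[of _ 0])
  have m_le: "m \<le> Q p" if "p \<in> S" for p
    unfolding m_def using that bdd by (auto intro: cInf_lower)
  have m0: "m \<ge> 0" unfolding m_def using \<open>S \<noteq> {}\<close> Q0 by (auto intro: cInf_greatest)
  have m_le': "m * L2_inner \<Omega> v v \<le> L2_inner \<Omega> gv gv"
    if v: "in_H10 \<Omega> v gv" "\<forall>j<n. L2_inner \<Omega> v (w j) = 0" for v gv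
  proof (cases "L2_inner \<Omega> v v = 0")
    case True
    then show ?thesis by (simp add: L2_inner_self_nonneg)
  next
    case False
    then obtain p where "p \<in> S" "L2_inner \<Omega> gv gv = Q p * L2_inner \<Omega> v v"
      using normalise[OF v] by blast
    then show ?thesis using m_le[of p] L2_inner_self_nonneg[of \<Omega> v] by (simp add: mult_right_mono)
  qed
  have "\<forall>k. \<exists>p. p \<in> S \<and> Q p < m + inverse (real (Suc k))"
  proof
    fix k
    have "Inf (Q ` S) < m + inverse (real (Suc k))" by (simp add: m_def)
    then show "\<exists>p. p \<in> S \<and> Q p < m + inverse (real (Suc k))"
      using \<open>S \<noteq> {}\<close> bdd by (auto simp: cInf_less_iff)
  qed
  from choice[OF this] obtain p where p: "\<And>k. p k \<in> S" "\<And>k. Q (p k) < m + inverse (real (Suc k))" by blast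
  define u where "u k = fst (p k)" for k
  define h where "h k = snd (p k)" for k
  have uH: "in_H10 \<Omega> (u k) (h k)" and uw: "\<And>j. j < n \<Longrightarrow> L2_inner \<Omega> (u k) (w j) = 0"
    and u1: "L2_inner \<Omega> (u k) (u k) = 1" for k
    using p(1)[of k] by (auto simp: S_def u_def h_def)
  have hQ: "m \<le> L2_inner \<Omega> (h k) (h k)" "L2_inner \<Omega> (h k) (h k) < m + inverse (real (Suc k))" for k
    using m_le[OF p(1)[of k]] p(2)[of k] by (simp_all add: Q_def h_def)
  define B where "B = max 1 (sqrt (m + 1))"
  have "L2_norm \<Omega> (u k) \<le> B" for k by (simp add: L2_norm_def u1 B_def)
  moreover have "L2_norm \<Omega> (h k) \<le> B" for k
  proof -
    have "inverse (real (Suc k)) \<le> 1" by (simp add: inverse_le_1_iff)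
    then have "L2_inner \<Omega> (h k) (h k) \<le> m + 1" using hQ(2)[of k] by linarith
    then show ?thesis by (simp add: L2_norm_def B_def le_max_iff_disj)
  qed
  ultimately obtain s :: "nat \<Rightarrow> nat" where s: "strict_mono s"
    and Cauchy: "\<And>e. e > 0 \<Longrightarrow> \<exists>N. \<forall>i\<ge>N. \<forall>j\<ge>N. L2_norm \<Omega> (\<lambda>x. u (s i) x - u (s j) x) < e"
    using rellich[where u = u and g = h, OF \<Omega> uH, of B] by blast
  note Lu = in_H10_L2[OF uH]
  have par: "(L2_norm \<Omega> (\<lambda>x. h i x - h j x))\<^sup>2 \<le> 2 * inverse (real (Suc i)) + 2 * inverse (real (Suc j)) + m * (L2_norm \<Omega> (\<lambda>x. u i x - u j x))\<^sup>2" for i j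
  proof -
    have "\<forall>l<n. L2_inner \<Omega> (\<lambda>x. u i x + u j x) (w l) = 0"
      using uw by (simp add: L2_inner_add_left[OF Lu(1) Lu(1) w])
    from m_le'[OF in_H10_add[OF \<Omega>(1) uH uH] this]
    have "m * L2_inner \<Omega> (\<lambda>x. u i x + u j x) (\<lambda>x. u i x + u j x) \<le> L2_inner \<Omega> (\<lambda>x. h i x + h j x) (\<lambda>x. h i x + h j x)" .
    moreover have "L2_inner \<Omega> (\<lambda>x. u i x + u j x) (\<lambda>x. u i x + u j x) = 4 - L2_inner \<Omega> (\<lambda>x. u i x - u j x) (\<lambda>x. u i x - u j x)"
      using L2_inner_add_scaleR_self[OF Lu(1)[of i] Lu(1)[of j], of 1] L2_inner_diff_self[OF Lu(1)[of i] Lu(1)[of j]] by (simp add: u1)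
    moreover have "L2_inner \<Omega> (\<lambda>x. h i x + h j x) (\<lambda>x. h i x + h j x)
       = 2 * L2_inner \<Omega> (h i) (h i) + 2 * L2_inner \<Omega> (h j) (h j) - L2_inner \<Omega> (\<lambda>x. h i x - h j x) (\<lambda>x. h i x - h j x)"
      using L2_inner_add_scaleR_self[OF Lu(2)[of i] Lu(2)[of j], of 1] L2_inner_diff_self[OF Lu(2)[of i] Lu(2)[of j]] by simp
    ultimately show ?thesis
      using hQ(2)[of i] hQ(2)[of j] unfolding L2_norm_power2 by (simp add: algebra_simps)
  qed
  have Cauchy_h: "\<exists>N. \<forall>i\<ge>N. \<forall>j\<ge>N. L2_norm \<Omega> (\<lambda>x. h (s i) x - h (s j) x) < e" if e: "e > 0" for e
  proof -
    \<comment> \<open>With this bound the L2 term in \<open>par\<close> is at most e^2 / 4, also for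
      m = 0; the two excess terms add less than e^2 / 2.\<close>
    have d: "e / (2 * sqrt (m + 1)) > 0" using e m0 by simp
    obtain N1 where N1: "\<And>i j. i \<ge> N1 \<Longrightarrow> j \<ge> N1 \<Longrightarrow> L2_norm \<Omega> (\<lambda>x. u (s i) x - u (s j) x) < e / (2 * sqrt (m + 1))"
      using Cauchy[OF d] by blast
    obtain N2 where N2: "inverse (real (Suc N2)) < e\<^sup>2 / 8"
      using reals_Archimedean[of "e\<^sup>2 / 8"] e by auto
    have "L2_norm \<Omega> (\<lambda>x. h (s i) x - h (s j) x) < e" if ij: "i \<ge> max N1 N2" "j \<ge> max N1 N2" for i j
    proof (rule power2_less_imp_less)
      have inv: "inverse (real (Suc (s k))) < e\<^sup>2 / 8" if "k \<ge> max N1 N2" for k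
      proof -
        have "N2 \<le> s k" using that seq_suble[OF s, of k] by simp
        then have "inverse (real (Suc (s k))) \<le> inverse (real (Suc N2))" by (intro le_imp_inverse_le) auto
        then show ?thesis using N2 by linarith
      qed
      have "(L2_norm \<Omega> (\<lambda>x. u (s i) x - u (s j) x))\<^sup>2 \<le> (e / (2 * sqrt (m + 1)))\<^sup>2"
        using N1[of i j] ij by (intro power_mono L2_norm_nonneg) auto
      also have "\<dots> = e\<^sup>2 / (4 * (m + 1))" using m0 by (simp add: power_divide power_mult_distrib)
      finally have "m * (L2_norm \<Omega> (\<lambda>x. u (s i) x - u (s j) x))\<^sup>2 \<le> m * (e\<^sup>2 / (4 * (m + 1)))"
        using m0 by (rule mult_left_mono)
      also have "\<dots> \<le> e\<^sup>2 / 4" using m0 by (simp add: field_simps)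
      finally show "(L2_norm \<Omega> (\<lambda>x. h (s i) x - h (s j) x))\<^sup>2 < e\<^sup>2"
        using par[of "s i" "s j"] inv[OF ij(1)] inv[OF ij(2)] zero_less_power[OF e, of 2] by linarith
    qed (use e in simp)
    then show ?thesis by blast
  qed
  obtain f gf where f: "in_H10 \<Omega> f gf" and lim: "(\<lambda>i. L2_norm \<Omega> (\<lambda>x. u (s i) x - f x)) \<longlonglongrightarrow> 0"
    "(\<lambda>i. L2_norm \<Omega> (\<lambda>x. h (s i) x - gf x)) \<longlonglongrightarrow> 0"
    by (rule H10_limit[where u = "\<lambda>i. u (s i)" and g = "\<lambda>i. h (s i)", OF \<Omega>(1) \<Omega>' uH Cauchy Cauchy_h])
  note Lf = in_H10_L2[OF f]
  have "(\<lambda>i. L2_inner \<Omega> (u (s i)) (u (s i))) \<longlonglongrightarrow> L2_inner \<Omega> f f"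
    by (rule tendsto_L2_inner[OF Lu(1) Lf(1) Lu(1) Lf(1) lim(1) lim(1)])
  then have ff: "L2_inner \<Omega> f f = 1" by (simp add: u1 LIMSEQ_const_iff)
  have fw: "L2_inner \<Omega> f (w j) = 0" if j: "j < n" for j
  proof -
    have "(\<lambda>i. L2_inner \<Omega> (u (s i)) (w j)) \<longlonglongrightarrow> L2_inner \<Omega> f (w j)"
      by (rule tendsto_L2_inner[OF Lu(1) Lf(1) w[OF j] w[OF j] lim(1)]) (simp add: L2_norm_zero)
    then show ?thesis using uw[OF j] by (simp add: LIMSEQ_const_iff)
  qed
  have lim_h: "(\<lambda>i. L2_inner \<Omega> (h (s i)) (h (s i))) \<longlonglongrightarrow> L2_inner \<Omega> gf gf"
    by (rule tendsto_L2_inner[OF Lu(2) Lf(2) Lu(2) Lf(2) lim(2) lim(2)])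
  have "(\<lambda>i. m + inverse (real (Suc i))) \<longlonglongrightarrow> m + 0"
    by (intro tendsto_add tendsto_const LIMSEQ_inverse_real_of_nat)
  then have "(\<lambda>i. m + inverse (real (Suc (s i)))) \<longlonglongrightarrow> m"
    using LIMSEQ_subseq_LIMSEQ[OF _ s] by (fastforce simp: comp_def)
  from LIMSEQ_le[OF lim_h this] have "L2_inner \<Omega> gf gf \<le> m"
    using hQ(2) less_imp_le by blast
  then have "L2_inner \<Omega> gf gf * L2_inner \<Omega> v v \<le> L2_inner \<Omega> gv gv"
    if "in_H10 \<Omega> v gv" "\<forall>j<n. L2_inner \<Omega> v (w j) = 0" for v gv
    using m_le'[OF that] mult_right_mono[of "L2_inner \<Omega> gf gf" m "L2_inner \<Omega> v v"] L2_inner_self_nonneg[of \<Omega> v] by linarith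
  with f ff fw show ?thesis by blast
qed

text \<open>The minimizer on the orthogonal complement of the system is the next eigenfunction. The
  function \<open>v0\<close> guarantees that this complement contains something that can be
  normalized.\<close>

lemma eigen_system_extend:
  fixes w :: "nat \<Rightarrow> 'a::euclidean_space \<Rightarrow> real"
  assumes \<Omega>: "open \<Omega>" "bounded \<Omega>" and E: "eigen_system \<Omega> n w g \<mu>"
    and ex: "in_H10 \<Omega> v0 g0" "\<And>j. j < n \<Longrightarrow> L2_inner \<Omega> v0 (w j) = 0" "L2_inner \<Omega> v0 v0 \<noteq> 0"
  shows "\<exists>w' g' \<mu>'. eigen_system \<Omega> (Suc n) w' g' \<mu>'"
proof -
  note D = eigen_systemD[OF E]
  have "\<exists>f gf. in_H10 \<Omega> f gf \<and> (\<forall>j<n. L2_inner \<Omega> f (w j) = 0) \<and> L2_inner \<Omega> f f = 1 \<and>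
    (\<forall>v gv. in_H10 \<Omega> v gv \<longrightarrow> (\<forall>j<n. L2_inner \<Omega> v (w j) = 0) \<longrightarrow> L2_inner \<Omega> gf gf * L2_inner \<Omega> v v \<le> L2_inner \<Omega> gv gv)"
    by (rule minimizer_exists[where w = w, OF \<Omega> _ ex]) (simp_all add: in_H10_L2(1)[OF D(1)])
  then obtain f gf where f: "in_H10 \<Omega> f gf" and fw: "\<And>j. j < n \<Longrightarrow> L2_inner \<Omega> f (w j) = 0" and ff: "L2_inner \<Omega> f f = 1"
    and min: "\<And>v gv. in_H10 \<Omega> v gv \<Longrightarrow> (\<And>j. j < n \<Longrightarrow> L2_inner \<Omega> v (w j) = 0) \<Longrightarrow> L2_inner \<Omega> gf gf * L2_inner \<Omega> v v \<le> L2_inner \<Omega> gv gv"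
    by blast
  define m where "m = L2_inner \<Omega> gf gf"
  note Lf = in_H10_L2[OF f]
  have EL0: "L2_inner \<Omega> gf gv = m * L2_inner \<Omega> f v"
    if v: "in_H10 \<Omega> v gv" "\<And>j. j < n \<Longrightarrow> L2_inner \<Omega> v (w j) = 0" for v gv
  proof -
    note Lv = in_H10_L2[OF v(1)]
    \<comment> \<open>The constant term of the quadratic in t is 0 because \<open>f\<close> attains
      the minimum, so its linear coefficient vanishes.\<close>
    have "(L2_inner \<Omega> gf gv - m * L2_inner \<Omega> f v)\<^sup>2 \<le> 0 * (L2_inner \<Omega> gv gv - m * L2_inner \<Omega> v v)"
    proof (rule quadratic_nonneg_imp_le)
      fix t :: real
      have "L2_inner \<Omega> (\<lambda>x. f x + t *\<^sub>R v x) (w j) = 0" if "j < n" for j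
        using fw[OF that] v(2)[OF that] in_H10_L2(1)[OF D(1)[OF that]]
        by (simp only: L2_inner_add_left[OF Lf(1) in_L2_scaleR[OF Lv(1)]] L2_inner_scaleR_left)
      from min[OF in_H10_add[OF \<Omega>(1) f in_H10_scaleR[OF \<Omega>(1) v(1)]] this]
      have "m * L2_inner \<Omega> (\<lambda>x. f x + t *\<^sub>R v x) (\<lambda>x. f x + t *\<^sub>R v x) \<le> L2_inner \<Omega> (\<lambda>x. gf x + t *\<^sub>R gv x) (\<lambda>x. gf x + t *\<^sub>R gv x)"
        unfolding m_def .
      then show "0 \<le> 0 + 2 * t * (L2_inner \<Omega> gf gv - m * L2_inner \<Omega> f v) + t\<^sup>2 * (L2_inner \<Omega> gv gv - m * L2_inner \<Omega> v v)"
        unfolding L2_inner_add_scaleR_self[OF Lf(1) Lv(1)] L2_inner_add_scaleR_self[OF Lf(2) Lv(2)]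
        by (simp add: ff m_def algebra_simps)
    qed (use min[OF v] in \<open>simp add: m_def\<close>)
    then show ?thesis by simp
  qed
  \<comment> \<open>An arbitrary direction differs from an admissible one by a combination of the
    \<open>w j\<close>. It contributes nothing on either side, since \<open>f\<close> is orthogonal
    to \<open>w j\<close> and, by the eigenvalue equation, \<open>gf\<close> to
    \<open>g j\<close>.\<close>
  have EL: "L2_inner \<Omega> gf gv = m * L2_inner \<Omega> f v" if v: "in_H10 \<Omega> v gv" for v gv
  proof -
    define c where "c j = L2_inner \<Omega> v (w j)" for j
    define r where "r x = v x - (\<Sum>j<n. c j *\<^sub>R w j x)" for x
    define gr where "gr x = gv x - (\<Sum>j<n. c j *\<^sub>R g j x)" for x
    note pr = eigen_projection(1,2)[OF \<Omega>(1) E v, folded c_def, folded r_def[abs_def] gr_def[abs_def]]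
    note Lv = in_H10_L2[OF v]
    have Lw: "in_L2 \<Omega> (\<lambda>x. c j *\<^sub>R w j x)" "in_L2 \<Omega> (\<lambda>x. c j *\<^sub>R g j x)" if "j < n" for j
      by (rule in_L2_scaleR, rule in_H10_L2[OF D(1)[OF that]])+
    have sw: "in_L2 \<Omega> (\<lambda>x. \<Sum>j<n. c j *\<^sub>R w j x)"
      by (rule in_L2_sum, rule Lw(1)) simp
    have "L2_inner \<Omega> f r = L2_inner \<Omega> f v - L2_inner \<Omega> f (\<lambda>x. \<Sum>j<n. c j *\<^sub>R w j x)"
      unfolding r_def[abs_def] by (rule L2_inner_diff_right[OF Lv(1) sw Lf(1)])
    also have "L2_inner \<Omega> f (\<lambda>x. \<Sum>j<n. c j *\<^sub>R w j x) = (\<Sum>j<n. L2_inner \<Omega> f (\<lambda>x. c j *\<^sub>R w j x))"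
      by (rule L2_inner_sum_right[OF _ Lf(1)], rule Lw(1)) simp
    also have "\<dots> = 0"
      using fw by (intro sum.neutral ballI) (simp only: L2_inner_scaleR_right lessThan_iff mult_zero_right)
    finally have 1: "L2_inner \<Omega> f r = L2_inner \<Omega> f v" by simp
    have gg: "L2_inner \<Omega> gf (g j) = 0" if "j < n" for j
      using D(3)[OF that f] fw[OF that] by (simp add: L2_inner_commute[of \<Omega> gf] L2_inner_commute[of \<Omega> "w j"])
    have sg: "in_L2 \<Omega> (\<lambda>x. \<Sum>j<n. c j *\<^sub>R g j x)"
      by (rule in_L2_sum, rule Lw(2)) simp
    have "L2_inner \<Omega> gf gr = L2_inner \<Omega> gf gv - L2_inner \<Omega> gf (\<lambda>x. \<Sum>j<n. c j *\<^sub>R g j x)"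
      unfolding gr_def[abs_def] by (rule L2_inner_diff_right[OF Lv(2) sg Lf(2)])
    also have "L2_inner \<Omega> gf (\<lambda>x. \<Sum>j<n. c j *\<^sub>R g j x) = (\<Sum>j<n. L2_inner \<Omega> gf (\<lambda>x. c j *\<^sub>R g j x))"
      by (rule L2_inner_sum_right[OF _ Lf(2)], rule Lw(2)) simp
    also have "\<dots> = 0"
      using gg by (intro sum.neutral ballI) (simp only: L2_inner_scaleR_right lessThan_iff mult_zero_right)
    finally have 2: "L2_inner \<Omega> gf gr = L2_inner \<Omega> gf gv" by simp
    show ?thesis using EL0[OF pr] 1 2 by simp
  qed
  have "eigen_system \<Omega> (Suc n) (w(n := f)) (g(n := gf)) (\<mu>(n := m))"
    unfolding eigen_system_def
  proof (intro conjI allI impI)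
    fix i assume "i < Suc n"
    then show "in_H10 \<Omega> ((w(n := f)) i) ((g(n := gf)) i)"
      using D(1) f by (auto simp: less_Suc_eq)
  next
    fix i j assume "i < Suc n" "j < Suc n"
    then show "L2_inner \<Omega> ((w(n := f)) i) ((w(n := f)) j) = (if i = j then 1 else 0)"
      using D(2) ff fw L2_inner_commute[of \<Omega> "w i" f] by (auto simp: less_Suc_eq)
  next
    fix i v gv assume "i < Suc n" "in_H10 \<Omega> v gv"
    then show "L2_inner \<Omega> ((g(n := gf)) i) gv = (\<mu>(n := m)) i * L2_inner \<Omega> ((w(n := f)) i) v"
      using D(3) EL by (auto simp: less_Suc_eq)
  next
    \<comment> \<open>Here \<open>f\<close> itself is inserted into the last clause of the old
      system.\<close>
    have le: "\<mu> i \<le> m" if "i < n" for i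
      using D(5)[OF f fw that] by (simp add: ff m_def)
    fix i j :: nat assume "i \<le> j" "j < Suc n"
    then show "(\<mu>(n := m)) i \<le> (\<mu>(n := m)) j"
      using D(4)[of i j] le[of i] by (auto simp: less_Suc_eq le_less)
  next
    fix v gv i assume v: "in_H10 \<Omega> v gv" "\<forall>j<Suc n. L2_inner \<Omega> v ((w(n := f)) j) = 0" "i < Suc n"
    have vw: "L2_inner \<Omega> v (w j) = 0" if "j < n" for j
      using v(2)[rule_format, of j] that by simp
    show "(\<mu>(n := m)) i * L2_inner \<Omega> v v \<le> L2_inner \<Omega> gv gv"
    proof (cases "i = n")
      case True
      then show ?thesis using min[OF v(1) vw] by (simp add: m_def)
    next
      case False
      then show ?thesis using D(5)[OF v(1) vw, of i] v(3) by simp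
    qed
  qed
  then show ?thesis by blast
qed

section \<open>The averaged variational principle\<close>

lemma dirichlet_laplacianD:
  assumes "dirichlet_laplacian \<Omega> u (\<lambda>x. \<mu> * u x)"
  obtains g where "in_H10 \<Omega> u g"
    "\<forall>v gv. in_H10 \<Omega> v gv \<longrightarrow> L2_inner \<Omega> g gv = \<mu> * L2_inner \<Omega> u v"
proof -
  obtain g where g: "in_H10 \<Omega> u g" and eq: "\<And>v gv. in_H10 \<Omega> v gv \<Longrightarrow>
      (LINT x|lebesgue_on \<Omega>. g x \<bullet> gv x) = (LINT x|lebesgue_on \<Omega>. \<mu> * u x * v x)"
    using assms unfolding dirichlet_laplacian_def by blast
  have "L2_inner \<Omega> g gv = \<mu> * L2_inner \<Omega> u v" if "in_H10 \<Omega> v gv" for v gv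
    unfolding L2_inner_def eq[OF that] by (simp add: mult.assoc)
  with g that show ?thesis by blast
qed

lemma L2_inner_self_eq_0_iff:
  assumes "in_L2 \<Omega> u"
  shows "L2_inner \<Omega> u u = 0 \<longleftrightarrow> (AE x in lebesgue_on \<Omega>. u x = 0)"
  unfolding L2_inner_def
  by (subst integral_nonneg_eq_0_iff_AE[OF integrable_L2_inner[OF assms assms]]) simp_all

lemma eigenfunction_exists:
  assumes lam: "dirichlet_eigenvalues \<Omega> lam" and j: "j \<ge> 1"
  obtains u g where "in_H10 \<Omega> u g" "L2_inner \<Omega> u u \<noteq> 0"
    "\<forall>v gv. in_H10 \<Omega> v gv \<longrightarrow> L2_inner \<Omega> g gv = lam j * L2_inner \<Omega> u v"
proof -
  let ?m = "card {i. 1 \<le> i \<and> lam i = lam j}"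
  have "finite {i. 1 \<le> i \<and> lam i = lam j}" and dim: "eigenspace_dim \<Omega> (lam j) ?m"
    using lam unfolding dirichlet_eigenvalues_def by blast+
  then have m: "?m > 0" using j by (auto simp: card_gt_0_iff)
  obtain u where u: "\<And>i. i < ?m \<Longrightarrow> dirichlet_laplacian \<Omega> (u i) (\<lambda>x. lam j * u i x)"
    and ind: "independent_L2 \<Omega> ?m u"
    using dim unfolding eigenspace_dim_def independent_eigenfunctions_def by blast
  obtain g where g: "in_H10 \<Omega> (u 0) g"
    "\<forall>v gv. in_H10 \<Omega> v gv \<longrightarrow> L2_inner \<Omega> g gv = lam j * L2_inner \<Omega> (u 0) v"
    by (rule dirichlet_laplacianD[OF u[OF m]])
  have "L2_inner \<Omega> (u 0) (u 0) \<noteq> 0"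
  proof
    assume "L2_inner \<Omega> (u 0) (u 0) = 0"
    then have AE: "AE x in lebesgue_on \<Omega>. u 0 x = 0"
      using L2_inner_self_eq_0_iff[OF in_H10_L2(1)[OF g(1)]] by simp
    let ?c = "\<lambda>i::nat. if i = 0 then 1 else 0 :: real"
    have "(\<Sum>i<?m. ?c i * u i x) = u 0 x" for x
    proof -
      have "(\<Sum>i<?m. ?c i * u i x) = (\<Sum>i<?m. if i = 0 then u i x else 0)"
        by (rule sum.cong) auto
      then show ?thesis using m by simp
    qed
    then have AE': "AE x in lebesgue_on \<Omega>. (\<Sum>i<?m. ?c i * u i x) = 0" using AE by simp
    have "(AE x in lebesgue_on \<Omega>. (\<Sum>i<?m. ?c i * u i x) = 0) \<longrightarrow> (\<forall>i<?m. ?c i = 0)"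
      using ind unfolding independent_L2_def by (rule spec[where x = ?c])
    then have "\<forall>i<?m. ?c i = 0" using AE' by (rule mp)
    from this[rule_format, OF m] show False by simp
  qed
  with g that show ?thesis by blast
qed

text \<open>Every value is taken at finitely many indices only, whereas there are infinitely many
  indices.\<close>

lemma infinite_range_eigenvalues:
  assumes "dirichlet_eigenvalues \<Omega> lam"
  shows "infinite (lam ` {1..})"
proof
  assume fin: "finite (lam ` {1..})"
  have "{1..} = (\<Union>\<mu>\<in>lam ` {1..}. {j. 1 \<le> j \<and> lam j = \<mu>})" by auto
  moreover have "finite (\<Union>\<mu>\<in>lam ` {1..}. {j. 1 \<le> j \<and> lam j = \<mu>})"
    by (rule finite_UN_I[OF fin]) (use assms in \<open>simp add: dirichlet_eigenvalues_def\<close>)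
  ultimately show False using infinite_Ici[of "1::nat"] by simp
qed

text \<open>The extension never stops: some \<open>lam j\<close> differs from all
  \<open>\<mu> i\<close> found so far, and by symmetry of the form its eigenfunction is orthogonal
  to every \<open>w i\<close>. This takes the place of a proof that the form domain is
  infinite-dimensional.\<close>

lemma eigen_system_exists:
  fixes \<Omega> :: "'a::euclidean_space set"
  assumes \<Omega>: "open \<Omega>" "bounded \<Omega>" and lam: "dirichlet_eigenvalues \<Omega> lam"
  shows "\<exists>w g \<mu>. eigen_system \<Omega> n w g \<mu>"
proof (induction n)
  case 0
  show ?case by (simp add: eigen_system_def)
next
  case (Suc n)
  then obtain w g \<mu> where E: "eigen_system \<Omega> n w g \<mu>" by blast
  note D = eigen_systemD[OF E]
  have "\<not> lam ` {1..} \<subseteq> \<mu> ` {..<n}"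
    using infinite_range_eigenvalues[OF lam] finite_subset by blast
  then obtain j where j: "j \<ge> 1" "\<And>i. i < n \<Longrightarrow> lam j \<noteq> \<mu> i" by auto
  obtain u h where u: "in_H10 \<Omega> u h" "L2_inner \<Omega> u u \<noteq> 0"
    "\<forall>v gv. in_H10 \<Omega> v gv \<longrightarrow> L2_inner \<Omega> h gv = lam j * L2_inner \<Omega> u v"
    by (rule eigenfunction_exists[OF lam j(1)])
  have "L2_inner \<Omega> u (w i) = 0" if "i < n" for i
  proof -
    have "L2_inner \<Omega> h (g i) = lam j * L2_inner \<Omega> u (w i)"
      using u(3) D(1)[OF that] by blast
    moreover have "L2_inner \<Omega> h (g i) = \<mu> i * L2_inner \<Omega> u (w i)"
      using D(3)[OF that u(1)] by (simp add: L2_inner_commute[of \<Omega> h] L2_inner_commute[of \<Omega> u])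
    ultimately show ?thesis using j(2)[OF that] mult_right_cancel by metis
  qed
  from eigen_system_extend[OF \<Omega> E u(1) this u(2)] show ?case .
qed

text \<open>Orthonormality gives independence, so that the number of indices with
  \<open>\<mu> i = x\<close> is a lower bound for the multiplicity of x.\<close>

lemma eigen_system_independent:
  assumes E: "eigen_system \<Omega> n w g \<mu>" and m: "m \<le> card {i. i < n \<and> \<mu> i = x}"
  shows "independent_eigenfunctions \<Omega> x m"
proof -
  note D = eigen_systemD[OF E]
  obtain A where A: "A \<subseteq> {i. i < n \<and> \<mu> i = x}" "card A = m" "finite A"
    using obtain_subset_with_card_n[OF m] by metis
  obtain e where e: "bij_betw e {..<m} A"
    using ex_bij_betw_nat_finite[OF A(3)] A(2) by (auto simp: atLeast0LessThan)
  have ei: "e i < n" "\<mu> (e i) = x" if "i < m" for i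
    using bij_betwE[OF e] A(1) that by auto
  have lap: "dirichlet_laplacian \<Omega> (w (e i)) (\<lambda>y. x * w (e i) y)" if "i < m" for i
    unfolding dirichlet_laplacian_def
  proof (intro conjI exI[of _ "g (e i)"] allI impI)
    note H = D(1)[OF ei(1)[OF that]]
    show "in_L2 \<Omega> (\<lambda>y. x * w (e i) y)"
      using in_L2_scaleR[OF in_H10_L2(1)[OF H], of x] by simp
    show "in_H10 \<Omega> (w (e i)) (g (e i))" by (rule H)
    show "(LINT y|lebesgue_on \<Omega>. g (e i) y \<bullet> gv y) = (LINT y|lebesgue_on \<Omega>. x * w (e i) y * v y)"
      if v: "in_H10 \<Omega> v gv" for v gv
      using D(3)[OF ei(1)[OF \<open>i < m\<close>] v] ei(2)[OF \<open>i < m\<close>] by (simp add: L2_inner_def mult.assoc)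
  qed
  have "independent_L2 \<Omega> m (\<lambda>i. w (e i))"
    unfolding independent_L2_def
  proof (intro allI impI)
    fix c i assume AE: "AE y in lebesgue_on \<Omega>. (\<Sum>l<m. c l * w (e l) y) = 0" and i: "i < m"
    have Lw: "in_L2 \<Omega> (w (e l))" if "l < m" for l
      by (rule in_H10_L2(1)[OF D(1)[OF ei(1)[OF that]]])
    have "L2_inner \<Omega> (\<lambda>y. \<Sum>l<m. c l *\<^sub>R w (e l) y) (w (e i)) = (\<Sum>l<m. L2_inner \<Omega> (\<lambda>y. c l *\<^sub>R w (e l) y) (w (e i)))"
      by (rule L2_inner_sum_left[OF _ Lw[OF i]], rule in_L2_scaleR, rule Lw) simp
    also have "\<dots> = (\<Sum>l<m. if l = i then c l else 0)"
    proof (rule sum.cong)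
      fix l assume "l \<in> {..<m}"
      then have l: "l < m" by simp
      have "e l = e i \<longleftrightarrow> l = i"
        using bij_betw_imp_inj_on[OF e] l i by (auto dest: inj_onD)
      then show "L2_inner \<Omega> (\<lambda>y. c l *\<^sub>R w (e l) y) (w (e i)) = (if l = i then c l else 0)"
        unfolding L2_inner_scaleR_left D(2)[OF ei(1)[OF l] ei(1)[OF i]] by simp
    qed simp
    also have "\<dots> = c i" using i by simp
    finally have "L2_inner \<Omega> (\<lambda>y. \<Sum>l<m. c l *\<^sub>R w (e l) y) (w (e i)) = c i" .
    moreover have "L2_inner \<Omega> (\<lambda>y. \<Sum>l<m. c l *\<^sub>R w (e l) y) (w (e i)) = 0"
      unfolding L2_inner_def
    proof (rule integral_eq_zero_AE)
      show "AE y in lebesgue_on \<Omega>. (\<Sum>l<m. c l *\<^sub>R w (e l) y) \<bullet> w (e i) y = 0"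
        using AE by eventually_elim simp
    qed
    ultimately show "c i = 0" by simp
  qed
  with lap show ?thesis
    unfolding independent_eigenfunctions_def by (intro exI[of _ "\<lambda>i. w (e i)"]) simp
qed

text \<open>Otherwise the \<open>j\<close> orthonormal eigenfunctions \<open>w 0, \<dots>, w (j - 1)\<close> would belong to eigenvalues below
  \<open>lam j\<close>, of which there are at most \<open>j - 1\<close> with multiplicity.\<close>

lemma eigenvalue_le_eigen_system:
  assumes E: "eigen_system \<Omega> n w g \<mu>" and lam: "dirichlet_eigenvalues \<Omega> lam" and j: "1 \<le> j" "j \<le> n"
  shows "lam j \<le> \<mu> (j - 1)"
proof (rule ccontr)
  assume "\<not> lam j \<le> \<mu> (j - 1)"
  then have less: "\<mu> (j - 1) < lam j" by simp
  note D = eigen_systemD[OF E]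
  have mono: "\<And>a b. 1 \<le> a \<Longrightarrow> a \<le> b \<Longrightarrow> lam a \<le> lam b"
    using lam by (auto simp: dirichlet_eigenvalues_def mono_on_def)
  let ?L = "\<lambda>x. {l. 1 \<le> l \<and> lam l = x}" and ?A = "\<lambda>x. {i. i < j \<and> \<mu> i = x}"
  have finL: "finite (?L x)" and dim: "eigenspace_dim \<Omega> x (card (?L x))" for x
    using lam unfolding dirichlet_eigenvalues_def by blast+
  have cardA: "card (?A x) \<le> card (?L x)" for x
  proof (rule ccontr)
    assume "\<not> card (?A x) \<le> card (?L x)"
    moreover have "card (?A x) \<le> card {i. i < n \<and> \<mu> i = x}"
      using j by (intro card_mono) auto
    ultimately have "Suc (card (?L x)) \<le> card {i. i < n \<and> \<mu> i = x}" by simp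
    from eigen_system_independent[OF E this] dim[of x] show False
      by (simp add: eigenspace_dim_def)
  qed
  let ?X = "\<mu> ` {..<j}"
  have "{..<j} = (\<Union>x\<in>?X. ?A x)" by auto
  then have "j = card (\<Union>x\<in>?X. ?A x)" by (metis card_lessThan)
  also have "\<dots> = (\<Sum>x\<in>?X. card (?A x))"
    by (rule card_UN_disjoint) auto
  also have "\<dots> \<le> (\<Sum>x\<in>?X. card (?L x))"
    by (rule sum_mono) (rule cardA)
  also have "\<dots> = card (\<Union>x\<in>?X. ?L x)"
    by (rule card_UN_disjoint[symmetric]) (use finL in auto)
  \<comment> \<open>An index l with \<open>lam l \<le> \<mu> (j - 1) < lam j\<close> lies below j by
    monotonicity; as \<open>lam\<close> starts at 1, only j - 1 such indices remain for j
    functions.\<close>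
  also have "\<dots> \<le> card {1..<j}"
  proof (rule card_mono)
    show "(\<Union>x\<in>?X. ?L x) \<subseteq> {1..<j}"
    proof
      fix l assume "l \<in> (\<Union>x\<in>?X. ?L x)"
      then obtain i where i: "i < j" "1 \<le> l" "lam l = \<mu> i" by auto
      have "\<mu> i \<le> \<mu> (j - 1)" using D(4)[of i "j - 1"] i j by simp
      then have "lam l < lam j" using i less by simp
      then have "l < j" using mono[of j l] j by (meson not_le)
      then show "l \<in> {1..<j}" using i by simp
    qed
  qed simp
  finally show False using j by simp
qed

text \<open>Real and imaginary part of \<open>\<phi>\<close> times a plane wave, since the space is
  real. Each energy alone contains a mixed term with the product of p and \<open>G\<close>; these
  terms cancel in the sum, and the squares of cosine and sine add up to 1.\<close>

lemma trig_test_pairs: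
  assumes \<Omega>: "open \<Omega>" and tp: "test_pair \<Omega> \<phi> G"
  defines "fc \<equiv> \<lambda>p x. \<phi> x * cos (x \<bullet> p)" and "gc \<equiv> \<lambda>p x. \<phi> x *\<^sub>R (- sin (x \<bullet> p) *\<^sub>R p) + cos (x \<bullet> p) *\<^sub>R G x"
    and "fs \<equiv> \<lambda>p x. \<phi> x * sin (x \<bullet> p)" and "gs \<equiv> \<lambda>p x. \<phi> x *\<^sub>R (cos (x \<bullet> p) *\<^sub>R p) + sin (x \<bullet> p) *\<^sub>R G x"
  shows "in_H10 \<Omega> (fc p) (gc p)" "in_H10 \<Omega> (fs p) (gs p)"
    and "L2_inner \<Omega> (fc p) (fc p) + L2_inner \<Omega> (fs p) (fs p) = (L2_norm \<Omega> \<phi>)\<^sup>2"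
    and "L2_inner \<Omega> (gc p) (gc p) + L2_inner \<Omega> (gs p) (gs p) = (L2_norm \<Omega> G)\<^sup>2 + (norm p)\<^sup>2 * (L2_norm \<Omega> \<phi>)\<^sup>2"
proof -
  have inn: "GDERIV (\<lambda>x. x \<bullet> p) x :> p" for x
    unfolding gderiv_def by (rule bounded_linear_imp_has_derivative[OF bounded_linear_inner_left])
  have "test_pair \<Omega> (fc p) (gc p)"
    unfolding fc_def gc_def
    by (rule test_pair_mult[OF tp C_k_cos GDERIV_DERIV_compose[OF inn DERIV_cos]])
  then show H1: "in_H10 \<Omega> (fc p) (gc p)" by (rule test_pair_in_H10[OF \<Omega>])
  have "test_pair \<Omega> (fs p) (gs p)"
    unfolding fs_def gs_def
    by (rule test_pair_mult[OF tp C_k_sin GDERIV_DERIV_compose[OF inn DERIV_sin]])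
  then show H2: "in_H10 \<Omega> (fs p) (gs p)" by (rule test_pair_in_H10[OF \<Omega>])
  note L = in_H10_L2[OF H1] in_H10_L2[OF H2] test_pair_in_L2[OF \<Omega> tp]
  have tr: "cos t * cos t + sin t * sin t = 1" for t :: real
    using sin_cos_squared_add2[of t] by (simp add: power2_eq_square)
  have "L2_inner \<Omega> (fc p) (fc p) + L2_inner \<Omega> (fs p) (fs p) = (LINT x|lebesgue_on \<Omega>. fc p x \<bullet> fc p x + fs p x \<bullet> fs p x)"
    unfolding L2_inner_def by (rule Bochner_Integration.integral_add[symmetric]; rule integrable_L2_inner; rule L)
  also have "\<dots> = L2_inner \<Omega> \<phi> \<phi>"
    unfolding L2_inner_def
  proof (rule Bochner_Integration.integral_cong)
    fix x
    have "fc p x \<bullet> fc p x + fs p x \<bullet> fs p x = \<phi> x * \<phi> x * (cos (x \<bullet> p) * cos (x \<bullet> p) + sin (x \<bullet> p) * sin (x \<bullet> p))"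
      unfolding fc_def fs_def inner_real_def by algebra
    then show "fc p x \<bullet> fc p x + fs p x \<bullet> fs p x = \<phi> x \<bullet> \<phi> x" by (simp add: tr)
  qed simp
  finally show "L2_inner \<Omega> (fc p) (fc p) + L2_inner \<Omega> (fs p) (fs p) = (L2_norm \<Omega> \<phi>)\<^sup>2"
    by (simp add: L2_norm_power2)
  have "L2_inner \<Omega> (gc p) (gc p) + L2_inner \<Omega> (gs p) (gs p) = (LINT x|lebesgue_on \<Omega>. gc p x \<bullet> gc p x + gs p x \<bullet> gs p x)"
    unfolding L2_inner_def by (rule Bochner_Integration.integral_add[symmetric]; rule integrable_L2_inner; rule L)
  also have "\<dots> = (LINT x|lebesgue_on \<Omega>. G x \<bullet> G x + (norm p)\<^sup>2 * (\<phi> x \<bullet> \<phi> x))"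
  proof (rule Bochner_Integration.integral_cong)
    fix x
    define C S where "C = cos (x \<bullet> p)" and "S = sin (x \<bullet> p)"
    have 1: "C * C + S * S = 1" unfolding C_def S_def by (rule tr)
    have "gc p x \<bullet> gc p x + gs p x \<bullet> gs p x = (C * C + S * S) * (G x \<bullet> G x) + (C * C + S * S) * (\<phi> x * \<phi> x * (p \<bullet> p))"
      unfolding gc_def gs_def C_def[symmetric] S_def[symmetric]
      by (simp add: inner_add_left inner_add_right inner_commute[of "G x" p] algebra_simps)
    then show "gc p x \<bullet> gc p x + gs p x \<bullet> gs p x = G x \<bullet> G x + (norm p)\<^sup>2 * (\<phi> x \<bullet> \<phi> x)"
      by (simp add: 1 power2_norm_eq_inner)
  qed simp
  also have "\<dots> = L2_inner \<Omega> G G + (norm p)\<^sup>2 * L2_inner \<Omega> \<phi> \<phi>"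
    unfolding L2_inner_def
    by (subst Bochner_Integration.integral_add) (auto intro!: integrable_L2_inner L simp del: inner_real_def)
  finally show "L2_inner \<Omega> (gc p) (gc p) + L2_inner \<Omega> (gs p) (gs p) = (L2_norm \<Omega> G)\<^sup>2 + (norm p)\<^sup>2 * (L2_norm \<Omega> \<phi>)\<^sup>2"
    by (simp add: L2_norm_power2)
qed

lemma in_L2_mult_bounded:
  fixes \<phi> w :: "'a::euclidean_space \<Rightarrow> real"
  assumes "in_L2 \<Omega> \<phi>" "in_L2 \<Omega> w" "\<And>x. \<bar>\<phi> x\<bar> \<le> 1"
  shows "in_L2 \<Omega> (\<lambda>x. \<phi> x * w x)" "(L2_norm \<Omega> (\<lambda>x. \<phi> x * w x))\<^sup>2 \<le> (L2_norm \<Omega> w)\<^sup>2"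
proof -
  have le: "(norm (\<phi> x * w x))\<^sup>2 \<le> (norm (w x))\<^sup>2" for x
    using mult_right_mono[OF assms(3)[of x], of "\<bar>w x\<bar>"] by (intro power_mono) (auto simp: abs_mult)
  show L: "in_L2 \<Omega> (\<lambda>x. \<phi> x * w x)"
  proof (rule in_L2_boundI[OF _ _ le])
    show "(\<lambda>x. \<phi> x * w x) \<in> borel_measurable (lebesgue_on \<Omega>)"
      by (intro borel_measurable_times in_L2_measurable assms)
    show "integrable (lebesgue_on \<Omega>) (\<lambda>x. (norm (w x))\<^sup>2)" using assms(2) by (simp add: in_L2_def)
  qed
  show "(L2_norm \<Omega> (\<lambda>x. \<phi> x * w x))\<^sup>2 \<le> (L2_norm \<Omega> w)\<^sup>2"
    unfolding L2_norm_power2_integral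
    by (rule integral_mono[OF _ _ le]) (use L assms(2) in \<open>simp_all add: in_L2_def\<close>)
qed

lemma averaged_variational_principle:
  fixes \<Omega> :: "'a::euclidean_space set"
  assumes \<Omega>: "open \<Omega>" "bounded \<Omega>" and E: "eigen_system \<Omega> k w g \<mu>" and k: "k \<ge> 1"
    and tp: "test_pair \<Omega> \<phi> G" and \<phi>: "\<And>x. \<bar>\<phi> x\<bar> \<le> 1" and \<rho>: "\<rho> \<ge> 0"
  defines "\<omega> \<equiv> unit_ball_vol (real DIM('a))" and "d \<equiv> real DIM('a)" and "N \<equiv> (L2_norm \<Omega> \<phi>)\<^sup>2" and "z \<equiv> \<mu> (k - 1)"
  shows "\<omega> * \<rho> ^ DIM('a) * (z * N - (L2_norm \<Omega> G)\<^sup>2 - d / (d + 2) * \<rho>\<^sup>2 * N) \<le> (2 * pi) ^ DIM('a) * (\<Sum>i<k. z - \<mu> i)"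
proof -
  note D = eigen_systemD[OF E]
  have \<Omega>': "\<Omega> \<in> lmeasurable" using \<Omega> by (simp add: lmeasurable_open)
  have Lw: "in_L2 \<Omega> (w i)" if "i < k" for i by (rule in_H10_L2(1)[OF D(1)[OF that]])
  note L\<phi> = test_pair_in_L2(1)[OF \<Omega>(1) tp]
  define q where "q i p = (L2_inner \<Omega> (\<lambda>x. \<phi> x * w i x) (\<lambda>x. cos (x \<bullet> p)))\<^sup>2 + (L2_inner \<Omega> (\<lambda>x. \<phi> x * w i x) (\<lambda>x. sin (x \<bullet> p)))\<^sup>2" for i and p :: 'a
  have z: "\<mu> i \<le> z" if "i < k" for i
    unfolding z_def using D(4)[of i "k - 1"] that by simp
  \<comment> \<open>The last clause of the system bounds the remainder of the projection; the two
    Pythagorean identities then produce the sum over the coefficients.\<close>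
  have var: "z * L2_inner \<Omega> f f - L2_inner \<Omega> h h \<le> (\<Sum>i<k. (z - \<mu> i) * (L2_inner \<Omega> f (w i))\<^sup>2)" if f: "in_H10 \<Omega> f h" for f h
  proof -
    note P = eigen_projection[OF \<Omega>(1) E f]
    have "z * L2_inner \<Omega> (\<lambda>x. f x - (\<Sum>j<k. L2_inner \<Omega> f (w j) *\<^sub>R w j x)) (\<lambda>x. f x - (\<Sum>j<k. L2_inner \<Omega> f (w j) *\<^sub>R w j x))
       \<le> L2_inner \<Omega> (\<lambda>x. h x - (\<Sum>j<k. L2_inner \<Omega> f (w j) *\<^sub>R g j x)) (\<lambda>x. h x - (\<Sum>j<k. L2_inner \<Omega> f (w j) *\<^sub>R g j x))"
      unfolding z_def using k by (intro D(5)[OF P(1) P(2)]) simp_all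
    then show ?thesis
      unfolding P(3) P(4) by (simp add: algebra_simps sum_subtractf sum_distrib_left)
  qed
  have pointwise: "z * N - ((L2_norm \<Omega> G)\<^sup>2 + (norm p)\<^sup>2 * N) \<le> (\<Sum>i<k. (z - \<mu> i) * q i p)" for p
  proof -
    note T = trig_test_pairs[OF \<Omega>(1) tp, of p]
    \<comment> \<open>Moving \<open>\<phi>\<close> to the other factor makes the coefficients
      Fourier integrals of \<open>\<phi> x * w i x\<close>, whose L2 norm is at most 1.\<close>
    have c: "L2_inner \<Omega> (\<lambda>x. \<phi> x * cos (x \<bullet> p)) (w i) = L2_inner \<Omega> (\<lambda>x. \<phi> x * w i x) (\<lambda>x. cos (x \<bullet> p))"
      and s: "L2_inner \<Omega> (\<lambda>x. \<phi> x * sin (x \<bullet> p)) (w i) = L2_inner \<Omega> (\<lambda>x. \<phi> x * w i x) (\<lambda>x. sin (x \<bullet> p))" for i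
      by (simp_all add: L2_inner_def mult_ac)
    have "z * (a + b) - (a' + b') \<le> x + y" if "z * a - a' \<le> x" "z * b - b' \<le> y" for a b a' b' x y
      using that by (simp add: algebra_simps)
    from this[OF var[OF T(1)] var[OF T(2)]] show ?thesis
      unfolding T(3) T(4) c s N_def q_def by (simp only: distrib_left sum.distrib)
  qed
  have Lv: "in_L2 \<Omega> (\<lambda>x. \<phi> x * w i x)" "(L2_norm \<Omega> (\<lambda>x. \<phi> x * w i x))\<^sup>2 \<le> 1" if "i < k" for i
    using in_L2_mult_bounded[OF L\<phi> Lw[OF that] \<phi>] D(2)[OF that that] by (simp_all add: L2_norm_power2)
  have qint: "integrable lborel (\<lambda>p. indicator (cball 0 \<rho>) p * q i p)"
    and qle: "(LINT p|lborel. indicator (cball 0 \<rho>) p * q i p) \<le> (2 * pi) ^ DIM('a)" if "i < k" for i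
  proof -
    note P = plancherel_ball[OF \<Omega>' Lv(1)[OF that] \<rho>, folded q_def]
    show "integrable lborel (\<lambda>p. indicator (cball 0 \<rho>) p * q i p)" by (rule P(1))
    have "(2 * pi) ^ DIM('a) * (L2_norm \<Omega> (\<lambda>x. \<phi> x * w i x))\<^sup>2 \<le> (2 * pi) ^ DIM('a) * 1"
      by (rule mult_left_mono[OF Lv(2)[OF that]]) simp
    from order_trans[OF P(2) this[unfolded mult_1_right]]
    show "(LINT p|lborel. indicator (cball 0 \<rho>) p * q i p) \<le> (2 * pi) ^ DIM('a)" .
  qed
  have "has_bochner_integral lborel (\<lambda>p::'a. indicator (cball 0 \<rho>) p *\<^sub>R (1::real)) (measure lborel (cball (0::'a) \<rho>) *\<^sub>R 1)"
    by (rule has_bochner_integral_indicator) (simp, rule emeasure_bounded_finite[OF bounded_cball])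
  then have ball: "integrable lborel (\<lambda>p::'a. indicator (cball 0 \<rho>) p :: real)"
    "(LINT p|lborel. indicator (cball (0::'a) \<rho>) p :: real) = \<omega> * \<rho> ^ DIM('a)"
    using \<rho> by (auto simp: has_bochner_integral_iff content_cball \<omega>_def)
  note mom = ball_second_moment[OF \<rho>, where 'a = 'a, folded \<omega>_def d_def]
  have "\<omega> * \<rho> ^ DIM('a) * (z * N - (L2_norm \<Omega> G)\<^sup>2 - d / (d + 2) * \<rho>\<^sup>2 * N)
     = (z * N - (L2_norm \<Omega> G)\<^sup>2) * (LINT p|lborel. indicator (cball (0::'a) \<rho>) p) - N * (LINT p|lborel. indicator (cball (0::'a) \<rho>) p * (norm p)\<^sup>2)"
    unfolding ball(2) mom(2) by (simp add: power_add algebra_simps power2_eq_square)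
  also have "\<dots> = (LINT p|lborel. (z * N - (L2_norm \<Omega> G)\<^sup>2) * indicator (cball (0::'a) \<rho>) p - N * (indicator (cball (0::'a) \<rho>) p * (norm p)\<^sup>2))"
    by (subst Bochner_Integration.integral_diff) (use ball(1) mom(1) in auto)
  also have "\<dots> \<le> (LINT p|lborel. (\<Sum>i<k. (z - \<mu> i) * (indicator (cball 0 \<rho>) p * q i p)))"
  proof (rule integral_mono)
    fix p :: 'a
    have "(z * N - (L2_norm \<Omega> G)\<^sup>2) * indicator (cball 0 \<rho>) p - N * (indicator (cball 0 \<rho>) p * (norm p)\<^sup>2)
        = indicator (cball 0 \<rho>) p * (z * N - ((L2_norm \<Omega> G)\<^sup>2 + (norm p)\<^sup>2 * N))"
      by (simp add: algebra_simps)
    also have "\<dots> \<le> indicator (cball 0 \<rho>) p * (\<Sum>i<k. (z - \<mu> i) * q i p)"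
      by (rule mult_left_mono[OF pointwise]) simp
    also have "\<dots> = (\<Sum>i<k. (z - \<mu> i) * (indicator (cball 0 \<rho>) p * q i p))"
      by (simp add: sum_distrib_left mult_ac)
    finally show "(z * N - (L2_norm \<Omega> G)\<^sup>2) * indicator (cball 0 \<rho>) p - N * (indicator (cball 0 \<rho>) p * (norm p)\<^sup>2)
        \<le> (\<Sum>i<k. (z - \<mu> i) * (indicator (cball 0 \<rho>) p * q i p))" .
  qed (use ball(1) mom(1) qint in auto)
  also have "\<dots> = (\<Sum>i<k. (z - \<mu> i) * (LINT p|lborel. indicator (cball 0 \<rho>) p * q i p))"
    by (subst Bochner_Integration.integral_sum) (use qint in auto)
  \<comment> \<open>The factors are nonnegative because z is the largest of the first k
    values.\<close>
  also have "\<dots> \<le> (\<Sum>i<k. (z - \<mu> i) * (2 * pi) ^ DIM('a))"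
    by (intro sum_mono mult_left_mono qle) (use z in auto)
  also have "\<dots> = (\<Sum>i<k. z - \<mu> i) * (2 * pi) ^ DIM('a)"
    by (rule sum_distrib_right[symmetric])
  also have "\<dots> = (2 * pi) ^ DIM('a) * (\<Sum>i<k. z - \<mu> i)"
    by (rule mult.commute)
  finally show ?thesis .
qed

theorem eigenvalue_sum_bound:
  fixes \<Omega> :: "'a::euclidean_space set"
  assumes \<Omega>: "open \<Omega>" "bounded \<Omega>" and lam: "dirichlet_eigenvalues \<Omega> lam" and k: "k \<ge> 1"
    and tp: "test_pair \<Omega> \<phi> G" and \<phi>: "\<And>x. \<bar>\<phi> x\<bar> \<le> 1" and N0: "L2_norm \<Omega> \<phi> \<noteq> 0"
  defines "d \<equiv> DIM('a)" and "N \<equiv> (L2_norm \<Omega> \<phi>)\<^sup>2"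
  shows "(1 / real k) * (\<Sum>j=1..k. lam j)
    \<le> real d / (real d + 2) * C_const d * (real k / N) powr (2 / real d) + (L2_norm \<Omega> G)\<^sup>2 / N"
proof -
  obtain w g \<mu> where E: "eigen_system \<Omega> k w g \<mu>" using eigen_system_exists[OF \<Omega> lam] by blast
  have N: "N > 0" using N0 by (simp add: N_def)
  have d: "d > 0" by (simp add: d_def)
  define \<omega> where "\<omega> = unit_ball_vol (real d)"
  have \<omega>: "\<omega> > 0" by (simp add: \<omega>_def)
  define T where "T = (2 * pi) ^ d"
  have T: "T > 0" by (simp add: T_def)
  \<comment> \<open>Solves omega rho^d N = (2 pi)^d k, so that z has the same coefficient on both
    sides of the averaged inequality.\<close>
  define \<rho> where "\<rho> = (T * real k / (\<omega> * N)) powr (1 / real d)"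
  have \<rho>: "\<rho> > 0" using N T \<omega> k by (simp add: \<rho>_def)
  have "\<rho> ^ d = T * real k / (\<omega> * N)"
    using N T \<omega> k d unfolding \<rho>_def by (simp add: powr_realpow[symmetric] powr_powr)
  then have pd: "\<omega> * \<rho> ^ d * N = T * real k" using N \<omega> by simp
  have "\<rho>\<^sup>2 = (T * real k / (\<omega> * N)) powr (2 / real d)"
    using N T \<omega> k d unfolding \<rho>_def by (simp add: powr_realpow[symmetric] powr_powr)
  also have "\<dots> = (T / \<omega> * (real k / N)) powr (2 / real d)" by simp
  also have "\<dots> = (T / \<omega>) powr (2 / real d) * (real k / N) powr (2 / real d)"
    by (rule powr_mult)
  also have "(T / \<omega>) powr (2 / real d) = T powr (2 / real d) / \<omega> powr (2 / real d)"
    using T \<omega> by (simp add: powr_divide)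
  also have "T powr (2 / real d) = (2 * pi)\<^sup>2"
  proof -
    have "T = (2 * pi) powr real d" unfolding T_def by (rule powr_realpow[symmetric]) simp
    then have "T powr (2 / real d) = (2 * pi) powr (real d * (2 / real d))" by (simp only: powr_powr)
    also have "real d * (2 / real d) = 2" using d by simp
    also have "(2 * pi) powr 2 = (2 * pi)\<^sup>2" by (rule powr_numeral) simp
    finally show ?thesis .
  qed
  \<comment> \<open>The constant C_d is the square of the radius of the ball of volume (2
    pi)^d.\<close>
  also have "(2 * pi)\<^sup>2 / \<omega> powr (2 / real d) = C_const d"
    by (simp add: C_const_def \<omega>_def power_mult_distrib powr_minus_divide)
  finally have \<rho>2: "\<rho>\<^sup>2 = C_const d * (real k / N) powr (2 / real d)" .
  define z where "z = \<mu> (k - 1)"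
  have "\<omega> * \<rho> ^ d * (z * N - (L2_norm \<Omega> G)\<^sup>2 - real d / (real d + 2) * \<rho>\<^sup>2 * N) \<le> T * (\<Sum>i<k. z - \<mu> i)"
    using averaged_variational_principle[OF \<Omega> E k tp \<phi> less_imp_le[OF \<rho>]]
    unfolding \<omega>_def T_def d_def N_def z_def .
  also have "\<omega> * \<rho> ^ d * (z * N - (L2_norm \<Omega> G)\<^sup>2 - real d / (real d + 2) * \<rho>\<^sup>2 * N)
      = T * (real k * (z - (L2_norm \<Omega> G)\<^sup>2 / N - real d / (real d + 2) * \<rho>\<^sup>2))"
  proof -
    have "a * (z * N - b - c * N) = a * N * (z - b / N - c)" for a b c
      using N by (simp add: field_simps)
    from this[of "\<omega> * \<rho> ^ d" "(L2_norm \<Omega> G)\<^sup>2" "real d / (real d + 2) * \<rho>\<^sup>2"]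
    show ?thesis unfolding pd by (simp only: mult.assoc)
  qed
  finally have "real k * (z - (L2_norm \<Omega> G)\<^sup>2 / N - real d / (real d + 2) * \<rho>\<^sup>2) \<le> (\<Sum>i<k. z - \<mu> i)"
    using T by simp
  also have "(\<Sum>i<k. z - \<mu> i) = real k * z - (\<Sum>i<k. \<mu> i)" by (simp add: sum_subtractf)
  finally have 1: "(\<Sum>i<k. \<mu> i) \<le> real k * (real d / (real d + 2) * \<rho>\<^sup>2 + (L2_norm \<Omega> G)\<^sup>2 / N)"
    by (simp add: algebra_simps)
  have "(\<Sum>j=1..k. lam j) = (\<Sum>i<k. lam (Suc i))"
    using sum.atLeast1_atMost_eq[of lam k] by simp
  \<comment> \<open>The list \<open>lam\<close> is counted from 1 and the system from 0.\<close>
  also have "\<dots> \<le> (\<Sum>i<k. \<mu> i)"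
  proof (rule sum_mono)
    fix i assume "i \<in> {..<k}"
    then show "lam (Suc i) \<le> \<mu> i" using eigenvalue_le_eigen_system[OF E lam, of "Suc i"] by simp
  qed
  finally have "(\<Sum>j=1..k. lam j) \<le> real k * (real d / (real d + 2) * \<rho>\<^sup>2 + (L2_norm \<Omega> G)\<^sup>2 / N)"
    using 1 by linarith
  from mult_left_mono[OF this, of "1 / real k"] show ?thesis
    unfolding \<rho>2 using k by simp
qed

section \<open>Cutoff functions\<close>

text \<open>Each order n comes with its own gradient; uniqueness of the derivative identifies them
  all, and the coordinates of this one gradient are again smooth of every order.\<close>

lemma C_k_all_gradient:
  assumes "\<And>n. C_k n \<eta>"
  obtains E where "\<And>x. GDERIV \<eta> x :> E x" "\<And>n b. b \<in> Basis \<Longrightarrow> C_k n (\<lambda>x. E x \<bullet> b)"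
proof -
  obtain E where E: "\<And>x. GDERIV \<eta> x :> E x" using assms[of "Suc 0"] by auto
  have "C_k n (\<lambda>x. E x \<bullet> b)" if "b \<in> Basis" for n b
  proof -
    obtain H where H: "\<And>x. GDERIV \<eta> x :> H x" "\<And>b. b \<in> Basis \<Longrightarrow> C_k n (\<lambda>x. H x \<bullet> b)"
      using assms[of "Suc n"] by auto
    have "H = E" using GDERIV_unique[OF H(1) E] by auto
    then show ?thesis using H(2)[OF that] by simp
  qed
  with E that show ?thesis by blast
qed

lemma C_k_gradient_continuous:
  fixes E :: "'a::euclidean_space \<Rightarrow> 'a"
  assumes "\<And>n b. b \<in> Basis \<Longrightarrow> C_k n (\<lambda>x. E x \<bullet> b)"
  shows "continuous_on UNIV E"
proof -
  have "continuous_on UNIV (\<lambda>x. \<Sum>b\<in>Basis. (E x \<bullet> b) *\<^sub>R b)"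
    by (intro continuous_on_sum continuous_on_scaleR continuous_on_const C_k_imp_continuous[OF assms])
  then show ?thesis by (simp add: euclidean_representation)
qed

text \<open>All derivatives fall on \<open>\<eta>\<close>, so the induction generalizes over it and
  \<open>\<psi>\<close> need only be continuous. Integrating over a fixed compact box makes Leibniz'
  rule applicable.\<close>

lemma C_k_convolution:
  fixes \<psi> \<eta> :: "'a::euclidean_space \<Rightarrow> real"
  assumes \<psi>: "continuous_on UNIV \<psi>" and \<eta>: "\<And>n. C_k n \<eta>"
  shows "C_k n (\<lambda>x. integral (cbox a b) (\<lambda>y. \<psi> y * \<eta> (x - y)))"
  using \<eta>
proof (induction n arbitrary: \<eta>)
  case 0
  have cont\<eta>: "continuous_on UNIV \<eta>" using 0[of 0] by simp
  have "continuous_on (UNIV \<times> cbox a b) (\<lambda>(x, y). \<psi> y * \<eta> (x - y))"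
    unfolding case_prod_unfold
    by (intro continuous_on_mult continuous_on_compose2[OF \<psi>] continuous_on_compose2[OF cont\<eta>]
        continuous_on_diff continuous_on_fst continuous_on_snd continuous_on_id) auto
  then show ?case by (simp add: integral_continuous_on_param)
next
  case (Suc n)
  obtain E where E: "\<And>x. GDERIV \<eta> x :> E x" "\<And>n b. b \<in> Basis \<Longrightarrow> C_k n (\<lambda>x. E x \<bullet> b)"
    using C_k_all_gradient[of \<eta>] Suc.prems by blast
  have contE: "continuous_on UNIV E" by (rule C_k_gradient_continuous[OF E(2)])
  have cont\<eta>: "continuous_on UNIV \<eta>" using Suc.prems[of 0] by simp
  have c1: "continuous_on (cbox a b) (\<lambda>y. \<psi> y * \<eta> (x - y))" for x
    by (intro continuous_on_mult continuous_on_compose2[OF \<psi>] continuous_on_compose2[OF cont\<eta>]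
        continuous_on_diff continuous_on_const continuous_on_id) auto
  have c2: "continuous_on (cbox a b) (\<lambda>y. \<psi> y *\<^sub>R E (x - y))" for x
    by (intro continuous_on_scaleR continuous_on_compose2[OF \<psi>] continuous_on_compose2[OF contE]
        continuous_on_diff continuous_on_const continuous_on_id) auto
  have c3: "continuous_on (UNIV \<times> cbox a b) (\<lambda>(x, y). blinfun_inner_left (\<psi> y *\<^sub>R E (x - y)))"
    unfolding case_prod_unfold
    by (intro bounded_linear.continuous_on[OF bounded_linear_blinfun_inner_left] continuous_on_scaleR
        continuous_on_compose2[OF \<psi>] continuous_on_compose2[OF contE]
        continuous_on_diff continuous_on_fst continuous_on_snd continuous_on_id) auto
  let ?G = "\<lambda>x. integral (cbox a b) (\<lambda>y. \<psi> y *\<^sub>R E (x - y))"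
  have "GDERIV (\<lambda>x. integral (cbox a b) (\<lambda>y. \<psi> y * \<eta> (x - y))) x :> ?G x" for x
  proof -
    have "((\<lambda>x. integral (cbox a b) (\<lambda>y. \<psi> y * \<eta> (x - y))) has_derivative
        blinfun_apply (integral (cbox a b) (\<lambda>y. blinfun_inner_left (\<psi> y *\<^sub>R E (x - y))))) (at x within UNIV)"
    proof (rule leibniz_rule)
      fix x t :: 'a
      have "(\<eta> has_derivative (\<lambda>h. h \<bullet> E (x - t))) (at (x - t))"
        using E(1) by (simp add: gderiv_def)
      moreover have "((\<lambda>x. x - t) has_derivative (\<lambda>h. h)) (at x)"
        by (auto intro!: derivative_eq_intros)
      ultimately have "((\<lambda>x. \<eta> (x - t)) has_derivative (\<lambda>h. h \<bullet> E (x - t))) (at x)"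
        using has_derivative_compose[of "\<lambda>x. x - t" "\<lambda>h. h" x UNIV \<eta> "\<lambda>h. h \<bullet> E (x - t)"] by simp
      from has_derivative_mult_right[OF this, of "\<psi> t"]
      show "((\<lambda>x. \<psi> t * \<eta> (x - t)) has_derivative blinfun_apply (blinfun_inner_left (\<psi> t *\<^sub>R E (x - t)))) (at x within UNIV)"
        by (simp add: blinfun_inner_left.rep_eq)
    next
      show "(\<lambda>y. \<psi> y * \<eta> (x - y)) integrable_on cbox a b" for x
        by (rule integrable_continuous[OF c1])
    qed (use c3 in auto)
    moreover have "integral (cbox a b) (\<lambda>y. blinfun_inner_left (\<psi> y *\<^sub>R E (x - y))) = blinfun_inner_left (?G x)"
      using integral_linear[OF integrable_continuous[OF c2] bounded_linear_blinfun_inner_left, of x]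
      by (simp add: comp_def)
    ultimately show ?thesis
      by (simp add: gderiv_def blinfun_inner_left.rep_eq)
  qed
  moreover have "C_k n (\<lambda>x. ?G x \<bullet> c)" if c: "c \<in> Basis" for c
  proof -
    have "?G x \<bullet> c = integral (cbox a b) (\<lambda>y. \<psi> y * (E (x - y) \<bullet> c))" for x
      using integral_linear[OF integrable_continuous[OF c2] bounded_linear_inner_left[of c], of x]
      by (simp add: comp_def)
    then show ?thesis using Suc.IH[of "\<lambda>x. E x \<bullet> c"] E(2)[OF c] by simp
  qed
  ultimately show ?case unfolding C_k.simps by (intro exI[of _ ?G]) simp
qed

text \<open>The derivative in the direction G is the square of norm G, while the Lipschitz bound
  gives at most L * norm G.\<close>

lemma GDERIV_norm_le_Lipschitz:
  fixes f :: "'a::euclidean_space \<Rightarrow> real"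
  assumes D: "GDERIV f x :> G" and L: "\<And>y. \<bar>f y - f x\<bar> \<le> L * norm (y - x)"
  shows "norm G \<le> L"
proof (cases "G = 0")
  case True
  \<comment> \<open>For G = 0 the claim is L \<ge> 0, which the Lipschitz bound at a unit vector
    supplies.\<close>
  obtain b :: 'a where b: "b \<in> Basis" using nonempty_Basis by blast
  have "0 \<le> \<bar>f (x + b) - f x\<bar>" by simp
  also have "\<dots> \<le> L" using L[of "x + b"] b by simp
  finally show ?thesis using True by simp
next
  case False
  have "(f has_derivative (\<lambda>h. h \<bullet> G)) (at (x + 0 *\<^sub>R G))" using D by (simp add: gderiv_def)
  moreover have "((\<lambda>t. x + t *\<^sub>R G) has_derivative (\<lambda>t. t *\<^sub>R G)) (at 0)"
    by (auto intro!: derivative_eq_intros)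
  ultimately have "((\<lambda>t. f (x + t *\<^sub>R G)) has_derivative (\<lambda>t. (t *\<^sub>R G) \<bullet> G)) (at (0::real))"
    using has_derivative_compose[of "\<lambda>t. x + t *\<^sub>R G" "\<lambda>t. t *\<^sub>R G" 0 UNIV f "\<lambda>h. h \<bullet> G"] by simp
  then have "((\<lambda>t. f (x + t *\<^sub>R G)) has_real_derivative (norm G)\<^sup>2) (at 0)"
    by (simp add: has_field_derivative_def power2_norm_eq_inner mult_commute_abs)
  then have "((\<lambda>t. \<bar>(f (x + t *\<^sub>R G) - f x) / t\<bar>) \<longlongrightarrow> \<bar>(norm G)\<^sup>2\<bar>) (at 0)"
    by (intro tendsto_rabs) (simp add: DERIV_def)
  moreover have "\<forall>\<^sub>F t in at (0::real). \<bar>(f (x + t *\<^sub>R G) - f x) / t\<bar> \<le> L * norm G"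
  proof -
    have "\<bar>(f (x + t *\<^sub>R G) - f x) / t\<bar> \<le> L * norm G" if "t \<noteq> 0" for t
      using L[of "x + t *\<^sub>R G"] that by (simp add: field_simps)
    then show ?thesis by (auto simp: eventually_at_filter)
  qed
  ultimately have "\<bar>(norm G)\<^sup>2\<bar> \<le> L * norm G" by (rule tendsto_upperbound) simp
  then show ?thesis using False by (simp add: power2_eq_square)
qed

lemma lborel_integral_reflect:
  fixes f :: "'a::euclidean_space \<Rightarrow> real"
  assumes [measurable]: "f \<in> borel_measurable borel"
  shows "(LINT y|lborel. f (x - y)) = (LINT y|lborel. f y)"
proof -
  have "lborel = density (distr lborel borel (\<lambda>y. x + (-1) *\<^sub>R y)) (\<lambda>_. ennreal (\<bar>-1\<bar> ^ DIM('a)))"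
    by (rule lborel_affine) simp
  also have "\<dots> = distr lborel borel (\<lambda>y. x - y)" by (simp add: density_1)
  finally have "lborel = distr lborel borel (\<lambda>y. x - y)" .
  then have "(LINT y|lborel. f y) = (LINT y|distr lborel borel (\<lambda>y. x - y). f y)" by (rule arg_cong)
  also have "\<dots> = (LINT y|lborel. f (x - y))"
    by (rule integral_distr) simp_all
  finally show ?thesis by simp
qed

text \<open>Averaging against a smooth probability density supported in the ball of radius \<delta>
  keeps the Lipschitz constant, and any bound on \<open>\<psi>\<close> that holds near x passes to
  \<open>\<phi> x\<close>. The last two clauses thus determine the cutoff where it is
  constant.\<close>

lemma mollify:
  fixes \<psi> :: "'a::euclidean_space \<Rightarrow> real"
  assumes \<delta>: "\<delta> > 0" and Lip: "\<And>x y. \<bar>\<psi> x - \<psi> y\<bar> \<le> L * norm (x - y)" and L: "L \<ge> 0"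
    and \<psi>: "\<And>x. 0 \<le> \<psi> x" "\<And>x. \<psi> x \<le> 1" and supp: "\<And>x. x \<notin> cbox a b \<Longrightarrow> \<psi> x = 0"
  obtains \<phi> where "\<And>n. C_k n \<phi>" "\<And>x y. \<bar>\<phi> x - \<phi> y\<bar> \<le> L * norm (x - y)"
    "\<And>x c. (\<And>y. norm y < \<delta> \<Longrightarrow> c \<le> \<psi> (x - y)) \<Longrightarrow> c \<le> \<phi> x"
    "\<And>x c. (\<And>y. norm y < \<delta> \<Longrightarrow> \<psi> (x - y) \<le> c) \<Longrightarrow> \<phi> x \<le> c"
proof -
  obtain \<eta>0 :: "'a \<Rightarrow> real" where \<eta>0: "\<And>n. C_k n \<eta>0" "\<And>x. \<eta>0 x \<ge> 0" "\<eta>0 0 > 0" "\<And>x. norm x \<ge> \<delta> \<Longrightarrow> \<eta>0 x = 0"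
    using bump_exists[OF \<delta>] by blast
  have cont0: "continuous_on UNIV \<eta>0" using \<eta>0(1)[of 0] by simp
  have int0: "integrable lborel \<eta>0"
    by (rule continuous_compact_support_integrable[OF cont0 compact_cball[of 0 \<delta>]]) (use \<eta>0(4) in auto)
  define c0 where "c0 = (LINT y|lborel. \<eta>0 y)"
  have "c0 \<noteq> 0"
  proof
    assume "c0 = 0"
    then have AE: "AE y in lborel. \<eta>0 y = 0"
      using integral_nonneg_eq_0_iff_AE[OF int0] \<eta>0(2) by (simp add: c0_def)
    \<comment> \<open>An open set containing 0, which cannot be a null set.\<close>
    let ?N = "{y. \<eta>0 y > 0}"
    have "open ?N" by (rule open_Collect_less[OF continuous_on_const cont0])
    then have sets: "?N \<in> sets lborel" by simp
    have "AE y in lborel. \<not> \<eta>0 y > 0" using AE by eventually_elim simp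
    then have "emeasure lborel ?N = 0" using AE_iff_measurable[OF sets, of "\<lambda>y. \<not> \<eta>0 y > 0"] by simp
    then have "negligible ?N" using sets by (simp add: negligible_iff_emeasure0)
    then show False using open_not_negligible[OF \<open>open ?N\<close>] \<eta>0(3) by auto
  qed
  moreover have "c0 \<ge> 0" unfolding c0_def using \<eta>0(2) by simp
  ultimately have c0: "c0 > 0" by simp
  define \<eta> where "\<eta> y = \<eta>0 y * (1 / c0)" for y
  have "C_k n \<eta>" for n
    unfolding \<eta>_def[abs_def] by (rule C_k_mult[OF \<eta>0(1) C_k_const])
  moreover have "\<eta> x \<ge> 0" "norm x \<ge> \<delta> \<Longrightarrow> \<eta> x = 0" for x
    using \<eta>0(2,4) c0 by (simp_all add: \<eta>_def)
  ultimately have \<eta>: "C_k n \<eta>" "\<eta> x \<ge> 0" "norm x \<ge> \<delta> \<Longrightarrow> \<eta> x = 0" for n x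
    by blast+
  have cont\<eta>: "continuous_on UNIV \<eta>" using \<eta>(1)[of 0] by simp
  have [measurable]: "\<eta> \<in> borel_measurable borel" by (rule borel_measurable_continuous_onI[OF cont\<eta>])
  have int\<eta>: "integrable lborel \<eta>" unfolding \<eta>_def[abs_def] using int0 by simp
  have one: "(LINT y|lborel. \<eta> y) = 1" unfolding \<eta>_def[abs_def] using c0 by (simp add: c0_def[symmetric])
  let ?P = "density lborel \<eta>"
  interpret P: prob_space ?P
  proof
    show "emeasure ?P (space ?P) = 1"
      using \<eta>(2) int\<eta> one by (simp add: emeasure_density nn_integral_eq_integral)
  qed
  have cont\<psi>: "continuous_on UNIV \<psi>"
  proof (rule lipschitz_on_continuous_on)
    show "L-lipschitz_on UNIV \<psi>" using Lip L by (auto simp: lipschitz_on_def dist_norm)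
  qed
  have [measurable]: "\<psi> \<in> borel_measurable borel" by (rule borel_measurable_continuous_onI[OF cont\<psi>])
  define \<phi> where "\<phi> x = P.expectation (\<lambda>y. \<psi> (x - y))" for x
  have int\<psi>: "integrable ?P (\<lambda>y. \<psi> (x - y))" for x
    by (rule P.integrable_const_bound[where B = 1]) (use \<psi> in auto)
  have AEP: "AE y in ?P. norm y < \<delta>"
    using \<eta>(3) by (subst AE_density) (auto intro!: always_eventually simp: not_le[symmetric])
  \<comment> \<open>Two readings of the same function: an expectation, from which the bounds follow,
    and a convolution with the shift on \<open>\<eta>\<close>, from which smoothness
    follows.\<close>
  have conv: "\<phi> x = integral (cbox a b) (\<lambda>y. \<psi> y * \<eta> (x - y))" for x
  proof -
    have "\<phi> x = (LINT y|lborel. \<eta> y * \<psi> (x - y))"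
      unfolding \<phi>_def using \<eta>(2) by (subst integral_density) auto
    also have "\<dots> = (LINT y|lborel. \<eta> (x - y) * \<psi> (x - (x - y)))"
      using lborel_integral_reflect[of "\<lambda>y. \<eta> y * \<psi> (x - y)" x] by simp
    also have "\<dots> = (LINT y|lborel. indicator (cbox a b) y *\<^sub>R (\<psi> y * \<eta> (x - y)))"
      by (rule Bochner_Integration.integral_cong) (auto simp: supp indicator_def)
    also have "\<dots> = integral (cbox a b) (\<lambda>y. \<psi> y * \<eta> (x - y))"
    proof -
      have "continuous_on (cbox a b) (\<lambda>y. \<psi> y * \<eta> (x - y))"
        by (intro continuous_on_mult continuous_on_compose2[OF cont\<psi>] continuous_on_compose2[OF cont\<eta>]
            continuous_on_diff continuous_on_const continuous_on_id) auto
      then have "set_integrable lborel (cbox a b) (\<lambda>y. \<psi> y * \<eta> (x - y))"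
        unfolding set_integrable_def by (intro borel_integrable_compact compact_cbox)
      from set_borel_integral_eq_integral(2)[OF this] show ?thesis
        by (simp add: set_lebesgue_integral_def)
    qed
    finally show ?thesis .
  qed
  show ?thesis
  proof (rule that[of \<phi>])
    show "C_k n \<phi>" for n
      unfolding conv[abs_def] by (rule C_k_convolution[OF cont\<psi> \<eta>(1)])
    show "\<bar>\<phi> x - \<phi> y\<bar> \<le> L * norm (x - y)" for x y
    proof -
      have "\<phi> x - \<phi> y = P.expectation (\<lambda>t. \<psi> (x - t) - \<psi> (y - t))"
        unfolding \<phi>_def by (rule Bochner_Integration.integral_diff[symmetric]; rule int\<psi>)
      also have "\<bar>\<dots>\<bar> \<le> P.expectation (\<lambda>t. \<bar>\<psi> (x - t) - \<psi> (y - t)\<bar>)"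
        by (rule integral_abs_bound)
      also have "\<dots> \<le> L * norm (x - y)"
      proof (rule P.integral_le_const)
        show "integrable ?P (\<lambda>t. \<bar>\<psi> (x - t) - \<psi> (y - t)\<bar>)" by (intro integrable_abs Bochner_Integration.integrable_diff int\<psi>)
        have "\<bar>\<psi> (x - t) - \<psi> (y - t)\<bar> \<le> L * norm (x - y)" for t
          using Lip[of "x - t" "y - t"] by simp
        then show "AE t in ?P. \<bar>\<psi> (x - t) - \<psi> (y - t)\<bar> \<le> L * norm (x - y)" by simp
      qed
      finally show ?thesis .
    qed
    show "c \<le> \<phi> x" if "\<And>y. norm y < \<delta> \<Longrightarrow> c \<le> \<psi> (x - y)" for x c
      unfolding \<phi>_def using AEP by (intro P.integral_ge_const[OF int\<psi>]) (auto elim!: eventually_mono intro: that)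
    show "\<phi> x \<le> c" if "\<And>y. norm y < \<delta> \<Longrightarrow> \<psi> (x - y) \<le> c" for x c
      unfolding \<phi>_def using AEP by (intro P.integral_le_const[OF int\<psi>]) (auto elim!: eventually_mono intro: that)
  qed
qed

text \<open>The segment from x to a nearest point of the complement crosses the frontier. This
  connects \<open>boundary_layer\<close> and \<open>inradius\<close> with the distance to the
  complement, which suits cutoffs because it vanishes outside \<open>\<Omega>\<close>.\<close>

lemma infdist_frontier_le:
  fixes \<Omega> :: "'a::euclidean_space set"
  assumes "open \<Omega>" "bounded \<Omega>" "x \<in> \<Omega>"
  shows "infdist x (frontier \<Omega>) \<le> infdist x (- \<Omega>)"
proof -
  have ne: "- \<Omega> \<noteq> {}" using assms(2) not_bounded_UNIV by (metis Compl_empty_eq double_complement)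
  obtain y where y: "y \<in> - \<Omega>" "infdist x (- \<Omega>) = dist x y"
    using infdist_attains_inf[of "- \<Omega>" x] assms(1) ne by (auto simp: closed_Compl)
  have "closed_segment x y \<inter> frontier \<Omega> \<noteq> {}"
    by (rule connected_Int_frontier) (use assms y in auto)
  then obtain z where z: "z \<in> closed_segment x y" "z \<in> frontier \<Omega>" by blast
  have "infdist x (frontier \<Omega>) \<le> dist x z" by (rule infdist_le[OF z(2)])
  also have "\<dots> \<le> dist x y" using dist_in_closed_segment[OF z(1)] by (simp add: dist_commute)
  finally show ?thesis using y by simp
qed

lemma cutoff_exists:
  fixes \<Omega> :: "'a::euclidean_space set"
  assumes \<Omega>: "open \<Omega>" "bounded \<Omega>" and \<delta>: "\<delta> > 0" "20 * \<delta> \<le> h"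
  obtains \<phi> G where "test_pair \<Omega> \<phi> G" "\<And>x. 0 \<le> \<phi> x" "\<And>x. \<phi> x \<le> 1"
    "\<And>x. infdist x (- \<Omega>) > h \<Longrightarrow> \<phi> x = 1" "\<And>x. infdist x (- \<Omega>) > h \<Longrightarrow> G x = 0"
    "\<And>x. norm (G x) \<le> 1 / (h - 4 * \<delta>)" "\<And>x. infdist x (- \<Omega>) \<ge> h / 4 \<Longrightarrow> \<phi> x \<ge> 1 / 8"
proof -
  have ne: "- \<Omega> \<noteq> {}" using \<Omega>(2) not_bounded_UNIV by (metis Compl_empty_eq double_complement)
  define D where "D x = infdist x (- \<Omega>)" for x
  have DL: "\<bar>D x - D y\<bar> \<le> norm (x - y)" for x y
    using infdist_triangle_abs[of x "- \<Omega>" y] by (simp add: D_def dist_norm)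
  have D0: "D x = 0" if "x \<notin> \<Omega>" for x using that by (simp add: D_def)
  \<comment> \<open>The ramp of \<open>\<psi>\<close> runs from distance 2 \<delta> to h - 2
    \<delta>. After mollification at scale \<delta>, \<open>\<phi>\<close> still vanishes below
    distance \<delta> and equals 1 above h.\<close>
  define H where "H = h - 4 * \<delta>"
  have H: "H > 0" using \<delta> by (simp add: H_def)
  define L where "L = 1 / H"
  have L: "L > 0" using H by (simp add: L_def)
  define \<psi> where "\<psi> x = max 0 (min 1 ((D x - 2 * \<delta>) / H))" for x
  have \<psi>: "0 \<le> \<psi> x" "\<psi> x \<le> 1" for x by (simp_all add: \<psi>_def)
  have Lip: "\<bar>\<psi> x - \<psi> y\<bar> \<le> L * norm (x - y)" for x y
  proof -
    have "\<bar>\<psi> x - \<psi> y\<bar> \<le> \<bar>(D x - 2 * \<delta>) / H - (D y - 2 * \<delta>) / H\<bar>"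
      unfolding \<psi>_def by linarith
    also have "(D x - 2 * \<delta>) / H - (D y - 2 * \<delta>) / H = L * (D x - D y)"
      by (simp add: L_def diff_divide_distrib)
    also have "\<bar>\<dots>\<bar> = L * \<bar>D x - D y\<bar>" using L by (simp add: abs_mult)
    also have "\<dots> \<le> L * norm (x - y)" using L DL by (intro mult_left_mono) auto
    finally show ?thesis .
  qed
  have \<psi>_zero: "\<psi> x = 0" if "D x \<le> 2 * \<delta>" for x
  proof -
    have "(D x - 2 * \<delta>) / H \<le> 0" using that H by (intro divide_nonpos_pos) auto
    then show ?thesis by (simp add: \<psi>_def)
  qed
  obtain a where a: "\<Omega> \<subseteq> cbox (- a) a" using bounded_subset_cbox_symmetric[OF \<Omega>(2)] by blast
  have supp: "\<psi> x = 0" if "x \<notin> cbox (- a) a" for x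
  proof (rule \<psi>_zero)
    have "x \<notin> \<Omega>" using that a by blast
    then show "D x \<le> 2 * \<delta>" using D0[of x] \<delta> by simp
  qed
  obtain \<phi> where \<phi>: "\<And>n. C_k n \<phi>" "\<And>x y. \<bar>\<phi> x - \<phi> y\<bar> \<le> L * norm (x - y)"
    "\<And>x c. (\<And>y. norm y < \<delta> \<Longrightarrow> c \<le> \<psi> (x - y)) \<Longrightarrow> c \<le> \<phi> x"
    "\<And>x c. (\<And>y. norm y < \<delta> \<Longrightarrow> \<psi> (x - y) \<le> c) \<Longrightarrow> \<phi> x \<le> c"
    using mollify[OF \<delta>(1) Lip less_imp_le[OF L] \<psi> supp] by metis
  have Dy: "\<bar>D (x - y) - D x\<bar> < \<delta>" if "norm y < \<delta>" for x y
    using DL[of "x - y" x] that by simp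
  have \<phi>01: "0 \<le> \<phi> x" "\<phi> x \<le> 1" for x using \<phi>(3)[of 0 x] \<phi>(4)[of x 1] \<psi> by auto
  have \<phi>zero: "\<phi> x = 0" if "D x < \<delta>" for x
  proof -
    have "\<psi> (x - y) = 0" if "norm y < \<delta>" for y
      using Dy[OF that, of x] \<open>D x < \<delta>\<close> by (intro \<psi>_zero) auto
    then have "\<phi> x \<le> 0" by (intro \<phi>(4)) simp
    then show ?thesis using \<phi>01[of x] by simp
  qed
  \<comment> \<open>A shift by less than \<delta> lowers the distance by less than \<delta>, which
    turns the offset 2 \<delta> of the ramp into 3 \<delta>.\<close>
  have lower: "c \<le> \<phi> x" if c: "c \<le> 1" "c * H \<le> D x - 3 * \<delta>" for x c
  proof (rule \<phi>(3))
    fix y :: 'a assume "norm y < \<delta>"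
    from Dy[OF this, of x] have "c * H \<le> D (x - y) - 2 * \<delta>" using c by linarith
    then have "c \<le> (D (x - y) - 2 * \<delta>) / H" using H by (simp add: field_simps)
    then show "c \<le> \<psi> (x - y)" using c by (simp add: \<psi>_def)
  qed
  have \<phi>one: "\<phi> x = 1" if "D x > h" for x
    using lower[of 1 x] \<phi>01[of x] that \<delta> by (simp add: H_def)
  obtain G where G: "\<And>x. GDERIV \<phi> x :> G x"
    using \<phi>(1)[of "Suc 0"] by auto
  show ?thesis
  proof (rule that[of \<phi> G])
    have contD: "continuous_on UNIV D" unfolding D_def by (intro continuous_on_infdist continuous_on_id)
    have "closed {x. \<delta> \<le> D x}" by (rule closed_Collect_le[OF continuous_on_const contD])
    moreover have sub: "{x. \<delta> \<le> D x} \<subseteq> \<Omega>" using D0 \<delta> by force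
    ultimately have "compact {x. \<delta> \<le> D x}" using \<Omega>(2) by (auto simp: compact_eq_bounded_closed intro: bounded_subset)
    then have "test_function \<Omega> \<phi>"
      by (rule test_functionI[OF \<phi>(1) _ sub]) (use \<phi>zero in auto)
    then show "test_pair \<Omega> \<phi> G" using G by (simp add: test_pair_def)
    show "norm (G x) \<le> 1 / (h - 4 * \<delta>)" for x
      using GDERIV_norm_le_Lipschitz[OF G \<phi>(2)] by (simp add: L_def H_def)
    show "G x = 0" if "infdist x (- \<Omega>) > h" for x
    proof -
      \<comment> \<open>The maximal value 1 is attained at x, so the derivative vanishes
        there.\<close>
      have "\<phi> y \<le> \<phi> x" for y using \<phi>one[of x] \<phi>01(2)[of y] that by (simp add: D_def)
      then have "(\<lambda>h. h \<bullet> G x) = (\<lambda>h. 0)"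
        using differential_zero_maxmin[of x UNIV \<phi> "\<lambda>h. h \<bullet> G x"] G[of x] by (auto simp: gderiv_def)
      then have "G x \<bullet> G x = 0" by (rule fun_cong)
      then show ?thesis by simp
    qed
    \<comment> \<open>The condition (h - 4 \<delta>) / 8 \<le> h / 4 - 3 \<delta> amounts exactly to
      20 \<delta> \<le> h; this is where that hypothesis comes from.\<close>
    show "\<phi> x \<ge> 1 / 8" if "infdist x (- \<Omega>) \<ge> h / 4" for x
      using lower[of "1 / 8" x] that \<delta> by (simp add: D_def H_def)
  qed (use \<phi>01 \<phi>one in \<open>auto simp: D_def\<close>)
qed

section \<open>The remainder term\<close>

lemma lmeasurable_boundary_layer:
  fixes \<Omega> :: "'a::euclidean_space set"
  assumes "open \<Omega>" "bounded \<Omega>"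
  shows "boundary_layer \<Omega> h \<in> lmeasurable"
proof -
  have "closed {x. infdist x (frontier \<Omega>) \<le> h}"
    by (rule closed_Collect_le) (intro continuous_on_infdist continuous_on_id continuous_on_const)+
  moreover have "boundary_layer \<Omega> h = \<Omega> \<inter> {x. infdist x (frontier \<Omega>) \<le> h}"
    by (auto simp: boundary_layer_def)
  ultimately have "boundary_layer \<Omega> h \<in> sets borel"
    using assms(1) by (simp add: borel_closed borel_open sets.Int)
  then show ?thesis
    using assms(2) by (intro bounded_set_imp_lmeasurable) (auto simp: boundary_layer_def intro: bounded_subset)
qed

lemma L2_norm_power2_ge:
  fixes \<phi> :: "'a::euclidean_space \<Rightarrow> real"
  assumes "\<Omega> \<in> sets lebesgue" "in_L2 \<Omega> \<phi>" "A \<in> lmeasurable" "A \<subseteq> \<Omega>" "c \<ge> 0" "\<And>x. x \<in> A \<Longrightarrow> c \<le> \<bar>\<phi> x\<bar>"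
  shows "c\<^sup>2 * measure lebesgue A \<le> (L2_norm \<Omega> \<phi>)\<^sup>2"
proof -
  have A: "A \<in> sets (lebesgue_on \<Omega>)" using assms by (auto simp: sets_restrict_space_iff fmeasurableD)
  have mA: "measure (lebesgue_on \<Omega>) A = measure lebesgue A" using assms by (intro measure_restrict_space) (auto simp: fmeasurableD)
  have eA: "emeasure (lebesgue_on \<Omega>) A < \<infinity>"
    using assms by (subst emeasure_restrict_space) (auto simp: fmeasurableD2 fmeasurable_def)
  have "c\<^sup>2 * measure lebesgue A = (LINT x|lebesgue_on \<Omega>. indicator A x *\<^sub>R c\<^sup>2)"
    unfolding has_bochner_integral_integral_eq[OF has_bochner_integral_indicator[OF A eA]] mA
    by (simp only: real_scaleR_def mult.commute)
  also have "\<dots> \<le> (L2_norm \<Omega> \<phi>)\<^sup>2"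
    unfolding L2_norm_power2_integral
  proof (rule integral_mono)
    show "integrable (lebesgue_on \<Omega>) (\<lambda>x. indicator A x *\<^sub>R c\<^sup>2)"
      using has_bochner_integral_indicator[OF A eA, of "c\<^sup>2"] by (simp add: has_bochner_integral_iff)
    show "integrable (lebesgue_on \<Omega>) (\<lambda>x. (norm (\<phi> x))\<^sup>2)" using assms(2) by (simp add: in_L2_def)
    show "indicator A x *\<^sub>R c\<^sup>2 \<le> (norm (\<phi> x))\<^sup>2" for x
      using assms(5) power_mono[OF assms(6)[of x], of 2] by (auto simp: indicator_def)
  qed
  finally show ?thesis .
qed

lemma L2_norm_power2_le:
  fixes G :: "'a::euclidean_space \<Rightarrow> 'b::euclidean_space"
  assumes "\<Omega> \<in> sets lebesgue" "in_L2 \<Omega> G" "A \<in> lmeasurable" "A \<subseteq> \<Omega>" "\<And>x. norm (G x) \<le> L"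
    and "\<And>x. x \<in> \<Omega> - A \<Longrightarrow> G x = 0"
  shows "(L2_norm \<Omega> G)\<^sup>2 \<le> L\<^sup>2 * measure lebesgue A"
proof -
  have A: "A \<in> sets (lebesgue_on \<Omega>)" using assms by (auto simp: sets_restrict_space_iff fmeasurableD)
  have mA: "measure (lebesgue_on \<Omega>) A = measure lebesgue A" using assms by (intro measure_restrict_space) (auto simp: fmeasurableD)
  have eA: "emeasure (lebesgue_on \<Omega>) A < \<infinity>"
    using assms by (subst emeasure_restrict_space) (auto simp: fmeasurableD2 fmeasurable_def)
  have "(L2_norm \<Omega> G)\<^sup>2 \<le> (LINT x|lebesgue_on \<Omega>. indicator A x *\<^sub>R L\<^sup>2)"
    unfolding L2_norm_power2_integral
  proof (rule integral_mono)
    show "integrable (lebesgue_on \<Omega>) (\<lambda>x. indicator A x *\<^sub>R L\<^sup>2)"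
      using has_bochner_integral_indicator[OF A eA, of "L\<^sup>2"] by (simp add: has_bochner_integral_iff)
    show "integrable (lebesgue_on \<Omega>) (\<lambda>x. (norm (G x))\<^sup>2)" using assms(2) by (simp add: in_L2_def)
    show "(norm (G x))\<^sup>2 \<le> indicator A x *\<^sub>R L\<^sup>2" if "x \<in> space (lebesgue_on \<Omega>)" for x
      using that assms(6)[of x] power_mono[OF assms(5)[of x], of 2]
      by (cases "x \<in> A") (auto simp: space_restrict_space)
  qed
  also have "\<dots> = L\<^sup>2 * measure lebesgue A"
    using has_bochner_integral_indicator[OF A eA, of "L\<^sup>2"] by (simp add: has_bochner_integral_iff mA)
  finally show ?thesis .
qed

text \<open>The set A is where the cutoffs are at least c, uniformly in \<delta>, so m bounds their
  mass from below. The two cases of \<open>Ac\<close> are the region outside the layer and a region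
  deep inside \<open>\<Omega>\<close>. Letting \<delta> tend to 0 turns the slope bound 1 / (h - 4
  \<delta>) into 1 / h.\<close>

lemma layer_bound:
  fixes \<Omega> :: "'a::euclidean_space set"
  assumes \<Omega>: "open \<Omega>" "bounded \<Omega>" and lam: "dirichlet_eigenvalues \<Omega> lam" and k: "k \<ge> 1" and h: "h > 0"
    and A: "A \<in> lmeasurable" "A \<subseteq> \<Omega>" "c \<ge> 0" "c\<^sup>2 * measure lebesgue A > 0"
    and Ac: "(c = 1 \<and> A = \<Omega> - boundary_layer \<Omega> h) \<or> (c = 1 / 8 \<and> (\<forall>x\<in>A. infdist x (- \<Omega>) \<ge> h / 4))"
  defines "d \<equiv> DIM('a)" and "m \<equiv> c\<^sup>2 * measure lebesgue A" and "W \<equiv> measure lebesgue (boundary_layer \<Omega> h)"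
  shows "(1 / real k) * (\<Sum>j=1..k. lam j)
    \<le> real d / (real d + 2) * C_const d * (real k / m) powr (2 / real d) + W / (h\<^sup>2 * m)"
proof -
  have \<Omega>': "\<Omega> \<in> sets lebesgue" using \<Omega>(1) by simp
  have m: "m > 0" using A by (simp add: m_def)
  have Cpos: "C_const d \<ge> 0" by (simp add: C_const_def)
  have layer: "infdist x (- \<Omega>) > h" if "x \<in> \<Omega> - boundary_layer \<Omega> h" for x
    using that infdist_frontier_le[OF \<Omega>, of x] by (auto simp: boundary_layer_def)
  have step: "(1 / real k) * (\<Sum>j=1..k. lam j)
    \<le> real d / (real d + 2) * C_const d * (real k / m) powr (2 / real d) + (1 / (h - 4 * \<delta>))\<^sup>2 * W / m"
    if \<delta>: "\<delta> > 0" "20 * \<delta> \<le> h" for \<delta>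
  proof -
    obtain \<phi> G where \<phi>: "test_pair \<Omega> \<phi> G" "\<And>x. 0 \<le> \<phi> x" "\<And>x. \<phi> x \<le> 1"
      "\<And>x. infdist x (- \<Omega>) > h \<Longrightarrow> \<phi> x = 1" "\<And>x. infdist x (- \<Omega>) > h \<Longrightarrow> G x = 0"
      "\<And>x. norm (G x) \<le> 1 / (h - 4 * \<delta>)" "\<And>x. infdist x (- \<Omega>) \<ge> h / 4 \<Longrightarrow> \<phi> x \<ge> 1 / 8"
      using cutoff_exists[OF \<Omega> \<delta>] by metis
    note L = test_pair_in_L2[OF \<Omega>(1) \<phi>(1)]
    have "c \<le> \<bar>\<phi> x\<bar>" if "x \<in> A" for x
      using Ac layer[of x] that \<phi>(2,4,7)[of x] by auto
    then have mN: "m \<le> (L2_norm \<Omega> \<phi>)\<^sup>2"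
      unfolding m_def using A by (intro L2_norm_power2_ge[OF \<Omega>' L(1)]) auto
    then have N: "(L2_norm \<Omega> \<phi>)\<^sup>2 > 0" using m by linarith
    have GW: "(L2_norm \<Omega> G)\<^sup>2 \<le> (1 / (h - 4 * \<delta>))\<^sup>2 * W"
      unfolding W_def by (rule L2_norm_power2_le[OF \<Omega>' L(2) lmeasurable_boundary_layer[OF \<Omega>] _ \<phi>(6)])
        (use \<phi>(5) layer in \<open>auto simp: boundary_layer_def\<close>)
    have "\<bar>\<phi> x\<bar> \<le> 1" for x using \<phi>(2,3)[of x] by simp
    then have "(1 / real k) * (\<Sum>j=1..k. lam j)
      \<le> real d / (real d + 2) * C_const d * (real k / (L2_norm \<Omega> \<phi>)\<^sup>2) powr (2 / real d) + (L2_norm \<Omega> G)\<^sup>2 / (L2_norm \<Omega> \<phi>)\<^sup>2"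
      unfolding d_def using N by (intro eigenvalue_sum_bound[OF \<Omega> lam k \<phi>(1)]) auto
    \<comment> \<open>Both terms decrease with the mass, so it may be replaced by its lower bound
      m.\<close>
    also have "\<dots> \<le> real d / (real d + 2) * C_const d * (real k / m) powr (2 / real d) + (1 / (h - 4 * \<delta>))\<^sup>2 * W / m"
    proof (rule add_mono)
      show "real d / (real d + 2) * C_const d * (real k / (L2_norm \<Omega> \<phi>)\<^sup>2) powr (2 / real d)
        \<le> real d / (real d + 2) * C_const d * (real k / m) powr (2 / real d)"
        using mN m N Cpos by (intro mult_left_mono powr_mono2 divide_left_mono) auto
      show "(L2_norm \<Omega> G)\<^sup>2 / (L2_norm \<Omega> \<phi>)\<^sup>2 \<le> (1 / (h - 4 * \<delta>))\<^sup>2 * W / m"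
        using mN m GW by (intro frac_le) (auto simp: W_def)
    qed
    finally show ?thesis .
  qed
  have "((\<lambda>\<delta>. real d / (real d + 2) * C_const d * (real k / m) powr (2 / real d) + (1 / (h - 4 * \<delta>))\<^sup>2 * W / m)
     \<longlongrightarrow> real d / (real d + 2) * C_const d * (real k / m) powr (2 / real d) + (1 / (h - 4 * 0))\<^sup>2 * W / m) (at_right 0)"
    using h m by (intro tendsto_intros) auto
  moreover have "\<forall>\<^sub>F \<delta> in at_right 0. (1 / real k) * (\<Sum>j=1..k. lam j)
    \<le> real d / (real d + 2) * C_const d * (real k / m) powr (2 / real d) + (1 / (h - 4 * \<delta>))\<^sup>2 * W / m"
    by (rule eventually_at_rightI[of 0 "h / 20"]) (use step h in auto)
  ultimately have "(1 / real k) * (\<Sum>j=1..k. lam j)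
    \<le> real d / (real d + 2) * C_const d * (real k / m) powr (2 / real d) + (1 / (h - 4 * 0))\<^sup>2 * W / m"
    by (rule tendsto_lowerbound) simp
  then show ?thesis by (simp add: power_divide)
qed

lemma bdd_above_infdist_frontier:
  fixes \<Omega> :: "'a::euclidean_space set"
  assumes "bounded \<Omega>"
  shows "bdd_above ((\<lambda>x. infdist x (frontier \<Omega>)) ` \<Omega>)"
proof -
  have "bounded ((\<lambda>x. infdist x (frontier \<Omega>)) ` closure \<Omega>)"
    using assms by (intro compact_imp_bounded compact_continuous_image continuous_on_infdist continuous_on_id)
      (simp add: compact_closure)
  then have "bdd_above ((\<lambda>x. infdist x (frontier \<Omega>)) ` closure \<Omega>)" by (rule bounded_imp_bdd_above)
  then show ?thesis by (rule bdd_above_mono) (use closure_subset in blast)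
qed

text \<open>A lower bound for the mass \<open>\<parallel>\<phi>\<parallel>\<^sup>2\<close> of the cutoff function. The second case is needed when
  the layer is all of \<open>\<Omega>\<close>, which the hypothesis on \<open>k\<close> still permits for \<open>h\<close> equal to the inradius:
  then a ball of radius \<open>h / 4\<close> on which \<open>\<phi> \<ge> 1 / 8\<close> does the job.\<close>

definition layer_mass :: "nat \<Rightarrow> real \<Rightarrow> real \<Rightarrow> real \<Rightarrow> real" where
  "layer_mass d V W h = (if W < V then V - W else unit_ball_vol (real d) * (h / 4) ^ d / 64)"

lemma eigenvalue_sum_layer_mass_bound:
  fixes \<Omega> :: "'a::euclidean_space set"
  assumes \<Omega>: "open \<Omega>" "bounded \<Omega>" "\<Omega> \<noteq> {}" and lam: "dirichlet_eigenvalues \<Omega> lam" and k: "k \<ge> 1"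
    and h: "h > 0" "h \<le> inradius \<Omega>"
  defines "d \<equiv> DIM('a)" and "W \<equiv> measure lebesgue (boundary_layer \<Omega> h)"
  defines "m \<equiv> layer_mass d (measure lebesgue \<Omega>) W h"
  shows "(1 / real k) * (\<Sum>j=1..k. lam j)
    \<le> real d / (real d + 2) * C_const d * (real k / m) powr (2 / real d) + W / (h\<^sup>2 * m)"
proof (cases "W < measure lebesgue \<Omega>")
  case True
  let ?A = "\<Omega> - boundary_layer \<Omega> h"
  have \<Omega>': "\<Omega> \<in> lmeasurable" using \<Omega> by (simp add: lmeasurable_open)
  have sub: "boundary_layer \<Omega> h \<subseteq> \<Omega>" by (auto simp: boundary_layer_def)
  have A: "?A \<in> lmeasurable" by (intro fmeasurable.Diff \<Omega>' lmeasurable_boundary_layer[OF \<Omega>(1,2)])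
  have mA: "measure lebesgue ?A = measure lebesgue \<Omega> - W"
    unfolding W_def using \<Omega>' sub lmeasurable_boundary_layer[OF \<Omega>(1,2), of h]
    by (intro measure_Diff) (auto simp: fmeasurable_def)
  have m: "m = 1\<^sup>2 * measure lebesgue ?A" using True by (simp add: m_def layer_mass_def mA)
  have pos: "1\<^sup>2 * measure lebesgue ?A > 0" using True mA by simp
  show ?thesis
    unfolding d_def W_def m by (rule layer_bound[OF \<Omega>(1,2) lam k h(1) A _ _ pos]) auto
next
  case False
  \<comment> \<open>The strict inequality provides a point x farther than h / 2 from the frontier.
    Points within h / 4 of x keep distance h / 4, where the cutoff is at least 1 / 8; its square is
    the 1 / 64 in \<open>layer_mass\<close>.\<close>
  have "h / 2 < inradius \<Omega>" using h by simp
  then obtain x where x: "x \<in> \<Omega>" "h / 2 < infdist x (frontier \<Omega>)"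
    unfolding inradius_def using less_cSUP_iff[OF \<Omega>(3) bdd_above_infdist_frontier[OF \<Omega>(2)]] by blast
  then have Dx: "h / 2 < infdist x (- \<Omega>)" using infdist_frontier_le[OF \<Omega>(1,2) x(1)] by simp
  let ?A = "ball x (h / 4)"
  have DA: "infdist y (- \<Omega>) \<ge> h / 4" if "y \<in> ?A" for y
    using infdist_triangle[of x "- \<Omega>" y] Dx that by simp
  have sub: "?A \<subseteq> \<Omega>"
  proof
    fix y assume "y \<in> ?A"
    from DA[OF this] h have "infdist y (- \<Omega>) \<noteq> 0" by simp
    then show "y \<in> \<Omega>" by (cases "y \<in> \<Omega>") auto
  qed
  have "measure lebesgue ?A = unit_ball_vol (real d) * (h / 4) ^ d"
    using h by (simp add: content_ball d_def)
  then have m: "m = (1 / 8)\<^sup>2 * measure lebesgue ?A" "(1 / 8)\<^sup>2 * measure lebesgue ?A > 0"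
    using False h by (simp_all add: m_def layer_mass_def power2_eq_square)
  show ?thesis
    unfolding d_def W_def m(1) by (rule layer_bound[OF \<Omega>(1,2) lam k h(1) _ sub _ m(2)]) (use DA in auto)
qed

section \<open>The layer width and the size of the remainder\<close>

lemma C_const_pos: "C_const d > 0"
proof -
  have "unit_ball_vol (real d) > 0" by simp
  then have "unit_ball_vol (real d) \<noteq> 0" by linarith
  then show ?thesis unfolding C_const_def by (intro mult_pos_pos) simp_all
qed

text \<open>In the notation K = (k/V)^(1/d) and B = (2 C_d/(d+2))^(1/2) this says h(k) = 1 / (B K),
  the form in which the width enters all later computations.\<close>

lemma layer_width_eq:
  assumes "d > 0" "V > 0" "k \<ge> 1"
  shows "layer_width d V k * (real k / V) powr (1 / real d) = ((real d + 2) / (2 * C_const d)) powr (1 / 2)"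
proof -
  have C: "C_const d > 0" by (rule C_const_pos)
  have 1: "V powr (1 / real d) * real k powr (- 1 / real d) * (real k / V) powr (1 / real d) = 1"
    using assms by (simp add: powr_divide powr_minus divide_simps)
  have "layer_width d V k * (real k / V) powr (1 / real d)
     = (real d + 2) powr (1 / 2) * (2 * C_const d) powr (- 1 / 2) * (V powr (1 / real d) * real k powr (- 1 / real d) * (real k / V) powr (1 / real d))"
    by (simp only: layer_width_def mult.assoc)
  also have "\<dots> = (real d + 2) powr (1 / 2) * (2 * C_const d) powr (- (1 / 2))" unfolding 1 by simp
  also have "\<dots> = ((real d + 2) / (2 * C_const d)) powr (1 / 2)"
    using C by (simp add: powr_minus_divide powr_divide)
  finally show ?thesis .
qed

text \<open>The origin of the threshold on k: it is the condition h(k) \<le> r, solved for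
  k.\<close>

lemma layer_width_le:
  assumes d: "d > 0" and V: "V > 0" and k: "k \<ge> 1" and r: "r > 0"
    and le: "real k \<ge> V * r powr (- real d) * ((real d + 2) / (2 * C_const d)) powr (real d / 2)"
  shows "layer_width d V k \<le> r"
proof -
  have C: "C_const d > 0" by (rule C_const_pos)
  define b where "b = ((real d + 2) / (2 * C_const d)) powr (1 / 2)"
  have b: "b > 0" using C by (simp add: b_def)
  have bd: "((real d + 2) / (2 * C_const d)) powr (real d / 2) = b powr real d"
    by (simp add: b_def powr_powr)
  have "(b / r) powr real d \<le> real k / V"
    using le V r b unfolding bd by (simp add: powr_divide powr_minus field_simps)
  then have "((b / r) powr real d) powr (1 / real d) \<le> (real k / V) powr (1 / real d)"
    by (intro powr_mono2) auto
  then have "b / r \<le> (real k / V) powr (1 / real d)"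
    using d b r by (simp add: powr_powr)
  then have "b \<le> r * (real k / V) powr (1 / real d)" using r by (simp add: field_simps)
  then have "layer_width d V k * (real k / V) powr (1 / real d) \<le> r * (real k / V) powr (1 / real d)"
    using layer_width_eq[OF d V k] by (simp add: b_def)
  then show ?thesis using k V by simp
qed

text \<open>Everything in the bound beyond the two leading terms. The inequality of the theorem then
  holds by rearrangement, and the analytic content is that this difference is small. The domain
  enters only through V, S and W.\<close>

definition layer_remainder :: "nat \<Rightarrow> nat \<Rightarrow> real \<Rightarrow> real \<Rightarrow> real \<Rightarrow> real" where
  "layer_remainder k d V S W =
    (let h = layer_width d V k; m = layer_mass d V W h
     in real d / (real d + 2) * C_const d * (real k / m) powr (2 / real d) + W / (h\<^sup>2 * m)
       - real d / (real d + 2) * C_const d * (real k / V) powr (2 / real d)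
       - 2 * (2 * C_const d / (real d + 2)) powr (1/2) * (S / V) * (real k / V) powr (1 / real d))"

text \<open>Divided by K, each of the two corrections tends to B S / V: one through the derivative
  2/d of (1 - x)^(-2/d) at 0 with x = w / V, the other through the energy w / (h^2 (V - w)).
  Together they cancel the subtracted term 2 B S / V.\<close>

lemma layer_remainder_smallo:
  fixes W :: "real \<Rightarrow> real"
  assumes d: "d > 0" and V: "V > 0" and lim: "((\<lambda>h. W h / h) \<longlongrightarrow> S) (at_right 0)"
  shows "(\<lambda>k. layer_remainder k d V S (W (layer_width d V k))) \<in> o(\<lambda>k. real k powr (1 / real d))"
proof (rule smalloI_tendsto)
  have C: "C_const d > 0" by (rule C_const_pos)
  define B where "B = (2 * C_const d / (real d + 2)) powr (1 / 2)"
  have B: "B > 0" using C by (simp add: B_def)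
  have B2: "B\<^sup>2 = 2 * C_const d / (real d + 2)"
    using C by (simp add: B_def powr_half_sqrt)
  have AB: "real d / (real d + 2) * C_const d = real d / 2 * B\<^sup>2" unfolding B2 by simp
  have invB: "((real d + 2) / (2 * C_const d)) powr (1 / 2) = 1 / B"
    using C by (simp add: B_def powr_divide)
  define h where "h k = layer_width d V k" for k
  define K where "K k = (real k / V) powr (1 / real d)" for k :: nat
  have hK: "h k * K k = 1 / B" if "k \<ge> 1" for k
    using layer_width_eq[OF d V that] by (simp add: h_def K_def invB)
  have Kpos: "K k > 0" if "k \<ge> 1" for k using that V by (simp add: K_def)
  have hpos: "h k > 0" if "k \<ge> 1" for k using hK[OF that] Kpos[OF that] B by (metis divide_pos_pos zero_less_mult_pos2 zero_less_one)
  have "filterlim (\<lambda>k. real k / V) at_top sequentially"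
    using V by real_asymp
  then have Ktop: "filterlim K at_top sequentially"
    unfolding K_def[abs_def] using d V by (intro filterlim_compose[OF _ \<open>filterlim (\<lambda>k. real k / V) at_top sequentially\<close>]) real_asymp
  have "((\<lambda>k. (1 / B) / K k) \<longlongrightarrow> 0) sequentially"
    by (rule tendsto_divide_0[OF tendsto_const filterlim_at_top_imp_at_infinity[OF Ktop]])
  moreover have "\<forall>\<^sub>F k in sequentially. (1 / B) / K k = h k"
    using eventually_ge_at_top[of 1] by (eventually_elim, unfold hK[symmetric], use Kpos in \<open>force\<close>)
  ultimately have h0: "h \<longlonglongrightarrow> 0" by (rule Lim_transform_eventually)
  have hr: "filterlim h (at_right 0) sequentially"
  proof (rule tendsto_imp_filterlim_at_right[OF h0])
    show "\<forall>\<^sub>F k in sequentially. h k > 0"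
      using eventually_ge_at_top[of 1] by eventually_elim (rule hpos)
  qed
  define w where "w k = W (h k)" for k
  have q: "(\<lambda>k. w k / h k) \<longlonglongrightarrow> S"
    unfolding w_def by (rule filterlim_compose[OF lim hr])
  have t: "(\<lambda>k. w k / h k * h k) \<longlonglongrightarrow> 0" using tendsto_mult[OF q h0] by simp
  have e: "\<forall>\<^sub>F k in sequentially. w k / h k * h k = w k"
    using eventually_ge_at_top[of 1]
  proof eventually_elim
    case (elim k)
    then show ?case using hpos[OF elim] by simp
  qed
  have w0: "w \<longlonglongrightarrow> 0" by (rule Lim_transform_eventually[OF t e])
  define f where "f x = (1 - x) powr (- 2 / real d)" for x
  have "(f has_real_derivative (2 / real d)) (at 0)"
    unfolding f_def[abs_def] by (auto intro!: derivative_eq_intros)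
  \<comment> \<open>Caratheodory's form of the derivative: an exact factorization with
    \<open>g\<close> continuous at 0 replaces a Taylor expansion with remainder.\<close>
  then obtain g where g: "\<And>z. f z - f 0 = g z * (z - 0)" "isCont g 0" "g 0 = 2 / real d"
    unfolding CARAT_DERIV by blast
  have x0: "(\<lambda>k. w k / V) \<longlonglongrightarrow> 0" using tendsto_divide[OF w0 tendsto_const, of V] V by simp
  have gx: "(\<lambda>k. g (w k / V)) \<longlonglongrightarrow> 2 / real d"
    using isCont_tendsto_compose[OF g(2) x0] g(3) by simp
  have "(\<lambda>k. real d / 2 * B\<^sup>2 * (w k / h k / (B * V) * g (w k / V)) + w k / h k * (B / (V - w k)) - 2 * B * (S / V))
     \<longlonglongrightarrow> real d / 2 * B\<^sup>2 * (S / (B * V) * (2 / real d)) + S * (B / (V - 0)) - 2 * B * (S / V)"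
    using V B by (intro tendsto_intros q gx w0) auto
  also have "real d / 2 * B\<^sup>2 * (S / (B * V) * (2 / real d)) + S * (B / (V - 0)) - 2 * B * (S / V) = 0"
    using V B d by (simp add: field_simps power2_eq_square)
  finally have main: "(\<lambda>k. real d / 2 * B\<^sup>2 * (w k / h k / (B * V) * g (w k / V)) + w k / h k * (B / (V - w k)) - 2 * B * (S / V)) \<longlonglongrightarrow> 0" .
  have "\<forall>\<^sub>F k in sequentially. real d / 2 * B\<^sup>2 * (w k / h k / (B * V) * g (w k / V)) + w k / h k * (B / (V - w k)) - 2 * B * (S / V)
     = layer_remainder k d V S (W (layer_width d V k)) / K k"
    using eventually_ge_at_top[of 1] order_tendstoD(2)[OF w0 V]
  proof eventually_elim
    case (elim k)
    note pos = hpos[OF elim(1)] Kpos[OF elim(1)]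
    \<comment> \<open>For large k the layer has volume below V, so the second case of
      \<open>layer_mass\<close> does not affect the asymptotics.\<close>
    have m: "layer_mass d V (w k) (h k) = V - w k" using elim by (simp add: layer_mass_def)
    have Vw: "V - w k = V * (1 - w k / V)" using V by (simp add: field_simps)
    have x1: "1 - w k / V > 0" using elim V by (simp add: field_simps)
    have K2: "(real k / V) powr (2 / real d) = (K k)\<^sup>2"
      using V elim by (simp add: K_def powr_power)
    have "(real k / (V - w k)) powr (2 / real d) = (real k / V / (1 - w k / V)) powr (2 / real d)"
      unfolding Vw by simp
    also have "\<dots> = (real k / V) powr (2 / real d) / (1 - w k / V) powr (2 / real d)"
      by (rule powr_divide)
    also have "\<dots> = (K k)\<^sup>2 * f (w k / V)"
      using powr_minus_divide[of "1 - w k / V" "2 / real d"] by (simp add: K2 f_def)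
    also have "f (w k / V) = 1 + g (w k / V) * (w k / V)"
      using g(1)[of "w k / V"] by (simp add: f_def)
    finally have p: "(real k / (V - w k)) powr (2 / real d) = (K k)\<^sup>2 * (1 + g (w k / V) * (w k / V))" .
    \<comment> \<open>With this relation every remaining term is K times a convergent expression,
      and the two copies of the leading term cancel.\<close>
    have Bh: "B = 1 / (h k * K k)" using hK[OF elim(1)] B by simp
    have "layer_remainder k d V S (W (layer_width d V k)) = real d / 2 * B\<^sup>2 * ((K k)\<^sup>2 * (1 + g (w k / V) * (w k / V)))
        + w k / ((h k)\<^sup>2 * (V - w k)) - real d / 2 * B\<^sup>2 * (K k)\<^sup>2 - 2 * B * (S / V) * K k"
      unfolding layer_remainder_def Let_def AB h_def[symmetric] w_def[symmetric] m p K2 B_def[symmetric] K_def[symmetric] ..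
    also have "\<dots> = K k * (real d / 2 * B\<^sup>2 * (w k / h k / (B * V) * g (w k / V)) + w k / h k * (B / (V - w k)) - 2 * B * (S / V))"
    proof -
      have 1: "K k * (w k / V) = w k / h k / (B * V)" "1 / (h k)\<^sup>2 = K k * (B / h k)"
        unfolding Bh using pos by (simp_all add: field_simps power2_eq_square)
      have 2: "w k / ((h k)\<^sup>2 * (V - w k)) = w k * (1 / (h k)\<^sup>2) / (V - w k)" by simp
      have 3: "(K k)\<^sup>2 * (1 + g (w k / V) * (w k / V)) = (K k)\<^sup>2 + K k * g (w k / V) * (K k * (w k / V))"
        by (simp add: algebra_simps power2_eq_square)
      show ?thesis unfolding 2 3 1 by (simp add: algebra_simps)
    qed
    finally show ?case using pos by simp
  qed
  with main have "(\<lambda>k. layer_remainder k d V S (W (layer_width d V k)) / K k) \<longlonglongrightarrow> 0"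
    by (rule Lim_transform_eventually)
  \<comment> \<open>K and k^(1/d) differ by the constant factor V^(-1/d).\<close>
  from tendsto_mult[OF this tendsto_const[of "(1 / V) powr (1 / real d)"]]
  have "(\<lambda>k. layer_remainder k d V S (W (layer_width d V k)) / K k * (1 / V) powr (1 / real d)) \<longlonglongrightarrow> 0" by simp
  moreover have "\<forall>\<^sub>F k in sequentially. layer_remainder k d V S (W (layer_width d V k)) / K k * (1 / V) powr (1 / real d)
     = layer_remainder k d V S (W (layer_width d V k)) / real k powr (1 / real d)"
    using eventually_ge_at_top[of 1]
    by eventually_elim (use V in \<open>simp add: K_def powr_divide\<close>)
  ultimately show "(\<lambda>k. layer_remainder k d V S (W (layer_width d V k)) / real k powr (1 / real d)) \<longlonglongrightarrow> 0"
    by (rule Lim_transform_eventually)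
  show "\<forall>\<^sub>F k in sequentially. real k powr (1 / real d) \<noteq> 0"
    using eventually_ge_at_top[of 1] by eventually_elim simp
qed

lemma inradius_pos:
  fixes \<Omega> :: "'a::euclidean_space set"
  assumes \<Omega>: "open \<Omega>" "bounded \<Omega>" "\<Omega> \<noteq> {}"
  shows "inradius \<Omega> > 0"
proof -
  obtain x where x: "x \<in> \<Omega>" using \<Omega>(3) by blast
  have "\<Omega> \<noteq> UNIV" using \<Omega>(2) not_bounded_UNIV by blast
  then have "frontier \<Omega> \<noteq> {}" using \<Omega>(3) by (simp add: frontier_eq_empty)
  moreover have "x \<notin> frontier \<Omega>" using x \<Omega>(1) by (simp add: frontier_def interior_open)
  ultimately have "infdist x (frontier \<Omega>) > 0"
    using in_closed_iff_infdist_zero[OF frontier_closed, of \<Omega> x] infdist_nonneg[of x "frontier \<Omega>"] by linarith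
  also have "\<dots> \<le> inradius \<Omega>"
    unfolding inradius_def by (rule cSUP_upper[OF x bdd_above_infdist_frontier[OF \<Omega>(2)]])
  finally show ?thesis .
qed

text \<open>Quantifying \<open>F\<close> before the domain expresses that the remainder depends on
  the listed numbers only; the witness is \<open>layer_remainder\<close>.\<close>

theorem theorem2p23:
  fixes d :: nat
  assumes d_def: "d = DIM('a::euclidean_space)" and "d \<ge> 2"
  shows "\<exists>F :: nat \<Rightarrow> nat \<Rightarrow> real \<Rightarrow> real \<Rightarrow> real \<Rightarrow> real.
    \<forall>(\<Omega> :: 'a set) (lam :: nat \<Rightarrow> real) (V :: real) (S :: real) (R :: nat \<Rightarrow> real).
      open \<Omega> \<and> connected \<Omega> \<and> \<Omega> \<noteq> {} \<and> bounded \<Omega> \<and>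
      V = measure lebesgue \<Omega> \<and>
      boundary_area \<Omega> < \<infinity> \<and> S = enn2real (boundary_area \<Omega>) \<and>
      ((\<lambda>h. measure lebesgue (boundary_layer \<Omega> h) / h) \<longlongrightarrow> S) (at_right 0) \<and>
      dirichlet_eigenvalues \<Omega> lam \<and>
      R = (\<lambda>k. F k d V S (measure lebesgue (boundary_layer \<Omega> (layer_width d V k))))
      \<longrightarrow>
      (\<forall>k::nat. 1 \<le> k \<and>
         real k \<ge> V * inradius \<Omega> powr (- real d)
                    * ((real d + 2) / (2 * C_const d)) powr (real d / 2) \<longrightarrow>
         (1 / real k) * (\<Sum>j=1..k. lam j)
           \<le> real d / (real d + 2) * C_const d * (real k / V) powr (2 / real d)
             + 2 * (2 * C_const d / (real d + 2)) powr (1/2) * (S / V) * (real k / V) powr (1 / real d)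
             + R k) \<and>
      R \<in> o(\<lambda>k. real k powr (1 / real d))"
proof (intro exI[of _ layer_remainder] allI impI conjI; elim conjE)
  fix \<Omega> :: "'a set" and lam V S R
  assume \<Omega>: "open \<Omega>" "\<Omega> \<noteq> {}" "bounded \<Omega>" and V: "V = measure lebesgue \<Omega>"
    and lim: "((\<lambda>h. measure lebesgue (boundary_layer \<Omega> h) / h) \<longlongrightarrow> S) (at_right 0)"
    and lam: "dirichlet_eigenvalues \<Omega> lam"
    and R: "R = (\<lambda>k. layer_remainder k d V S (measure lebesgue (boundary_layer \<Omega> (layer_width d V k))))"
  have d: "d > 0" using \<open>d \<ge> 2\<close> by simp
  have Vpos: "V > 0"
  proof -
    have "\<not> negligible \<Omega>" using open_not_negligible \<Omega> by blast
    moreover have "\<Omega> \<in> lmeasurable" using \<Omega> by (simp add: lmeasurable_open)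
    ultimately have "measure lebesgue \<Omega> \<noteq> 0" using negligible_iff_measure by blast
    then show ?thesis unfolding V by (simp add: zero_less_measure_iff)
  qed
  show "R \<in> o(\<lambda>k. real k powr (1 / real d))"
    unfolding R by (rule layer_remainder_smallo[OF d Vpos lim])
  fix k :: nat
  assume k: "1 \<le> k" and ge: "real k \<ge> V * inradius \<Omega> powr (- real d) * ((real d + 2) / (2 * C_const d)) powr (real d / 2)"
  have hle: "layer_width d V k \<le> inradius \<Omega>"
    by (rule layer_width_le[OF d Vpos k inradius_pos[OF \<Omega>(1,3,2)] ge])
  have hpos: "layer_width d V k > 0"
    using Vpos k C_const_pos[of d] by (simp add: layer_width_def)
  from eigenvalue_sum_layer_mass_bound[OF \<Omega>(1,3,2) lam k hpos hle]
  show "(1 / real k) * (\<Sum>j=1..k. lam j)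
           \<le> real d / (real d + 2) * C_const d * (real k / V) powr (2 / real d)
             + 2 * (2 * C_const d / (real d + 2)) powr (1/2) * (S / V) * (real k / V) powr (1 / real d)
             + R k"
    unfolding R layer_remainder_def Let_def d_def[symmetric] V[symmetric] by simp
qed

end
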